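(* Let $M,u\not\equiv-\infty$ be subharmonic functions on $\mathbb{C}$ of finite type ($\limsup_{z\to\infty}M(z)/|z|<+\infty$, same for $u$) with Riesz measures $\mu=\frac1{2\pi}\Delta M$, $\nu=\frac1{2\pi}\Delta u$. Let $q_0\colon\mathbb{R}\to[0,+\infty]$ be locally Lebesgue integrable with $\limsup_{|y|\to+\infty}q_0(y)/|y|<+\infty$; $q\colon\mathbb{R}\to[0,+\infty)$ continuous with $\limsup_{|y|\to+\infty}q(y)/|y|<1$; $E\subset[0,+\infty)$ Lebesgue measurable with $q_E(r):=\mathrm{mes}(E\cap[0,r])\ln\frac{er}{\mathrm{mes}(E\cap[0,r])}=:q_E(-r)$ for $r>0$ ($:=0$ if the measure is $0$). Assume that for every $y\in[0,+\infty)\setminus E$: $u(iy)+u(-iy)\le\mathsf C_M(iy,q(y))+\mathsf C_M(-iy,q(-y))+q_0(y)+q_0(-y)$. Let $Q(s):=q(s)+q(-s)$, $Q_N(s):=Q(s)/s^{2+N}$, and assume either (i) for some $N\ge0$, $Q_N$ is decreasing on some interval $(A,+\infty)$, or (ii) $Q$ is continuously differentiable on some interval $(A,+\infty)$ with $\limsup_{y\to+\infty}yQ'(y)/Q(y)<+\infty$. Assume finally that $\ln\text{-}\mathrm{dens}\bigl(J_{\mathbb{R}}(\cdot,\cdot;q_0+q+q_E)\bigr)=0$. Then $$\ln\text{-}\mathrm{dens}(l_\nu)\le\min\bigl\{\ln\text{-}\mathrm{dens}(l^{\mathrm{rh}}_\mu),\ln\text{-}\mathrm{dens}(l^{\mathr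m{lh}}_\mu)\bigr\}\le\ln\text{-}\mathrm{dens}(l_\mu).$$
   Context: $\mathsf C_M(z,r):=\frac1{2\pi}\int_0^{2\pi}M(z+re^{i\theta})\,d\theta$. $J_{\mathbb{R}}(r,R;v):=\frac{1}{2\pi}\int_r^R\frac{v(x)+v(-x)}{x^2}\,dx$. For a positive Borel measure $\mu$ and $0<r<R$: $l^{\mathrm{rh}}_\mu(r,R):=\int_{r<|z|\le R,\ \mathrm{Re}\,z>0}\mathrm{Re}\frac1z\,d\mu$, $l^{\mathrm{lh}}_\mu(r,R):=\int_{r<|z|\le R,\ \mathrm{Re}\,z<0}\mathrm{Re}(-\frac1z)\,d\mu$, $l_\mu:=\max\{l^{\mathrm{lh}}_\mu,l^{\mathrm{rh}}_\mu\}$. For a function of intervals $l$ (defined on intervals $(r,R]$ near $+\infty$), $\ln\text{-}\mathrm{dens}(l):=\limsup_{a\to+\infty}\frac{1}{\ln a}\limsup_{r\to+\infty}l(r,ar)$. (For logarithmic submeasures of intervals — nonnegative, subadditive interval functions with $\sup_{r\ge r_0}l(r,2r)<\infty$, a class containing all interval functions appearing here — it is known that this limsup in $a$ is a finite limit and equals $\inf_{a>1}\frac1{\ln a}\limsup_{r\to\infty}l(r,ar)$ as well as $\inf\{b\ge0:\sup_{r_0\le r<R}(l(r,R)-b\ln(R/r))<\infty\}$.) $\mathrm{mes}$ is Lebesgue measure. *)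

theory Defs
  imports "HOL-Analysis.Analysis"
begin

definition circle_mean :: "(complex \<Rightarrow> ereal) \<Rightarrow> complex \<Rightarrow> real \<Rightarrow> ereal" where
  "circle_mean M z r =
     ereal (1 / (2 * pi)) *
       (enn2ereal (\<integral>\<^sup>+ \<theta>. indicator {0..2*pi} \<theta> * e2ennreal (M (z + of_real r * cis \<theta>)) \<partial>lborel)
      - enn2ereal (\<integral>\<^sup>+ \<theta>. indicator {0..2*pi} \<theta> * e2ennreal (- M (z + of_real r * cis \<theta>)) \<partial>lborel))"

definition subharmonic_C :: "(complex \<Rightarrow> ereal) \<Rightarrow> bool" where
  "subharmonic_C u \<longleftrightarrow>
     (\<forall>z. u z < \<infinity>) \<and>
     (\<forall>z. Limsup (at z) u \<le> u z) \<and>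
     (\<forall>z r. r > 0 \<longrightarrow> u z \<le> circle_mean u z r)"

definition finite_type :: "(complex \<Rightarrow> ereal) \<Rightarrow> bool" where
  "finite_type u \<longleftrightarrow> Limsup at_infinity (\<lambda>z. u z / ereal (norm z)) < \<infinity>"

definition pd :: "(complex \<Rightarrow> real) \<Rightarrow> complex \<Rightarrow> complex \<Rightarrow> real" where
  "pd f v z = deriv (\<lambda>t::real. f (z + of_real t * v)) 0"

definition partial_exists :: "(complex \<Rightarrow> real) \<Rightarrow> complex \<Rightarrow> bool" where
  "partial_exists f v \<longleftrightarrow> (\<forall>z. (\<lambda>t::real. f (z + of_real t * v)) differentiable (at 0))"

definition test_fun :: "(complex \<Rightarrow> real) \<Rightarrow> bool" where
  "test_fun f \<longleftrightarrow> bounded {z. f z \<noteq> 0} \<and>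
     (\<forall>v \<in> {1, \<i>}. partial_exists f v) \<and>
     (\<forall>v \<in> {1, \<i>}. \<forall>w \<in> {1, \<i>}. partial_exists (pd f v) w \<and> continuous_on UNIV (pd (pd f v) w))"

definition laplacian :: "(complex \<Rightarrow> real) \<Rightarrow> complex \<Rightarrow> real" where
  "laplacian f z = pd (pd f 1) 1 z + pd (pd f \<i>) \<i> z"

definition riesz_measure :: "(complex \<Rightarrow> ereal) \<Rightarrow> complex measure \<Rightarrow> bool" where
  "riesz_measure u \<mu> \<longleftrightarrow>
     sets \<mu> = sets borel \<and>
     (\<forall>K. compact K \<longrightarrow> emeasure \<mu> K < \<infinity>) \<and>
     (\<forall>\<phi>. test_fun \<phi> \<longrightarrow>
        (\<integral>z. \<phi> z \<partial>\<mu>) = (1 / (2 * pi)) * (\<integral>z. real_of_ereal (u z) * laplacian \<phi> z \<partial>lborel))"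

definition J_R :: "(real \<Rightarrow> ereal) \<Rightarrow> real \<Rightarrow> real \<Rightarrow> ereal" where
  "J_R v r R = ereal (1 / (2 * pi)) *
     enn2ereal (\<integral>\<^sup>+ x. indicator {r..R} x * e2ennreal ((v x + v (-x)) / ereal (x^2)) \<partial>lborel)"

definition l_rh :: "complex measure \<Rightarrow> real \<Rightarrow> real \<Rightarrow> ereal" where
  "l_rh \<mu> r R = enn2ereal (\<integral>\<^sup>+ z. indicator {z. r < cmod z \<and> cmod z \<le> R \<and> Re z > 0} z
                                   * ennreal (Re (1 / z)) \<partial>\<mu>)"

definition l_lh :: "complex measure \<Rightarrow> real \<Rightarrow> real \<Rightarrow> ereal" where
  "l_lh \<mu> r R = enn2ereal (\<integral>\<^sup>+ z. indicator {z. r < cmod z \<and> cmod z \<le> R \<and> Re z < 0} z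
                                   * ennreal (Re (- 1 / z)) \<partial>\<mu>)"

definition l_meas :: "complex measure \<Rightarrow> real \<Rightarrow> real \<Rightarrow> ereal" where
  "l_meas \<mu> r R = max (l_lh \<mu> r R) (l_rh \<mu> r R)"

definition ln_dens :: "(real \<Rightarrow> real \<Rightarrow> ereal) \<Rightarrow> ereal" where
  "ln_dens l = Limsup at_top (\<lambda>a. ereal (1 / ln a) * Limsup at_top (\<lambda>r. l r (a * r)))"

definition qE :: "real set \<Rightarrow> real \<Rightarrow> real" where
  "qE E x = (let m = measure lebesgue (E \<inter> {0..\<bar>x\<bar>}) in
              if m = 0 then 0 else m * ln (exp 1 * \<bar>x\<bar> / m))"

end

(*
  Fix a scale t. Subtract a subharmonic function of finite type from the bound B t valid for |z| = O(t);
  this gives a nonnegative lower semicontinuous supermean function N, and the Riesz formula reads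
  int N Lap(phi) = - 2 pi int phi d mu for test functions phi. Take phi(z) = f(Re z) p(|z|^2), where f is a smoothed
  positive part at scale rho and p is 1/s cut off to the ring t < |z| < 4 t. Then phi approximates (Re 1/z)^+ on
  the ring, int phi d mu is the mass contribution of the ring, f'' turns the left-hand side into an average of
  vertical line integrals of N near the imaginary axis, and the remaining terms come only from the cutoffs and
  telescope over dyadic rings (a Carleman formula without boundary regularity).

  For u the limit rho -> 0 and lower semicontinuity bound the integral of the defect of u over the axis from above.
  For M circle means are monotone in the radius, so if q <= rho on the ring, the defect of C_M(iy, q(y)) dominates
  an average of N over an annulus of size rho; the error is O(rho / t), and the regularity of Q makes the sum of
  these errors O(J(q)). On the exceptional set, N is bounded by the logarithmic potential of mu, whose integral over
  a set of measure m is O(t m log(4 e t / m)), that is, controlled by q_E. Summing over rings bounds l_nu on either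
  side by l_mu on either side up to O(1 + J), on a slightly larger interval, which the logarithmic density ignores.
*)
theory Submission
  imports Defs
begin

text \<open>On the imaginary axis both defects may be infinite, so no formula with boundary values
  is available there. The two functions are therefore treated asymmetrically. For u an upper bound
  suffices, and lower semicontinuity gives it in the limit. For M a lower bound is required, which
  semicontinuity cannot give; the identity is kept at a positive scale \<rho>, and the averaging
  kernel lives on an annulus with radii from \<rho> to 2 \<rho>. Every radius is then at least q,
  and each circle mean of N is at most the one of radius q.

  The second derivative of the smoothed positive part is even, so the axis term does not see which
  half-plane was chosen. This is why each side of \<nu> can be compared with each side of \<mu>, and
  why a minimum stands in the conclusion.

  The level B t is common to M and u. It cancels in the pointwise comparison, and its contributions
  to the two cutoff terms agree, so the difference of these terms is free of t. Only this difference
  telescopes over dyadic rings, since each ring has its own level.\<close>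

section \<open>Lebesgue measure on the complex plane\<close>

text \<open>Lebesgue measure is determined by its values on boxes, and a box in the plane is a
  product of intervals; this opens the plane to Fubini.\<close>

lemma lborel_complex:
  "(lborel :: complex measure) = distr (lborel \<Otimes>\<^sub>M lborel) borel (\<lambda>(x, y). Complex x y)"
proof (rule lborel_eqI)
  fix l u :: complex
  assume le: "\<And>b. b \<in> Basis \<Longrightarrow> l \<bullet> b \<le> u \<bullet> b"
  have le': "Re l \<le> Re u" "Im l \<le> Im u"
    using le[of 1] le[of \<i>] by (auto simp: Basis_complex_def)
  have m: "(\<lambda>(x, y). Complex x y) \<in> borel_measurable (lborel \<Otimes>\<^sub>M lborel)"
    unfolding Complex_eq by measurable
  have "(\<lambda>(x, y). Complex x y) -` box l u \<inter> space (lborel \<Otimes>\<^sub>M lborel)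
      = {Re l<..<Re u} \<times> {Im l<..<Im u}"
    by (auto simp: box_def Basis_complex_def space_pair_measure)
  then show "emeasure (distr (lborel \<Otimes>\<^sub>M lborel) borel (\<lambda>(x, y). Complex x y)) (box l u)
      = (\<Prod>b\<in>Basis. (u - l) \<bullet> b)"
    using le' by (simp add: emeasure_distr m lborel.emeasure_pair_measure_Times Basis_complex_def
        ennreal_mult complex_eq_iff)
qed simp

lemma measurable_Complex [measurable]: "(\<lambda>(x, y). Complex x y) \<in> borel_measurable (borel \<Otimes>\<^sub>M borel)"
  unfolding Complex_eq by measurable

lemma measurable_Complex2 [measurable (raw)]:
  assumes [measurable]: "f \<in> borel_measurable A" "g \<in> borel_measurable A"
  shows "(\<lambda>x. Complex (f x) (g x)) \<in> borel_measurable A"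
  unfolding Complex_eq by measurable

lemma nn_integral_complex:
  assumes [measurable]: "f \<in> borel_measurable borel"
  shows "(\<integral>\<^sup>+ z. f z \<partial>lborel) = (\<integral>\<^sup>+ x. \<integral>\<^sup>+ y. f (Complex x y) \<partial>lborel \<partial>lborel)"
proof -
  have "(\<integral>\<^sup>+ z. f z \<partial>lborel) = (\<integral>\<^sup>+ p. f (case p of (x, y) \<Rightarrow> Complex x y) \<partial>(lborel \<Otimes>\<^sub>M lborel))"
    by (subst lborel_complex, subst nn_integral_distr) auto
  also have "\<dots> = (\<integral>\<^sup>+ x. \<integral>\<^sup>+ y. f (Complex x y) \<partial>lborel \<partial>lborel)"
    by (subst lborel.nn_integral_fst[symmetric]) auto
  finally show ?thesis .
qed

lemma nn_integral_complex':
  assumes [measurable]: "f \<in> borel_measurable borel"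
  shows "(\<integral>\<^sup>+ z. f z \<partial>lborel) = (\<integral>\<^sup>+ y. \<integral>\<^sup>+ x. f (Complex x y) \<partial>lborel \<partial>lborel)"
  unfolding nn_integral_complex[OF assms] by (rule lborel_pair.Fubini'[symmetric]) measurable

lemma nn_integral_shift:
  fixes f :: "real \<Rightarrow> ennreal"
  assumes "f \<in> borel_measurable borel"
  shows "(\<integral>\<^sup>+ x. f (x + s) \<partial>lborel) = (\<integral>\<^sup>+ x. f x \<partial>lborel)"
  using nn_integral_real_affine[OF assms, of 1 s] by (simp add: add.commute)

text \<open>For each fixed imaginary part a horizontal shear is a translation of the line.\<close>

lemma nn_integral_shear1:
  assumes [measurable]: "f \<in> borel_measurable borel"
  shows "(\<integral>\<^sup>+ z. f (z + of_real (p * Im z)) \<partial>lborel) = (\<integral>\<^sup>+ z. f z \<partial>lborel)"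
proof -
  have eq: "Complex x y + complex_of_real (p * Im (Complex x y)) = Complex (x + p * y) y" for x y
    by (simp add: complex_eq_iff)
  show ?thesis
    by (simp only: nn_integral_complex' assms eq nn_integral_shift, subst nn_integral_complex')
      (auto simp only: eq intro!: nn_integral_cong nn_integral_shift, measurable)
qed

lemma nn_integral_shear2:
  assumes [measurable]: "f \<in> borel_measurable borel"
  shows "(\<integral>\<^sup>+ z. f (z + \<i> * of_real (p * Re z)) \<partial>lborel) = (\<integral>\<^sup>+ z. f z \<partial>lborel)"
proof -
  have eq: "Complex x y + \<i> * complex_of_real (p * Re (Complex x y)) = Complex x (y + p * x)" for x y
    by (simp add: complex_eq_iff)
  show ?thesis
    by (simp only: nn_integral_complex assms eq nn_integral_shift, subst nn_integral_complex)
      (auto simp only: eq intro!: nn_integral_cong nn_integral_shift, measurable)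
qed

text \<open>A rotation is a product of three shears, horizontal, vertical, horizontal, with
  \<open>p\<close> equal to minus the tangent of half the angle; the quotient defining
  \<open>p\<close> makes sense only for \<open>Im c \<noteq> 0\<close>.\<close>

lemma nn_integral_rotate_aux:
  fixes c :: complex
  assumes f [measurable]: "f \<in> borel_measurable borel" and c: "cmod c = 1" and b: "Im c \<noteq> 0"
  shows "(\<integral>\<^sup>+ z. f (c * z) \<partial>lborel) = (\<integral>\<^sup>+ z. f z \<partial>lborel)"
proof -
  define p where "p = (Re c - 1) / Im c"
  define S where "S = (\<lambda>z::complex. z + of_real (p * Im z))"
  define T where "T = (\<lambda>z::complex. z + \<i> * of_real (Im c * Re z))"
  have S: "S z = z + of_real (p * Im z)" and T: "T z = z + \<i> * of_real (Im c * Re z)" for z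
    by (simp_all add: S_def T_def)
  have [measurable]: "S \<in> borel_measurable borel" "T \<in> borel_measurable borel"
    unfolding S_def T_def by measurable
  have c2: "Re c ^ 2 + Im c ^ 2 = 1" using c by (simp add: cmod_def)
  have pb: "p * Im c = Re c - 1" using b by (simp add: p_def)
  have pa: "p * (Re c + 1) = - Im c"
    using c2 b by (simp add: p_def field_simps power2_eq_square)
  have eq: "S (T (S z)) = c * z" for z
  proof (rule complex_eqI)
    have "Re (S (T (S z))) = Re z + p * Im z + p * (Im z + Im c * (Re z + p * Im z))"
      by (simp add: S_def T_def)
    also have "\<dots> = Re z * (1 + p * Im c) + (p + p * (1 + p * Im c)) * Im z"
      by (simp add: algebra_simps)
    also have "\<dots> = Re z * Re c + (p * (Re c + 1)) * Im z" unfolding pb by (simp add: algebra_simps)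
    finally show "Re (S (T (S z))) = Re (c * z)" unfolding pa by (simp add: algebra_simps)
    have "Im (S (T (S z))) = Im c * Re z + (1 + p * Im c) * Im z"
      by (simp add: S_def T_def algebra_simps)
    then show "Im (S (T (S z))) = Im (c * z)" unfolding pb by (simp add: algebra_simps)
  qed
  have "(\<integral>\<^sup>+ z. f (c * z) \<partial>lborel) = (\<integral>\<^sup>+ z. f (S (T (S z))) \<partial>lborel)" by (simp add: eq)
  also have "\<dots> = (\<integral>\<^sup>+ z. f (S (T z)) \<partial>lborel)"
    using nn_integral_shear1[of "\<lambda>z. f (S (T z))" p] by (simp only: S[symmetric]) simp
  also have "\<dots> = (\<integral>\<^sup>+ z. f (S z) \<partial>lborel)"
    using nn_integral_shear2[of "\<lambda>z. f (S z)" "Im c"] by (simp only: T[symmetric]) simp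
  also have "\<dots> = (\<integral>\<^sup>+ z. f z \<partial>lborel)"
    using nn_integral_shear1[of f p] by (simp only: S[symmetric]) simp
  finally show ?thesis .
qed

lemma nn_integral_rotate:
  fixes c :: complex
  assumes f [measurable]: "f \<in> borel_measurable borel" and c: "cmod c = 1"
  shows "(\<integral>\<^sup>+ z. f (c * z) \<partial>lborel) = (\<integral>\<^sup>+ z. f z \<partial>lborel)"
proof (cases "Im c = 0")
  case False then show ?thesis using nn_integral_rotate_aux[OF f c] by simp
next
  case True
  then have "Re c = 1 \<or> Re c = -1" using c by (auto simp: cmod_def power2_eq_1_iff)
  \<comment> \<open>For c = 1 or c = -1 the rotation is split into two rotations by non-real
    numbers.\<close>
  then have cc: "c = \<i> * (- \<i> * c)" "Im (- \<i> * c) \<noteq> 0" "cmod (- \<i> * c) = 1"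
    using c by (auto simp: norm_mult)
  have "(\<integral>\<^sup>+ z. f (c * z) \<partial>lborel) = (\<integral>\<^sup>+ z. f (\<i> * ((- \<i> * c) * z)) \<partial>lborel)"
    by (simp add: mult.assoc[symmetric])
  also have "\<dots> = (\<integral>\<^sup>+ z. f (\<i> * z) \<partial>lborel)"
    by (rule nn_integral_rotate_aux[of "\<lambda>z. f (\<i> * z)"]) (use cc in auto)
  also have "\<dots> = (\<integral>\<^sup>+ z. f z \<partial>lborel)"
    by (rule nn_integral_rotate_aux) auto
  finally show ?thesis .
qed

lemma nn_integral_translate:
  fixes c :: complex
  assumes f [measurable]: "f \<in> borel_measurable borel"
  shows "(\<integral>\<^sup>+ z. f (c + z) \<partial>lborel) = (\<integral>\<^sup>+ z. f z \<partial>lborel)"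
  by (subst (2) lborel_distr_plus[of c, symmetric], subst nn_integral_distr) auto

lemma emeasure_cball_le: "R \<ge> 0 \<Longrightarrow> emeasure lborel (cball (z::complex) R) \<le> ennreal (4 * R\<^sup>2)"
proof -
  assume R: "R \<ge> 0"
  have "cball z R \<subseteq> cbox (z - Complex R R) (z + Complex R R)"
  proof
    fix w assume "w \<in> cball z R"
    then have "cmod (z - w) \<le> R" by (simp add: dist_norm)
    then have "\<bar>Re (z - w)\<bar> \<le> R" "\<bar>Im (z - w)\<bar> \<le> R"
      using abs_Re_le_cmod abs_Im_le_cmod order_trans by blast+
    then show "w \<in> cbox (z - Complex R R) (z + Complex R R)"
      by (auto simp: in_cbox_complex_iff)
  qed
  then have "emeasure lborel (cball z R) \<le> emeasure lborel (cbox (z - Complex R R) (z + Complex R R))"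
    by (intro emeasure_mono) auto
  also have "\<dots> = ennreal (4 * R\<^sup>2)"
    using R by (subst emeasure_lborel_cbox_eq) (auto simp: Basis_complex_def power2_eq_square complex_eq_iff)
  finally show ?thesis .
qed

text \<open>For a shift inside one period, the part that sticks out beyond 2 pi is moved back by a
  period; a general shift is first reduced modulo 2 pi.\<close>

lemma nn_integral_periodic_shift:
  fixes f :: "real \<Rightarrow> ennreal"
  assumes f [measurable]: "f \<in> borel_measurable borel" and per: "\<And>x. f (x + 2 * pi) = f x"
  shows "(\<integral>\<^sup>+ x. indicator {0..2*pi} x * f (x + a) \<partial>lborel) = (\<integral>\<^sup>+ x. indicator {0..2*pi} x * f x \<partial>lborel)"
proof -
  have half: "(\<integral>\<^sup>+ x. indicator {0..2*pi} x * f (x + a) \<partial>lborel) = (\<integral>\<^sup>+ x. indicator {0..2*pi} x * f x \<partial>lborel)"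
    if a: "0 \<le> a" "a \<le> 2 * pi" for a
  proof -
    have "(\<integral>\<^sup>+ x. indicator {0..2*pi} x * f (x + a) \<partial>lborel)
        = (\<integral>\<^sup>+ x. indicator {a..2*pi+a} (x + a) * f (x + a) \<partial>lborel)"
      by (intro nn_integral_cong) (auto simp: indicator_def)
    also have "\<dots> = (\<integral>\<^sup>+ x. indicator {a..2*pi+a} x * f x \<partial>lborel)"
      by (rule nn_integral_shift[of "\<lambda>x. indicator {a..2*pi+a} x * f x" a]) measurable
    also have "\<dots> = (\<integral>\<^sup>+ x. indicator {a..2*pi} x * f x + indicator {2*pi<..2*pi+a} x * f x \<partial>lborel)"
      using a by (intro nn_integral_cong) (auto simp: indicator_def)
    also have "\<dots> = (\<integral>\<^sup>+ x. indicator {a..2*pi} x * f x \<partial>lborel) + (\<integral>\<^sup>+ x. indicator {2*pi<..2*pi+a} x * f x \<partial>lborel)"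
      by (rule nn_integral_add) auto
    also have "(\<integral>\<^sup>+ x. indicator {2*pi<..2*pi+a} x * f x \<partial>lborel)
        = (\<integral>\<^sup>+ x. indicator {2*pi<..2*pi+a} (x + 2*pi) * f (x + 2*pi) \<partial>lborel)"
      by (rule nn_integral_shift[symmetric, of "\<lambda>x. indicator {2*pi<..2*pi+a} x * f x"]) measurable
    also have "\<dots> = (\<integral>\<^sup>+ x. indicator {0<..a} x * f x \<partial>lborel)"
      by (intro nn_integral_cong) (auto simp: indicator_def per)
    also have "\<dots> = (\<integral>\<^sup>+ x. indicator {0..<a} x * f x \<partial>lborel)"
    proof (rule nn_integral_cong_AE)
      show "AE x in lborel. indicator {0<..a} x * f x = indicator {0..<a} x * f x"
        using AE_lborel_singleton[of 0] AE_lborel_singleton[of a]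
        by eventually_elim (auto simp: indicator_def)
    qed
    also have "(\<integral>\<^sup>+ x. indicator {a..2*pi} x * f x \<partial>lborel) + (\<integral>\<^sup>+ x. indicator {0..<a} x * f x \<partial>lborel)
        = (\<integral>\<^sup>+ x. indicator {a..2*pi} x * f x + indicator {0..<a} x * f x \<partial>lborel)"
      by (rule nn_integral_add[symmetric]) auto
    also have "\<dots> = (\<integral>\<^sup>+ x. indicator {0..2*pi} x * f x \<partial>lborel)"
      using a by (intro nn_integral_cong) (auto simp: indicator_def)
    finally show ?thesis .
  qed
  have perZ: "f (x + 2 * pi * of_int n) = f x" for x and n :: int
  proof -
    have N: "f (x + 2 * pi * real k) = f x" for x k
    proof (induction k)
      case (Suc k)
      have "f (x + 2 * pi * real (Suc k)) = f ((x + 2 * pi * real k) + 2 * pi)" by (simp add: algebra_simps)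
      then show ?case using Suc per by simp
    qed simp
    show ?thesis
    proof (cases "n \<ge> 0")
      case True then show ?thesis using N[of x "nat n"] by simp
    next
      case False
      have "f (x + 2 * pi * of_int n) = f (x + 2 * pi * of_int n + 2 * pi * real (nat (- n)))"
        by (rule N[symmetric])
      then show ?thesis using False by simp
    qed
  qed
  define n where "n = \<lfloor>a / (2 * pi)\<rfloor>"
  define a' where "a' = a - 2 * pi * of_int n"
  have "of_int n \<le> a / (2 * pi)" "a / (2 * pi) < of_int n + 1" unfolding n_def by linarith+
  then have a': "0 \<le> a'" "a' \<le> 2 * pi"
    unfolding a'_def by (auto simp: field_simps)
  have "f (x + a) = f (x + a')" for x
    using perZ[of "x + a'" n] by (simp add: a'_def add.assoc)
  then show ?thesis using half[OF a'] by simp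
qed


section \<open>Circle averages of supermean functions\<close>

definition lsc :: "(complex \<Rightarrow> ennreal) \<Rightarrow> bool" where
  "lsc N \<longleftrightarrow> (\<forall>a. open {w. a < N w})"

lemma lsc_measurable: "lsc N \<Longrightarrow> N \<in> borel_measurable borel"
  by (rule borel_measurableI_greater) (simp add: lsc_def)

lemma lsc_liminf:
  assumes N: "lsc N" and X: "X \<longlonglongrightarrow> x"
  shows "N x \<le> liminf (\<lambda>n. N (X n))"
  unfolding le_Liminf_iff
proof (intro allI impI)
  fix a assume "a < N x"
  then have "x \<in> {w. a < N w}" by simp
  moreover have "open {w. a < N w}" using N by (simp add: lsc_def)
  ultimately show "\<forall>\<^sub>F n in sequentially. a < N (X n)"
    using topological_tendstoD[OF X] by fastforce
qed

text \<open>The radius is replaced by a complex displacement \<open>w\<close>: as a function of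
  \<open>w\<close> the average again satisfies a mean value inequality, so a minimum principle in
  the \<open>w\<close>-plane can be applied to it.\<close>

definition cavg :: "(complex \<Rightarrow> ennreal) \<Rightarrow> complex \<Rightarrow> complex \<Rightarrow> ennreal" where
  "cavg N z w = ennreal (1 / (2 * pi)) * (\<integral>\<^sup>+ \<theta>. indicator {0..2*pi} \<theta> * N (z + cis \<theta> * w) \<partial>lborel)"

lemma measurable_cis [measurable]: "cis \<in> borel_measurable borel"
  by (intro borel_measurable_continuous_onI continuous_intros)

lemma cavg_measurable [measurable]:
  assumes [measurable]: "N \<in> borel_measurable borel"
  shows "cavg N z \<in> borel_measurable borel"
  unfolding cavg_def[abs_def] by measurable

lemma two_pi_ennreal: "ennreal (1 / (2 * pi)) * ennreal (2 * pi) = 1"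
  by (subst ennreal_mult[symmetric]) auto

lemma two_pi_ennreal': "ennreal (2 * pi) * ennreal (1 / (2 * pi)) = 1"
  using two_pi_ennreal by (simp only: mult.commute)

lemma cavg_0: "cavg N z 0 = N z"
proof -
  have "(\<integral>\<^sup>+ \<theta>. indicator {0..2*pi} \<theta> * N z \<partial>lborel) = (\<integral>\<^sup>+ \<theta>. N z * indicator {0..2*pi} \<theta> \<partial>lborel)"
    by (simp add: mult.commute)
  also have "\<dots> = N z * ennreal (2 * pi)"
    by (subst nn_integral_cmult_indicator) auto
  finally show ?thesis
    by (simp add: cavg_def mult.left_commute[of _ "N z"] two_pi_ennreal)
qed

lemma cavg_liminf:
  assumes N: "lsc N" and X: "X \<longlonglongrightarrow> x"
  shows "cavg N z x \<le> liminf (\<lambda>n. cavg N z (X n))"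
proof -
  note lsc_measurable[OF N, measurable]
  have "(\<integral>\<^sup>+ \<theta>. indicator {0..2*pi} \<theta> * N (z + cis \<theta> * x) \<partial>lborel)
     \<le> (\<integral>\<^sup>+ \<theta>. liminf (\<lambda>n. indicator {0..2*pi} \<theta> * N (z + cis \<theta> * X n)) \<partial>lborel)"
  proof (rule nn_integral_mono)
    fix \<theta> :: real
    have "N (z + cis \<theta> * x) \<le> liminf (\<lambda>n. N (z + cis \<theta> * X n))"
      by (rule lsc_liminf[OF N]) (intro tendsto_intros X)
    then show "indicator {0..2*pi} \<theta> * N (z + cis \<theta> * x)
      \<le> liminf (\<lambda>n. indicator {0..2*pi} \<theta> * N (z + cis \<theta> * X n))"
      by (auto simp: indicator_def)
  qed
  also have "\<dots> \<le> liminf (\<lambda>n. \<integral>\<^sup>+ \<theta>. indicator {0..2*pi} \<theta> * N (z + cis \<theta> * X n) \<partial>lborel)"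
    by (rule nn_integral_liminf) measurable
  finally have *: "(\<integral>\<^sup>+ \<theta>. indicator {0..2*pi} \<theta> * N (z + cis \<theta> * x) \<partial>lborel)
    \<le> liminf (\<lambda>n. \<integral>\<^sup>+ \<theta>. indicator {0..2*pi} \<theta> * N (z + cis \<theta> * X n) \<partial>lborel)" .
  have "cavg N z x \<le> ennreal (1 / (2 * pi)) * liminf (\<lambda>n. \<integral>\<^sup>+ \<theta>. indicator {0..2*pi} \<theta> * N (z + cis \<theta> * X n) \<partial>lborel)"
    unfolding cavg_def by (intro mult_left_mono *) simp
  also have "\<dots> = liminf (\<lambda>n. cavg N z (X n))"
    unfolding cavg_def
    by (rule Liminf_compose_continuous_mono[symmetric])
      (auto intro!: ennreal_continuous_on_cmult monoI mult_left_mono continuous_on_id)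
  finally show ?thesis .
qed

lemma cavg_rotate:
  assumes [measurable]: "N \<in> borel_measurable borel"
  shows "cavg N z (cis a * w) = cavg N z w"
proof -
  have "(\<integral>\<^sup>+ \<theta>. indicator {0..2*pi} \<theta> * N (z + cis \<theta> * (cis a * w)) \<partial>lborel)
     = (\<integral>\<^sup>+ \<theta>. indicator {0..2*pi} \<theta> * N (z + cis (\<theta> + a) * w) \<partial>lborel)"
    by (simp add: cis_mult mult.assoc[symmetric])
  also have "\<dots> = (\<integral>\<^sup>+ \<theta>. indicator {0..2*pi} \<theta> * N (z + cis \<theta> * w) \<partial>lborel)"
    by (rule nn_integral_periodic_shift[of "\<lambda>\<theta>. N (z + cis \<theta> * w)"])
      (auto simp: cis_mult[symmetric] simp del: cis_mult)
  finally show ?thesis by (simp add: cavg_def)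
qed

lemma cavg_norm:
  assumes "N \<in> borel_measurable borel"
  shows "cavg N z w = cavg N z (of_real (cmod w))"
proof -
  have "w = cis (Arg w) * of_real (cmod w)"
    using rcis_cmod_Arg[of w] by (simp add: rcis_def mult.commute)
  then show ?thesis using cavg_rotate[OF assms, of z "Arg w" "of_real (cmod w)"] by simp
qed

text \<open>Relative to a set \<open>D\<close>, because the defect below a level inherits the mean
  value inequality of u only where u stays below that level.\<close>

definition supermean_on :: "complex set \<Rightarrow> (complex \<Rightarrow> ennreal) \<Rightarrow> bool" where
  "supermean_on D N \<longleftrightarrow> (\<forall>p r. r > 0 \<longrightarrow> cball p r \<subseteq> D \<longrightarrow> cavg N p (of_real r) \<le> N p)"

text \<open>After exchanging the two angular integrals, the inner one runs over a circle of radius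
  \<epsilon> about \<open>z + cis \<theta> * p\<close>, up to a rotation of the starting point, and
  the supermean inequality applies to it for each \<theta>.\<close>

lemma cavg_supermean:
  assumes N [measurable]: "N \<in> borel_measurable borel" and sm: "supermean_on D N"
    and D: "cball z s \<subseteq> D" and \<epsilon>: "\<epsilon> > 0" and p: "cmod p + \<epsilon> \<le> s"
  shows "(\<integral>\<^sup>+ \<phi>. indicator {0..2*pi} \<phi> * cavg N z (p + cis \<phi> * of_real \<epsilon>) \<partial>lborel) \<le> ennreal (2 * pi) * cavg N z p"
proof -
  let ?I = "\<lambda>x. indicator {0..2*pi} x :: ennreal" and ?c = "ennreal (1 / (2 * pi))"
  have "(\<integral>\<^sup>+ \<phi>. ?I \<phi> * cavg N z (p + cis \<phi> * of_real \<epsilon>) \<partial>lborel)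
    = (\<integral>\<^sup>+ \<phi>. ?c * (\<integral>\<^sup>+ \<theta>. ?I \<phi> * (?I \<theta> * N (z + cis \<theta> * (p + cis \<phi> * of_real \<epsilon>))) \<partial>lborel) \<partial>lborel)"
    unfolding cavg_def
    by (intro nn_integral_cong) (subst nn_integral_cmult, measurable, simp add: mult_ac)
  also have "\<dots> = ?c * (\<integral>\<^sup>+ \<phi>. \<integral>\<^sup>+ \<theta>. ?I \<phi> * (?I \<theta> * N (z + cis \<theta> * (p + cis \<phi> * of_real \<epsilon>))) \<partial>lborel \<partial>lborel)"
    by (rule nn_integral_cmult) measurable
  also have "\<dots> = ?c * (\<integral>\<^sup>+ \<theta>. \<integral>\<^sup>+ \<phi>. ?I \<phi> * (?I \<theta> * N (z + cis \<theta> * (p + cis \<phi> * of_real \<epsilon>))) \<partial>lborel \<partial>lborel)"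
    by (subst lborel_pair.Fubini') auto
  also have "\<dots> \<le> ?c * (\<integral>\<^sup>+ \<theta>. ennreal (2 * pi) * (?I \<theta> * N (z + cis \<theta> * p)) \<partial>lborel)"
  proof (intro mult_left_mono nn_integral_mono)
    fix \<theta> :: real
    have "(\<integral>\<^sup>+ \<phi>. ?I \<phi> * (?I \<theta> * N (z + cis \<theta> * (p + cis \<phi> * of_real \<epsilon>))) \<partial>lborel)
      = (\<integral>\<^sup>+ \<phi>. ?I \<theta> * (?I \<phi> * N ((z + cis \<theta> * p) + cis \<phi> * (cis \<theta> * of_real \<epsilon>))) \<partial>lborel)"
      by (intro nn_integral_cong) (simp add: algebra_simps)
    also have "\<dots> = ?I \<theta> * (\<integral>\<^sup>+ \<phi>. (?I \<phi> * N ((z + cis \<theta> * p) + cis \<phi> * (cis \<theta> * of_real \<epsilon>))) \<partial>lborel)"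
      by (rule nn_integral_cmult) measurable
    also have "(\<integral>\<^sup>+ \<phi>. (?I \<phi> * N ((z + cis \<theta> * p) + cis \<phi> * (cis \<theta> * of_real \<epsilon>))) \<partial>lborel)
        = ennreal (2 * pi) * cavg N (z + cis \<theta> * p) (cis \<theta> * of_real \<epsilon>)"
      unfolding cavg_def mult.assoc[symmetric] two_pi_ennreal' by simp
    also have "cavg N (z + cis \<theta> * p) (cis \<theta> * of_real \<epsilon>) = cavg N (z + cis \<theta> * p) (of_real \<epsilon>)"
      by (rule cavg_rotate) fact
    also have "\<dots> \<le> N (z + cis \<theta> * p)"
    proof -
      have "cball (z + cis \<theta> * p) \<epsilon> \<subseteq> cball z s"
        using p \<epsilon> by (intro cball_subset_cball_iff[THEN iffD2] disjI1) (simp add: dist_norm norm_mult)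
      then show ?thesis using sm D \<epsilon> unfolding supermean_on_def by blast
    qed
    finally show "(\<integral>\<^sup>+ \<phi>. ?I \<phi> * (?I \<theta> * N (z + cis \<theta> * (p + cis \<phi> * of_real \<epsilon>))) \<partial>lborel)
       \<le> ennreal (2 * pi) * (?I \<theta> * N (z + cis \<theta> * p))"
      by (simp add: mult_left_mono mult.left_commute)
  qed auto
  also have "\<dots> = ?c * (ennreal (2 * pi) * (\<integral>\<^sup>+ \<theta>. ?I \<theta> * N (z + cis \<theta> * p) \<partial>lborel))"
    by (subst nn_integral_cmult) auto
  also have "\<dots> = ennreal (2 * pi) * cavg N z p"
    by (simp add: cavg_def mult_ac)
  finally show ?thesis .
qed

text \<open>The circle average of N is a radial lower semicontinuous supermean function of the
  displacement, so its minimum over a disc is attained on the boundary circle.\<close>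

lemma cavg_antimono:
  assumes N: "lsc N" and sm: "supermean_on D N" and D: "cball z s \<subseteq> D"
    and q: "0 \<le> q" "q \<le> s"
  shows "cavg N z (of_real s) \<le> cavg N z (of_real q)"
proof -
  note Nm [measurable] = lsc_measurable[OF N]
  let ?B = "cavg N z"
  define m where "m = Inf (?B ` cball 0 s)"
  have mle: "m \<le> ?B w" if "cmod w \<le> s" for w
    unfolding m_def using that by (auto intro!: INF_lower)
  have s0: "0 \<le> s" using q by simp
  have "?B ` cball 0 s \<noteq> {}" using s0 by auto
  from Inf_as_limit[OF this] obtain U where U: "\<And>n. U n \<in> ?B ` cball 0 s" "U \<longlonglongrightarrow> m"
    unfolding m_def by auto
  have "\<forall>n. \<exists>w. w \<in> cball 0 s \<and> U n = ?B w" using U(1) by blast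
  then obtain W where W: "\<And>n. W n \<in> cball 0 s" "\<And>n. U n = ?B (W n)" by metis
  have lim: "?B x \<le> m" if "X \<longlonglongrightarrow> x" "(\<lambda>n. ?B (X n)) \<longlonglongrightarrow> m" for X x
    using cavg_liminf[OF N that(1), of z] that(2) by (simp add: lim_imp_Liminf)
  obtain l r where l: "l \<in> cball 0 s" "strict_mono r" "(W \<circ> r) \<longlonglongrightarrow> l"
    by (rule seq_compactE[OF compact_imp_seq_compact[OF compact_cball[of "0::complex" s]], of W]) (use W(1) in auto)
  have "?B l \<le> m"
    by (rule lim[OF l(3)]) (use LIMSEQ_subseq_LIMSEQ[OF U(2) l(2)] W(2) in \<open>simp add: o_def\<close>)
  define K where "K = {w \<in> cball 0 s. ?B w \<le> m}"
  have "l \<in> K" using l \<open>?B l \<le> m\<close> by (simp add: K_def)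
  have "closed K"
    unfolding closed_sequential_limits
  proof (intro allI impI, elim conjE)
    fix X x assume X: "\<forall>n. X n \<in> K" "X \<longlonglongrightarrow> x"
    have "x \<in> cball 0 s"
      using closed_sequentially[OF closed_cball[of 0 s] _ X(2)] X(1) by (auto simp: K_def)
    have "(\<lambda>n. ?B (X n)) = (\<lambda>n. m)"
      using X(1) mle by (auto simp: K_def fun_eq_iff intro: antisym)
    then have "?B x \<le> m" using lim[OF X(2)] by simp
    then show "x \<in> K" using \<open>x \<in> cball 0 s\<close> by (simp add: K_def)
  qed
  moreover have "bounded K" by (rule bounded_subset[OF bounded_cball[of 0 s]]) (auto simp: K_def)
  ultimately have "compact K" using compact_eq_bounded_closed by blast
  \<comment> \<open>Among the minimisers one of largest modulus is taken. If it lay inside the disc,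
    the supermean inequality on the circle about it reaching out to radius \<open>s\<close> would
    force the value \<open>m\<close> almost everywhere on that circle, hence at points of larger
    modulus.\<close>
  then obtain p0 where p0: "p0 \<in> K" "\<And>w. w \<in> K \<Longrightarrow> cmod w \<le> cmod p0"
    using continuous_attains_sup[of K cmod] \<open>l \<in> K\<close> by (auto intro: continuous_intros)
  define x where "x = cmod p0"
  have x: "0 \<le> x" "x \<le> s" using p0 by (auto simp: x_def K_def)
  have Bx: "?B (of_real x) = m"
    using p0(1) cavg_norm[OF Nm, of z p0] mle[of p0] by (auto simp: K_def x_def intro: antisym)
  show ?thesis
  proof (cases "m = \<infinity>")
    case True
    then show ?thesis using mle[of "of_real q"] q by (simp add: top_unique)
  next
    case fin: False
    have "x = s"
    proof (rule ccontr)
      assume "x \<noteq> s"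
      then have e: "s - x > 0" using x by simp
      define \<epsilon> where "\<epsilon> = s - x"
      let ?I = "\<lambda>t. indicator {0..2*pi} t :: ennreal"
      let ?w = "\<lambda>\<phi>. of_real x + cis \<phi> * of_real \<epsilon> :: complex"
      have nw: "cmod (?w \<phi>) \<le> s" for \<phi>
      proof -
        have "cmod (?w \<phi>) \<le> x + \<epsilon>" "x + \<epsilon> = s"
          using norm_triangle_ineq[of "of_real x" "cis \<phi> * of_real \<epsilon>"] x e
          by (auto simp add: norm_mult \<epsilon>_def simp del: of_real_diff)
        then show ?thesis by simp
      qed
      have "(\<integral>\<^sup>+ \<phi>. ?I \<phi> * ?B (?w \<phi>) \<partial>lborel) \<le> ennreal (2 * pi) * m"
        using cavg_supermean[OF Nm sm D, of \<epsilon> "of_real x"] e x Bx by (simp add: \<epsilon>_def)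
      moreover have "(\<integral>\<^sup>+ \<phi>. ?I \<phi> * ?B (?w \<phi>) \<partial>lborel)
         = (\<integral>\<^sup>+ \<phi>. ?I \<phi> * (?B (?w \<phi>) - m) + m * ?I \<phi> \<partial>lborel)"
        using mle[OF nw] fin by (intro nn_integral_cong) (auto simp: indicator_def diff_add_cancel_ennreal)
      moreover have "\<dots> = (\<integral>\<^sup>+ \<phi>. ?I \<phi> * (?B (?w \<phi>) - m) \<partial>lborel) + m * ennreal (2 * pi)"
        by (subst nn_integral_add) (auto simp: nn_integral_cmult_indicator)
      ultimately have *: "m * ennreal (2 * pi) + (\<integral>\<^sup>+ \<phi>. ?I \<phi> * (?B (?w \<phi>) - m) \<partial>lborel) \<le> m * ennreal (2 * pi) + 0"
        by (simp only: mult.commute add.commute add_0)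
      \<comment> \<open>Cancellation in \<open>ennreal\<close> needs a finite summand; this is why
        the case of infinite \<open>m\<close> was split off.\<close>
      moreover have "m * ennreal (2 * pi) \<noteq> \<infinity>" using fin by (simp add: ennreal_mult_eq_top_iff)
      ultimately have "(\<integral>\<^sup>+ \<phi>. ?I \<phi> * (?B (?w \<phi>) - m) \<partial>lborel) = 0"
        unfolding ennreal_add_left_cancel_le by simp
      then have "AE \<phi> in lborel. ?I \<phi> * (?B (?w \<phi>) - m) = 0"
        by (subst (asm) nn_integral_0_iff_AE) auto
      then have ae: "AE \<phi> in lborel. \<phi> \<in> {0<..<pi/2} \<longrightarrow> ?B (?w \<phi>) \<le> m"
        by eventually_elim (auto simp: indicator_def ennreal_minus_eq_0 split: if_splits)
      \<comment> \<open>The arc has positive measure, so it contains a point where the almost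
        everywhere statement holds; positive cosine on the arc makes its modulus exceed
        \<open>x\<close>.\<close>
      have "\<exists>\<phi>\<in>{0<..<pi/2}. ?B (?w \<phi>) \<le> m"
      proof (rule ccontr)
        assume "\<not> ?thesis"
        then have "AE \<phi> in lborel. \<phi> \<notin> {0<..<pi/2}" using ae by (elim AE_mp) (auto intro!: AE_I2)
        then have "emeasure lborel {0<..<pi/2} = 0"
          by (subst (asm) AE_iff_measurable[where N="{0<..<pi/2}"]) auto
        then show False by simp
      qed
      then obtain \<phi> where \<phi>: "0 < \<phi>" "\<phi> < pi / 2" "?B (?w \<phi>) \<le> m" by auto
      then have "?w \<phi> \<in> K" using nw by (simp add: K_def)
      then have "cmod (?w \<phi>) \<le> x" using p0(2) x_def by simp
      then have "(cmod (?w \<phi>))\<^sup>2 \<le> x\<^sup>2" by (intro power_mono) auto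
      moreover have "(cmod (?w \<phi>))\<^sup>2 = (x + cos \<phi> * \<epsilon>)\<^sup>2 + (sin \<phi> * \<epsilon>)\<^sup>2"
        by (simp add: cmod_power2)
      moreover have "\<dots> = x\<^sup>2 + 2 * x * cos \<phi> * \<epsilon> + (cos \<phi> ^ 2 + sin \<phi> ^ 2) * \<epsilon>\<^sup>2"
        by algebra
      moreover have "cos \<phi> > 0" using \<phi> by (intro cos_gt_zero_pi) auto
      then have "2 * x * cos \<phi> * \<epsilon> \<ge> 0" using x e by (simp add: \<epsilon>_def)
      moreover have "\<epsilon>\<^sup>2 > 0" using e by (simp add: \<epsilon>_def)
      ultimately show False by simp
    qed
    then show ?thesis using Bx mle[of "of_real q"] q by simp
  qed
qed

text \<open>Against a radial kernel a rotation of the argument of N does not change the integral, so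
  N may be averaged over all rotations.\<close>

lemma nn_integral_rotation_average:
  assumes N [measurable]: "N \<in> borel_measurable borel" and k [measurable]: "k \<in> borel_measurable borel"
    and rad: "\<And>c w. cmod c = 1 \<Longrightarrow> k (c * w) = k w"
  shows "(\<integral>\<^sup>+ w. N (z + of_real \<rho> * w) * k w \<partial>lborel) = (\<integral>\<^sup>+ w. cavg N z (of_real \<rho> * w) * k w \<partial>lborel)"
proof -
  let ?I = "\<lambda>t. indicator {0..2*pi} t :: ennreal" and ?c = "ennreal (1 / (2 * pi))"
  have rot: "(\<integral>\<^sup>+ w. N (z + cis \<theta> * (of_real \<rho> * w)) * k w \<partial>lborel)
     = (\<integral>\<^sup>+ w. N (z + of_real \<rho> * w) * k w \<partial>lborel)" for \<theta>
  proof -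
    have "(\<integral>\<^sup>+ w. N (z + cis \<theta> * (of_real \<rho> * w)) * k w \<partial>lborel)
      = (\<integral>\<^sup>+ w. N (z + of_real \<rho> * (cis \<theta> * w)) * k (cis \<theta> * w) \<partial>lborel)"
      by (simp add: rad mult.left_commute)
    also have "\<dots> = (\<integral>\<^sup>+ w. N (z + of_real \<rho> * w) * k w \<partial>lborel)"
      by (rule nn_integral_rotate[of "\<lambda>w. N (z + of_real \<rho> * w) * k w"]) auto
    finally show ?thesis .
  qed
  have "(\<integral>\<^sup>+ w. cavg N z (of_real \<rho> * w) * k w \<partial>lborel)
     = (\<integral>\<^sup>+ w. ?c * (\<integral>\<^sup>+ \<theta>. ?I \<theta> * (N (z + cis \<theta> * (of_real \<rho> * w)) * k w) \<partial>lborel) \<partial>lborel)"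
    unfolding cavg_def mult.assoc
    by (intro nn_integral_cong arg_cong2[where f="(*)"] refl)
       (subst nn_integral_multc[symmetric], measurable, simp add: mult_ac)
  also have "\<dots> = ?c * (\<integral>\<^sup>+ w. (\<integral>\<^sup>+ \<theta>. ?I \<theta> * (N (z + cis \<theta> * (of_real \<rho> * w)) * k w) \<partial>lborel) \<partial>lborel)"
    by (rule nn_integral_cmult) measurable
  also have "\<dots> = ?c * (\<integral>\<^sup>+ \<theta>. (\<integral>\<^sup>+ w. ?I \<theta> * (N (z + cis \<theta> * (of_real \<rho> * w)) * k w) \<partial>lborel) \<partial>lborel)"
    by (subst lborel_pair.Fubini') auto
  also have "\<dots> = ?c * (\<integral>\<^sup>+ \<theta>. (\<integral>\<^sup>+ w. N (z + of_real \<rho> * w) * k w \<partial>lborel) * ?I \<theta> \<partial>lborel)"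
    by (intro arg_cong2[where f="(*)"] nn_integral_cong refl)
      (subst nn_integral_cmult, measurable, simp add: rot mult.commute[of "?I _"])
  also have "\<dots> = (\<integral>\<^sup>+ w. N (z + of_real \<rho> * w) * k w \<partial>lborel)"
    by (subst nn_integral_cmult_indicator) (auto simp: two_pi_ennreal mult.left_commute[of ?c])
  finally show ?thesis by simp
qed

text \<open>The link between area means and circle means: all radii in the support of
  \<open>k\<close> are at least \<open>q\<close>, and circle means of N decrease with the radius.
  With \<open>q = 0\<close> it bounds an area integral by the value at the centre.\<close>

lemma radial_mean_le_cavg:
  assumes N: "lsc N" and sm: "supermean_on D N" and D: "cball z s \<subseteq> D"
    and k [measurable]: "k \<in> borel_measurable borel"
    and rad: "\<And>c w. cmod c = 1 \<Longrightarrow> k (c * w) = k w"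
    and q: "0 \<le> q" and \<rho>: "\<rho> \<ge> 0"
    and supp: "\<And>w. k w \<noteq> 0 \<Longrightarrow> q \<le> \<rho> * cmod w \<and> \<rho> * cmod w \<le> s"
  shows "(\<integral>\<^sup>+ w. N (z + of_real \<rho> * w) * k w \<partial>lborel) \<le> cavg N z (of_real q) * (\<integral>\<^sup>+ w. k w \<partial>lborel)"
proof -
  note Nm [measurable] = lsc_measurable[OF N]
  have "(\<integral>\<^sup>+ w. N (z + of_real \<rho> * w) * k w \<partial>lborel) = (\<integral>\<^sup>+ w. cavg N z (of_real \<rho> * w) * k w \<partial>lborel)"
    by (rule nn_integral_rotation_average[OF Nm k rad])
  also have "\<dots> \<le> (\<integral>\<^sup>+ w. cavg N z (of_real q) * k w \<partial>lborel)"
  proof (rule nn_integral_mono)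
    fix w
    show "cavg N z (of_real \<rho> * w) * k w \<le> cavg N z (of_real q) * k w"
    proof (cases "k w = 0")
      case False
      have "cball z (\<rho> * cmod w) \<subseteq> D" using supp[OF False] D by (meson order_trans subset_cball)
      then have "cavg N z (of_real (\<rho> * cmod w)) \<le> cavg N z (of_real q)"
        using supp[OF False] q by (intro cavg_antimono[OF N sm]) auto
      then show ?thesis
        using cavg_norm[OF Nm, of z "of_real \<rho> * w"] \<rho> by (intro mult_right_mono) (auto simp: norm_mult)
    qed auto
  qed
  also have "\<dots> = cavg N z (of_real q) * (\<integral>\<^sup>+ w. k w \<partial>lborel)" by (rule nn_integral_cmult) measurable
  finally show ?thesis .
qed


section \<open>Test functions and their Laplacians\<close>

lemma integrable_complex_iff:
  fixes f :: "complex \<Rightarrow> real"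
  assumes [measurable]: "f \<in> borel_measurable borel"
  shows "integrable lborel f \<longleftrightarrow> integrable (lborel \<Otimes>\<^sub>M lborel) (\<lambda>(x, y). f (Complex x y))"
proof -
  have "integrable lborel f \<longleftrightarrow> integrable (distr (lborel \<Otimes>\<^sub>M lborel) borel (\<lambda>(x, y). Complex x y)) f"
    by (subst lborel_complex) (rule refl)
  also have "\<dots> \<longleftrightarrow> integrable (lborel \<Otimes>\<^sub>M lborel) (\<lambda>p. f (case p of (x, y) \<Rightarrow> Complex x y))"
    by (rule integrable_distr_eq) measurable
  finally show ?thesis by (simp add: case_prod_beta')
qed

lemma integral_complex:
  fixes f :: "complex \<Rightarrow> real"
  assumes f: "integrable lborel f"
  shows "(\<integral>z. f z \<partial>lborel) = (\<integral>x. \<integral>y. f (Complex x y) \<partial>lborel \<partial>lborel)"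
    and "(\<integral>z. f z \<partial>lborel) = (\<integral>y. \<integral>x. f (Complex x y) \<partial>lborel \<partial>lborel)"
proof -
  have [measurable]: "f \<in> borel_measurable borel" using borel_measurable_integrable[OF f] by simp
  have i: "integrable (lborel \<Otimes>\<^sub>M lborel) (\<lambda>(x, y). f (Complex x y))"
    using f integrable_complex_iff by simp
  have "(\<integral>z. f z \<partial>lborel) = (\<integral>p. f (case p of (x, y) \<Rightarrow> Complex x y) \<partial>(lborel \<Otimes>\<^sub>M lborel))"
    by (subst lborel_complex, subst integral_distr) auto
  also have "\<dots> = (\<integral>p. (case p of (x, y) \<Rightarrow> f (Complex x y)) \<partial>(lborel \<Otimes>\<^sub>M lborel))"
    by (simp add: case_prod_beta')
  finally have e: "(\<integral>z. f z \<partial>lborel) = (\<integral>(x, y). f (Complex x y) \<partial>(lborel \<Otimes>\<^sub>M lborel))" .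
  show "(\<integral>z. f z \<partial>lborel) = (\<integral>x. \<integral>y. f (Complex x y) \<partial>lborel \<partial>lborel)"
    using lborel_pair.integral_fst'[OF i] e by simp
  show "(\<integral>z. f z \<partial>lborel) = (\<integral>y. \<integral>x. f (Complex x y) \<partial>lborel \<partial>lborel)"
    using lborel_pair.integral_snd[OF i] e by simp
qed

lemma integrable_compact_support:
  fixes f :: "'a::euclidean_space \<Rightarrow> real"
  assumes "continuous_on UNIV f" "\<And>z. norm z > R \<Longrightarrow> f z = 0"
  shows "integrable lborel f"
proof -
  have "integrable lborel (\<lambda>x. indicator (cball 0 R) x *\<^sub>R f x)"
    by (rule borel_integrable_compact) (use assms(1) continuous_on_subset in auto)
  also have "(\<lambda>x. indicator (cball 0 R) x *\<^sub>R f x) = f"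
    using assms(2) by (auto simp: fun_eq_iff indicator_def not_le)
  finally show ?thesis .
qed

lemma pd_zero_outside:
  assumes "\<And>z. cmod z > R \<Longrightarrow> f z = 0" "cmod z > R"
  shows "pd f v z = 0"
proof -
  have "eventually (\<lambda>t::real. cmod (z + of_real t * v) > R) (nhds 0)"
  proof (rule order_tendstoD(1))
    have "((\<lambda>t::real. cmod (z + of_real t * v)) \<longlongrightarrow> cmod (z + of_real 0 * v)) (nhds 0)"
      by (intro tendsto_intros filterlim_ident)
    then show "((\<lambda>t::real. cmod (z + of_real t * v)) \<longlongrightarrow> cmod z) (nhds 0)" by simp
  qed fact
  then have "eventually (\<lambda>t::real. f (z + of_real t * v) = 0) (nhds 0)"
    by eventually_elim (rule assms(1))
  then have "deriv (\<lambda>t. f (z + of_real t * v)) 0 = deriv (\<lambda>t. 0) 0"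
    by (intro deriv_cong_ev) auto
  then show ?thesis by (simp add: pd_def)
qed

lemma partial_exists_DERIV:
  assumes "partial_exists f v"
  shows "((\<lambda>t::real. f (z + of_real t * v)) has_real_derivative pd f v (z + of_real s * v)) (at s)"
proof -
  have "(\<lambda>t::real. f ((z + of_real s * v) + of_real t * v)) differentiable (at 0)"
    using assms unfolding partial_exists_def by blast
  then have "((\<lambda>t::real. f ((z + of_real s * v) + of_real t * v)) has_real_derivative pd f v (z + of_real s * v)) (at 0)"
    unfolding pd_def using DERIV_deriv_iff_real_differentiable by blast
  then have "((\<lambda>t::real. f ((z + of_real s * v) + of_real (t - s) * v)) has_real_derivative pd f v (z + of_real s * v)) (at s)"
    using DERIV_shift[of "\<lambda>t. f ((z + of_real s * v) + of_real (t - s) * v)" _ 0 s]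
    by (simp add: add.commute)
  then show ?thesis by (simp add: algebra_simps)
qed

lemma integral_derivative_compact_support:
  fixes F f :: "real \<Rightarrow> real"
  assumes F: "\<And>s. (F has_real_derivative f s) (at s)" and f: "continuous_on UNIV f"
    and 0: "\<And>s. \<bar>s\<bar> > R \<Longrightarrow> F s = 0" "\<And>s. \<bar>s\<bar> > R \<Longrightarrow> f s = 0"
  shows "(\<integral>s. f s \<partial>lborel) = 0"
proof -
  define S where "S = max 0 R + 1"
  have "(\<integral>s. f s * indicator {-S..S} s \<partial>lborel) = F S - F (- S)"
    by (rule integral_FTC_Icc_real) (use F f S_def in \<open>auto intro: continuous_on_interior simp: continuous_on_eq_continuous_at\<close>)
  also have "(\<lambda>s. f s * indicator {-S..S} s) = f"
  proof
    fix s
    show "f s * indicator {-S..S} s = f s"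
      using 0(2)[of s] by (cases "\<bar>s\<bar> > R") (auto simp: indicator_def S_def)
  qed
  finally show ?thesis using 0(1)[of S] 0(1)[of "-S"] by (simp add: S_def)
qed

lemma integral_pd_eq_0:
  assumes "partial_exists f v" and v: "v \<in> {1, \<i>}" and c: "continuous_on UNIV (pd f v)"
    and R: "\<And>z. cmod z > R \<Longrightarrow> f z = 0"
  shows "(\<integral>z. pd f v z \<partial>lborel) = 0"
proof -
  have z: "pd f v z = 0" if "cmod z > R" for v z by (rule pd_zero_outside[where R=R]) (use R that in auto)
  have i: "integrable lborel (pd f v)" using integrable_compact_support[OF c z] .
  have far: "cmod (Complex x y) > R" if "\<bar>x\<bar> > R \<or> \<bar>y\<bar> > R" for x y
    using that abs_Re_le_cmod[of "Complex x y"] abs_Im_le_cmod[of "Complex x y"] by auto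
  have cx: "Complex x y = of_real x + of_real y * \<i>" for x y by (simp add: complex_eq_iff)
  have cx': "Complex x y = of_real y * \<i> + of_real x * 1" for x y by (simp add: complex_eq_iff)
  have d: "continuous_on UNIV (\<lambda>x. pd f v (Complex x y))"
    "continuous_on UNIV (\<lambda>y. pd f v (Complex x y))" for x y
    unfolding cx by (intro continuous_on_compose2[OF c] continuous_intros subset_UNIV)+
  show ?thesis
  proof (cases "v = 1")
    case True
    have "(\<integral>x. pd f v (Complex x y) \<partial>lborel) = 0" for y
    proof (rule integral_derivative_compact_support[where F="\<lambda>x. f (Complex x y)" and R=R])
      show "((\<lambda>x. f (Complex x y)) has_real_derivative pd f v (Complex s y)) (at s)" for s
        using partial_exists_DERIV[OF assms(1), of "of_real y * \<i>" s] unfolding cx' True .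
    qed (use d R z far in auto)
    then show ?thesis using integral_complex(2)[OF i] by simp
  next
    case False
    then have vi: "v = \<i>" using v by auto
    have "(\<integral>y. pd f v (Complex x y) \<partial>lborel) = 0" for x
    proof (rule integral_derivative_compact_support[where F="\<lambda>y. f (Complex x y)" and R=R])
      show "((\<lambda>y. f (Complex x y)) has_real_derivative pd f v (Complex x s)) (at s)" for s
        using partial_exists_DERIV[OF assms(1), of "of_real x" s] unfolding cx vi .
    qed (use d R z far in auto)
    then show ?thesis using integral_complex(1)[OF i] by simp
  qed
qed

text \<open>The vanishing integral is what removes the constant level when u is replaced by its
  defect in the Riesz formula.\<close>

lemma laplacian_test_fun:
  assumes t: "test_fun f" and R: "\<And>z. cmod z > R \<Longrightarrow> f z = 0"
  shows "continuous_on UNIV (laplacian f)" and "\<And>z. cmod z > R \<Longrightarrow> laplacian f z = 0"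
    and "(\<integral>z. laplacian f z \<partial>lborel) = 0"
proof -
  have z: "pd f v z = 0" if "cmod z > R" for v z by (rule pd_zero_outside[where R=R]) (use R that in auto)
  have zz: "pd (pd f v) v z = 0" if "cmod z > R" for v z by (rule pd_zero_outside[where R=R]) (use z that in auto)
  have c: "continuous_on UNIV (pd (pd f 1) 1)" "continuous_on UNIV (pd (pd f \<i>) \<i>)"
    using t by (auto simp: test_fun_def)
  show "continuous_on UNIV (laplacian f)" unfolding laplacian_def[abs_def] by (intro continuous_intros c)
  show "laplacian f z = 0" if "cmod z > R" for z using zz[OF that] by (simp add: laplacian_def)
  have "(\<integral>z. pd (pd f 1) 1 z \<partial>lborel) = 0" "(\<integral>z. pd (pd f \<i>) \<i> z \<partial>lborel) = 0"
    by (rule integral_pd_eq_0[where R=R]; use t z in \<open>simp add: test_fun_def\<close>)+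
  moreover have "integrable lborel (pd (pd f 1) 1)" "integrable lborel (pd (pd f \<i>) \<i>)"
    using integrable_compact_support[OF c(1) zz] integrable_compact_support[OF c(2) zz] by auto
  ultimately show "(\<integral>z. laplacian f z \<partial>lborel) = 0"
    unfolding laplacian_def by (subst Bochner_Integration.integral_add) auto
qed

lemma pd_oneI:
  assumes "\<And>x y. ((\<lambda>x. g (Complex x y)) has_real_derivative d (Complex x y)) (at x)"
  shows "pd g 1 = d" "partial_exists g 1"
proof -
  have "((\<lambda>t::real. g (z + of_real t * 1)) has_real_derivative d z) (at 0)" for z
  proof -
    have "((\<lambda>t. g (Complex (t + Re z) (Im z))) has_real_derivative d z) (at 0)"
      using assms[of "Im z" "Re z"] DERIV_shift[of "\<lambda>x. g (Complex x (Im z))" "d z" 0 "Re z"] by simp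
    moreover have "(\<lambda>t. g (Complex (t + Re z) (Im z))) = (\<lambda>t::real. g (z + of_real t * 1))"
      by (intro ext arg_cong[where f=g]) (simp add: complex_eq_iff)
    ultimately show ?thesis by simp
  qed
  then show "pd g 1 = d" "partial_exists g 1"
    unfolding pd_def partial_exists_def by (auto simp: fun_eq_iff DERIV_imp_deriv real_differentiable_def)
qed

lemma pd_imaginary_unitI:
  assumes "\<And>x y. ((\<lambda>y. g (Complex x y)) has_real_derivative d (Complex x y)) (at y)"
  shows "pd g \<i> = d" "partial_exists g \<i>"
proof -
  have "((\<lambda>t::real. g (z + of_real t * \<i>)) has_real_derivative d z) (at 0)" for z
  proof -
    have "((\<lambda>t. g (Complex (Re z) (t + Im z))) has_real_derivative d z) (at 0)"
      using assms[of "Re z" "Im z"] DERIV_shift[of "\<lambda>y. g (Complex (Re z) y)" "d z" 0 "Im z"] by simp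
    moreover have "(\<lambda>t. g (Complex (Re z) (t + Im z))) = (\<lambda>t::real. g (z + of_real t * \<i>))"
      by (intro ext arg_cong[where f=g]) (simp add: complex_eq_iff)
    ultimately show ?thesis by simp
  qed
  then show "pd g \<i> = d" "partial_exists g \<i>"
    unfolding pd_def partial_exists_def by (auto simp: fun_eq_iff DERIV_imp_deriv real_differentiable_def)
qed

text \<open>A polynomial in the coordinates, so that differentiation meets no singularity at
  \<open>z0\<close>, unlike with \<open>cmod\<close>.\<close>

definition sqd :: "complex \<Rightarrow> complex \<Rightarrow> real" where
  "sqd z0 z = (Re z - Re z0)\<^sup>2 + (Im z - Im z0)\<^sup>2"

lemma sqd_eq: "sqd z0 z = (cmod (z - z0))\<^sup>2"
  by (simp add: sqd_def cmod_power2)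

definition has_deriv2 :: "(real \<Rightarrow> real) \<Rightarrow> (real \<Rightarrow> real) \<Rightarrow> (real \<Rightarrow> real) \<Rightarrow> bool" where
  "has_deriv2 f f1 f2 \<longleftrightarrow> (\<forall>x. (f has_real_derivative f1 x) (at x)) \<and>
     (\<forall>x. (f1 has_real_derivative f2 x) (at x)) \<and> continuous_on UNIV f2"

lemma has_deriv2_continuous:
  assumes "has_deriv2 f f1 f2"
  shows "continuous_on UNIV f" "continuous_on UNIV f1" "continuous_on UNIV f2"
  using assms unfolding has_deriv2_def
  by (auto intro!: continuous_at_imp_continuous_on intro: DERIV_isCont)

text \<open>All test functions of the development have this product form. The bracket
  \<open>4 p' + 4 s p''\<close> is the planar Laplacian of a radial function written in the variable
  \<open>s = r^2\<close>.\<close>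

lemma test_fun_radial:
  fixes z0 :: complex
  assumes f: "has_deriv2 f f1 f2" and p: "has_deriv2 p p1 p2" and R: "\<And>s. s \<ge> R \<Longrightarrow> p s = 0"
  defines "g \<equiv> (\<lambda>z. f (Re z) * p (sqd z0 z))"
  shows "test_fun g"
    and "laplacian g z = f2 (Re z) * p (sqd z0 z) + 4 * (Re z - Re z0) * f1 (Re z) * p1 (sqd z0 z)
       + f (Re z) * (4 * p1 (sqd z0 z) + 4 * sqd z0 z * p2 (sqd z0 z))"
proof -
  note ch = DERIV_chain2[where f=f, OF f[unfolded has_deriv2_def, THEN conjunct1, rule_format]]
     DERIV_chain2[where f=f1, OF f[unfolded has_deriv2_def, THEN conjunct2, THEN conjunct1, rule_format]]
     DERIV_chain2[where f=p, OF p[unfolded has_deriv2_def, THEN conjunct1, rule_format]]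
     DERIV_chain2[where f=p1, OF p[unfolded has_deriv2_def, THEN conjunct2, THEN conjunct1, rule_format]]
  note simps = sqd_def complex.sel
  define gx where "gx = (\<lambda>z. f1 (Re z) * p (sqd z0 z) + f (Re z) * (2 * (Re z - Re z0) * p1 (sqd z0 z)))"
  define gy where "gy = (\<lambda>z. f (Re z) * (2 * (Im z - Im z0) * p1 (sqd z0 z)))"
  define gxx where "gxx = (\<lambda>z. f2 (Re z) * p (sqd z0 z) + 4 * (Re z - Re z0) * f1 (Re z) * p1 (sqd z0 z)
     + f (Re z) * (2 * p1 (sqd z0 z) + 4 * (Re z - Re z0)\<^sup>2 * p2 (sqd z0 z)))"
  define gxy where "gxy = (\<lambda>z. f1 (Re z) * (2 * (Im z - Im z0) * p1 (sqd z0 z))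
     + f (Re z) * (4 * (Re z - Re z0) * (Im z - Im z0) * p2 (sqd z0 z)))"
  define gyy where "gyy = (\<lambda>z. f (Re z) * (2 * p1 (sqd z0 z) + 4 * (Im z - Im z0)\<^sup>2 * p2 (sqd z0 z)))"
  have x: "pd g 1 = gx" "partial_exists g 1"
    by (rule pd_oneI[where d=gx]; unfold g_def gx_def simps; (rule derivative_eq_intros ch refl | simp)+; simp add: algebra_simps)+
  have y: "pd g \<i> = gy" "partial_exists g \<i>"
    by (rule pd_imaginary_unitI[where d=gy]; unfold g_def gy_def simps; (rule derivative_eq_intros ch refl | simp)+; simp add: algebra_simps)+
  have xx: "pd gx 1 = gxx" "partial_exists gx 1"
    by (rule pd_oneI[where d=gxx]; unfold gx_def gxx_def simps; (rule derivative_eq_intros ch refl | simp)+; simp add: algebra_simps power2_eq_square)+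
  have xy: "pd gx \<i> = gxy" "partial_exists gx \<i>"
    by (rule pd_imaginary_unitI[where d=gxy]; unfold gx_def gxy_def simps; (rule derivative_eq_intros ch refl | simp)+; simp add: algebra_simps)+
  have yx: "pd gy 1 = gxy" "partial_exists gy 1"
    by (rule pd_oneI[where d=gxy]; unfold gy_def gxy_def simps; (rule derivative_eq_intros ch refl | simp)+; simp add: algebra_simps)+
  have yy: "pd gy \<i> = gyy" "partial_exists gy \<i>"
    by (rule pd_imaginary_unitI[where d=gyy]; unfold gy_def gyy_def simps; (rule derivative_eq_intros ch refl | simp)+; simp add: algebra_simps power2_eq_square)+
  have cf: "continuous_on UNIV (\<lambda>z. h (Re z))" if "continuous_on UNIV h" for h :: "real \<Rightarrow> real"
    by (rule continuous_on_compose2[OF that]) (auto intro: continuous_intros)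
  have cp: "continuous_on UNIV (\<lambda>z. h (sqd z0 z))" if "continuous_on UNIV h" for h :: "real \<Rightarrow> real"
    by (rule continuous_on_compose2[OF that]) (auto simp: sqd_def intro!: continuous_intros)
  note cs = has_deriv2_continuous[OF f, THEN cf] has_deriv2_continuous[OF p, THEN cp]
  have cc: "continuous_on UNIV gxx" "continuous_on UNIV gxy" "continuous_on UNIV gyy"
    unfolding gxx_def gxy_def gyy_def by (intro continuous_intros cs)+
  have "{z. g z \<noteq> 0} \<subseteq> cball z0 (max 1 R)"
  proof
    fix z assume "z \<in> {z. g z \<noteq> 0}"
    then have "sqd z0 z < R" using R[of "sqd z0 z"] by (force simp: g_def)
    then have "(cmod (z - z0))\<^sup>2 \<le> (max 1 R)\<^sup>2"
      unfolding sqd_eq by (smt (verit) max.cobounded1 max.cobounded2 one_le_power power2_eq_square mult_left_le mult_le_cancel_left1)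
    then show "z \<in> cball z0 (max 1 R)"
      by (simp add: dist_norm norm_minus_commute power2_le_iff_abs_le)
  qed
  then have "bounded {z. g z \<noteq> 0}" using bounded_cball bounded_subset by blast
  then show "test_fun g" unfolding test_fun_def using x y xx xy yx yy cc by simp
  show "laplacian g z = f2 (Re z) * p (sqd z0 z) + 4 * (Re z - Re z0) * f1 (Re z) * p1 (sqd z0 z)
       + f (Re z) * (4 * p1 (sqd z0 z) + 4 * sqd z0 z * p2 (sqd z0 z))"
    unfolding laplacian_def x y xx yy by (simp add: gxx_def gyy_def sqd_def algebra_simps)
qed


section \<open>Radial cutoffs\<close>

lemma DERIV_max0_power:
  assumes "n \<ge> 2"
  shows "((\<lambda>x::real. (max 0 x) ^ n) has_real_derivative real n * (max 0 x) ^ (n - 1)) (at x)"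
proof (cases x "0::real" rule: linorder_cases)
  case less
  have "eventually (\<lambda>y::real. y < 0) (nhds x)" using less by (rule order_tendstoD(2)[OF filterlim_ident])
  then have e: "eventually (\<lambda>y::real. (max 0 y) ^ n = 0) (nhds x)"
    by eventually_elim (use assms in \<open>simp add: max_def\<close>)
  show ?thesis
    by (subst DERIV_cong_ev[OF refl e refl]) (use less assms in \<open>auto simp: max_def power_0_left\<close>)
next
  case greater
  have "eventually (\<lambda>y::real. y > 0) (nhds x)" using greater by (rule order_tendstoD(1)[OF filterlim_ident])
  then have e: "eventually (\<lambda>y::real. (max 0 y) ^ n = y ^ n) (nhds x)"
    by eventually_elim (simp add: max_def)
  show ?thesis
    by (subst DERIV_cong_ev[OF refl e refl]) (use greater in \<open>auto simp: max_def intro!: derivative_eq_intros\<close>)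
next
  case equal
  have "((\<lambda>h::real. ((max 0 (0 + h)) ^ n - (max 0 0) ^ n) / h) \<longlongrightarrow> 0) (at 0)"
  proof (rule tendsto_rabs_zero_cancel, rule tendsto_sandwich[of "\<lambda>_. 0" _ _ "\<lambda>h. \<bar>h\<bar> ^ (n - 1)"])
    show "\<forall>\<^sub>F h in at 0. \<bar>((max 0 (0 + h)) ^ n - (max 0 0) ^ n) / h\<bar> \<le> \<bar>h::real\<bar> ^ (n - 1)"
      using assms by (intro always_eventually) (auto simp: max_def power_0_left power_diff abs_mult divide_simps power_abs)
    have "((\<lambda>h::real. \<bar>h\<bar> ^ (n - 1)) \<longlongrightarrow> \<bar>0\<bar> ^ (n - 1)) (at 0)" by (intro tendsto_intros)
    then show "((\<lambda>h::real. \<bar>h\<bar> ^ (n - 1)) \<longlongrightarrow> 0) (at 0)" using assms by (simp add: power_0_left)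
  qed auto
  then show ?thesis using equal assms by (simp add: DERIV_def power_0_left)
qed

lemma continuous_bounded_Icc:
  fixes h :: "real \<Rightarrow> real"
  assumes "continuous_on UNIV h"
  shows "\<exists>C. \<forall>s\<in>{a..b}. \<bar>h s\<bar> \<le> C"
proof -
  have "bounded (h ` {a..b})"
    by (intro compact_imp_bounded compact_continuous_image continuous_on_subset[OF assms]) auto
  then show ?thesis unfolding bounded_iff by auto
qed

lemma has_deriv2_scale:
  assumes "has_deriv2 f f1 f2"
  shows "has_deriv2 (\<lambda>x. a * f (c * x)) (\<lambda>x. a * c * f1 (c * x)) (\<lambda>x. a * c\<^sup>2 * f2 (c * x))"
proof -
  have f: "(f has_real_derivative f1 x) (at x)" "(f1 has_real_derivative f2 x) (at x)" for x
    using assms by (auto simp: has_deriv2_def)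
  have "((\<lambda>x. a * f (c * x)) has_real_derivative a * c * f1 (c * x)) (at x)" for x
    by (rule derivative_eq_intros DERIV_chain2[OF f(1)] refl | simp)+
  moreover have "((\<lambda>x. a * c * f1 (c * x)) has_real_derivative a * c\<^sup>2 * f2 (c * x)) (at x)" for x
    by (rule derivative_eq_intros DERIV_chain2[OF f(2)] refl | simp add: power2_eq_square)+
  moreover have "continuous_on UNIV (\<lambda>x. a * c\<^sup>2 * f2 (c * x))"
    by (intro continuous_intros continuous_on_compose2[OF has_deriv2_continuous(3)[OF assms]]) auto
  ultimately show ?thesis by (simp add: has_deriv2_def)
qed

lemma has_deriv2_diff:
  assumes "has_deriv2 f f1 f2" "has_deriv2 g g1 g2"
  shows "has_deriv2 (\<lambda>x. f x - g x) (\<lambda>x. f1 x - g1 x) (\<lambda>x. f2 x - g2 x)"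
  using assms unfolding has_deriv2_def by (auto intro!: DERIV_diff continuous_intros)

lemma has_deriv2_const: "has_deriv2 (\<lambda>x. c) (\<lambda>x. 0) (\<lambda>x. 0)"
  unfolding has_deriv2_def by (auto intro!: continuous_intros)

text \<open>Cubes of positive parts are twice continuously differentiable, and the two parts never
  vanish together, so \<open>step\<close> is an explicit C2 step from 0 to 1. The thresholds 1 and 4
  become radii 1 and 2, because the argument will be a squared modulus.\<close>

definition step_num :: "real \<Rightarrow> real" where "step_num s = max 0 (s - 1)"
definition step_co :: "real \<Rightarrow> real" where "step_co s = max 0 (4 - s)"
definition step_den :: "real \<Rightarrow> real" where "step_den s = step_num s ^ 3 + step_co s ^ 3"
definition step :: "real \<Rightarrow> real" where "step s = step_num s ^ 3 / step_den s"
definition step1 :: "real \<Rightarrow> real" where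
  "step1 s = 3 * (step_num s ^ 2 * step_co s ^ 3 + step_num s ^ 3 * step_co s ^ 2) / (step_den s)\<^sup>2"
definition step2 :: "real \<Rightarrow> real" where
  "step2 s = ((6 * step_num s * step_co s ^ 3 - 6 * step_num s ^ 3 * step_co s) * (step_den s)\<^sup>2
     - 3 * (step_num s ^ 2 * step_co s ^ 3 + step_num s ^ 3 * step_co s ^ 2)
       * (2 * step_den s * (3 * step_num s ^ 2 - 3 * step_co s ^ 2))) / (step_den s) ^ 4"

lemma step_den_pos: "step_den s > 0"
proof (cases "s > 1")
  case True then show ?thesis unfolding step_den_def step_num_def step_co_def by (intro add_pos_nonneg) auto
next
  case False then show ?thesis unfolding step_den_def step_num_def step_co_def by (intro add_nonneg_pos) auto
qed

lemma DERIV_step_parts: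
  "((\<lambda>s. step_num s ^ 3) has_real_derivative 3 * step_num s ^ 2) (at s)"
  "((\<lambda>s. step_num s ^ 2) has_real_derivative 2 * step_num s) (at s)"
  "((\<lambda>s. step_co s ^ 3) has_real_derivative - 3 * step_co s ^ 2) (at s)"
  "((\<lambda>s. step_co s ^ 2) has_real_derivative - 2 * step_co s) (at s)"
proof -
  have *: "((\<lambda>s. max 0 (c * s + d) ^ n) has_real_derivative c * (real n * max 0 (c * s + d) ^ (n - 1))) (at s)"
    if "n \<ge> 2" for c d :: real and n
  proof -
    have "((\<lambda>s. c * s + d) has_real_derivative c) (at s)"
      by (auto intro!: derivative_eq_intros)
    from DERIV_chain2[OF DERIV_max0_power[OF that] this] show ?thesis by (simp add: mult.commute)
  qed
  show "((\<lambda>s. step_num s ^ 3) has_real_derivative 3 * step_num s ^ 2) (at s)"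
    "((\<lambda>s. step_num s ^ 2) has_real_derivative 2 * step_num s) (at s)"
    "((\<lambda>s. step_co s ^ 3) has_real_derivative - 3 * step_co s ^ 2) (at s)"
    "((\<lambda>s. step_co s ^ 2) has_real_derivative - 2 * step_co s) (at s)"
    unfolding step_num_def step_co_def
    using *[of 3 1 "-1"] *[of 2 1 "-1"] *[of 3 "-1" 4] *[of 2 "-1" 4] by (simp_all add: eval_nat_numeral)
qed

lemma DERIV_step_den: "(step_den has_real_derivative 3 * step_num s ^ 2 - 3 * step_co s ^ 2) (at s)"
  unfolding step_den_def[abs_def] by (rule derivative_eq_intros DERIV_step_parts refl | simp)+

lemma has_deriv2_step: "has_deriv2 step step1 step2"
proof -
  have nz: "step_den s \<noteq> 0" for s using step_den_pos[of s] by simp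
  have 1: "(step has_real_derivative step1 s) (at s)" for s
    unfolding step_def[abs_def] step1_def
    by (rule derivative_eq_intros DERIV_step_parts DERIV_step_den refl nz | simp)+
      (simp add: step_den_def power2_eq_square power3_eq_cube algebra_simps)
  have 2: "(step1 has_real_derivative step2 s) (at s)" for s
    unfolding step1_def[abs_def] step2_def
    by (rule DERIV_step_parts DERIV_step_den derivative_eq_intros refl | simp add: nz)+
  have "continuous_on UNIV step_num" "continuous_on UNIV step_co"
    unfolding step_num_def[abs_def] step_co_def[abs_def] by (intro continuous_intros)+
  then have 3: "continuous_on UNIV step2"
    unfolding step2_def[abs_def] step_den_def[abs_def]
    using nz by (intro continuous_intros) (auto simp: step_den_def)
  show ?thesis using 1 2 3 by (simp add: has_deriv2_def)
qed

lemma step_0: "s \<le> 1 \<Longrightarrow> step s = 0" "s \<le> 1 \<Longrightarrow> step1 s = 0" "s \<le> 1 \<Longrightarrow> step2 s = 0"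
  by (simp_all add: step_def step1_def step2_def step_num_def)

lemma step_1: "s \<ge> 4 \<Longrightarrow> step s = 1" "s \<ge> 4 \<Longrightarrow> step1 s = 0" "s \<ge> 4 \<Longrightarrow> step2 s = 0"
  using step_den_pos[of s]
  by (simp_all add: step_def step1_def step2_def step_co_def step_den_def)

lemma step1_nonneg: "step1 s \<ge> 0"
  unfolding step1_def by (intro divide_nonneg_nonneg mult_nonneg_nonneg add_nonneg_nonneg)
    (auto simp: step_num_def step_co_def)

lemma step_mono: "s \<le> t \<Longrightarrow> step s \<le> step t"
  by (rule DERIV_nonneg_imp_nondecreasing) (use has_deriv2_step step1_nonneg in \<open>auto simp: has_deriv2_def\<close>)

lemma step_bounds: "0 \<le> step s" "step s \<le> 1"
  using step_mono[of "min s 1" s] step_0(1)[of "min s 1"] step_mono[of s "max s 4"] step_1(1)[of "max s 4"] by auto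

text \<open>The profile of which x times the value at |z|^2 is Re (1/z) cut off near the origin.\<close>

definition inv_cut :: "real \<Rightarrow> real" where "inv_cut s = step s / s"
definition inv_cut1 :: "real \<Rightarrow> real" where "inv_cut1 s = step1 s / s - step s / s\<^sup>2"
definition inv_cut2 :: "real \<Rightarrow> real" where "inv_cut2 s = step2 s / s - 2 * step1 s / s\<^sup>2 + 2 * step s / s ^ 3"

lemma inv_cut_0: "s \<le> 1 \<Longrightarrow> inv_cut s = 0" "s \<le> 1 \<Longrightarrow> inv_cut1 s = 0" "s \<le> 1 \<Longrightarrow> inv_cut2 s = 0"
  by (simp_all add: inv_cut_def inv_cut1_def inv_cut2_def step_0)

lemma inv_cut_4: "s \<ge> 4 \<Longrightarrow> inv_cut s = 1 / s" "s \<ge> 4 \<Longrightarrow> inv_cut1 s = - 1 / s\<^sup>2" "s \<ge> 4 \<Longrightarrow> inv_cut2 s = 2 / s ^ 3"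
  by (simp_all add: inv_cut_def inv_cut1_def inv_cut2_def step_1)

lemma has_deriv2_inv_cut: "has_deriv2 inv_cut inv_cut1 inv_cut2"
proof -
  have st: "(step has_real_derivative step1 x) (at x)" "(step1 has_real_derivative step2 x) (at x)" for x
    using has_deriv2_step by (auto simp: has_deriv2_def)
  have ev0: "eventually (\<lambda>y::real. y < 1) (nhds x)" if "x < 1" for x
    using that by (rule order_tendstoD(2)[OF filterlim_ident])
  have e1: "(inv_cut has_real_derivative inv_cut1 s) (at s)" for s
  proof (cases "s < 1")
    case True
    have "eventually (\<lambda>y. inv_cut y = 0) (nhds s)" using ev0[OF True] by eventually_elim (simp add: inv_cut_0)
    then show ?thesis by (subst DERIV_cong_ev[OF refl _ refl]) (use True in \<open>auto simp: inv_cut_0\<close>)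
  next
    case False
    then show ?thesis unfolding inv_cut_def[abs_def] inv_cut1_def
      by (auto intro!: derivative_eq_intros st simp: field_simps power2_eq_square)
  qed
  have e2: "(inv_cut1 has_real_derivative inv_cut2 s) (at s)" for s
  proof (cases "s < 1")
    case True
    have "eventually (\<lambda>y. inv_cut1 y = 0) (nhds s)" using ev0[OF True] by eventually_elim (simp add: inv_cut_0)
    then show ?thesis by (subst DERIV_cong_ev[OF refl _ refl]) (use True in \<open>auto simp: inv_cut_0\<close>)
  next
    case False
    then show ?thesis unfolding inv_cut1_def[abs_def] inv_cut2_def
      by (auto intro!: derivative_eq_intros st simp: field_simps power2_eq_square power3_eq_cube)
  qed
  \<comment> \<open>Two overlapping open sets cover the line: on the first the function is 0, on the
    second the denominators stay away from 0.\<close>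
  have "continuous_on ({..<1} \<union> {1/2<..}) inv_cut2"
  proof (rule continuous_on_open_Un)
    have "continuous_on {..<1} (\<lambda>s::real. 0::real)" by (rule continuous_on_const)
    then show "continuous_on {..<1} inv_cut2"
      by (rule continuous_on_eq) (auto simp: inv_cut_0)
    show "continuous_on {1/2<..} inv_cut2" unfolding inv_cut2_def[abs_def]
      by (intro continuous_intros continuous_on_subset[OF has_deriv2_continuous(1)[OF has_deriv2_step]]
         continuous_on_subset[OF has_deriv2_continuous(2)[OF has_deriv2_step]]
         continuous_on_subset[OF has_deriv2_continuous(3)[OF has_deriv2_step]]) auto
  qed auto
  moreover have "{..<1} \<union> {1/2<..} = (UNIV :: real set)" by auto
  ultimately show ?thesis using e1 e2 by (simp add: has_deriv2_def)
qed

text \<open>Beyond 4 the formulas are explicit powers of 1/s, and between 1 and 4 continuity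
  suffices. The factor \<open>s\<close> is the one that accompanies the second derivative in the
  radial Laplacian.\<close>

lemma inv_cut_bounds: "\<exists>C>0. \<forall>s. \<bar>inv_cut s\<bar> \<le> C \<and> \<bar>inv_cut1 s\<bar> \<le> C \<and> \<bar>s * inv_cut2 s\<bar> \<le> C"
proof -
  note c = has_deriv2_continuous[OF has_deriv2_inv_cut]
  obtain C0 where C0: "\<And>s. s \<in> {1..4} \<Longrightarrow> \<bar>inv_cut s\<bar> \<le> C0" using continuous_bounded_Icc[OF c(1)] by blast
  obtain C1 where C1: "\<And>s. s \<in> {1..4} \<Longrightarrow> \<bar>inv_cut1 s\<bar> \<le> C1" using continuous_bounded_Icc[OF c(2)] by blast
  obtain C2 where C2: "\<And>s. s \<in> {1..4} \<Longrightarrow> \<bar>s * inv_cut2 s\<bar> \<le> C2"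
    using continuous_bounded_Icc[of "\<lambda>s. s * inv_cut2 s", OF continuous_on_mult[OF continuous_on_id c(3)]] by blast
  define C where "C = 1 + \<bar>C0\<bar> + \<bar>C1\<bar> + \<bar>C2\<bar>"
  have "\<bar>inv_cut s\<bar> \<le> C \<and> \<bar>inv_cut1 s\<bar> \<le> C \<and> \<bar>s * inv_cut2 s\<bar> \<le> C" for s
  proof -
    consider "s \<le> 1" | "s \<in> {1..4}" | "s \<ge> 4" by force
    then show ?thesis
    proof cases
      case 1 then show ?thesis by (simp add: inv_cut_0 C_def)
    next
      case 2 then show ?thesis using C0[OF 2] C1[OF 2] C2[OF 2] by (auto simp: C_def)
    next
      case 3
      have "s\<^sup>2 \<ge> 4\<^sup>2" using 3 by (intro power_mono) auto
      then have "\<bar>inv_cut s\<bar> \<le> 1" "\<bar>inv_cut1 s\<bar> \<le> 1" "\<bar>s * inv_cut2 s\<bar> \<le> 1"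
        using 3 by (auto simp: inv_cut_4 divide_simps power3_eq_cube power2_eq_square)
      then show ?thesis by (auto simp: C_def)
    qed
  qed
  then show ?thesis by (intro exI[of _ C]) (auto simp: C_def)
qed

text \<open>Up to the factor x = Re z, the Laplacian of x times the profile at |z|^2; it vanishes where the
  profile is 1/s because Re (1/z) is harmonic.\<close>

definition inv_cut_lap :: "real \<Rightarrow> real" where "inv_cut_lap s = 8 * inv_cut1 s + 4 * s * inv_cut2 s"

lemma inv_cut_lap_0: "s \<le> 1 \<or> s \<ge> 4 \<Longrightarrow> inv_cut_lap s = 0"
  by (auto simp: inv_cut_lap_def inv_cut_0 inv_cut_4 power2_eq_square power3_eq_cube)

text \<open>A cutoff of 1/s to the ring from radius \<open>a\<close> to radius \<open>2 * b\<close>,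
  exact from \<open>2 * a\<close> to \<open>b\<close>. As a difference of one profile at two scales
  it telescopes in the endpoints, so the weights of adjacent rings add up without error. For
  \<open>b = 2 * a\<close> the exact part shrinks to a circle.\<close>

definition ring_wt :: "real \<Rightarrow> real \<Rightarrow> real \<Rightarrow> real" where
  "ring_wt a b s = inv_cut (s / a\<^sup>2) / a\<^sup>2 - inv_cut (s / b\<^sup>2) / b\<^sup>2"
definition ring_wt1 :: "real \<Rightarrow> real \<Rightarrow> real \<Rightarrow> real" where
  "ring_wt1 a b s = inv_cut1 (s / a\<^sup>2) / a ^ 4 - inv_cut1 (s / b\<^sup>2) / b ^ 4"
definition ring_wt2 :: "real \<Rightarrow> real \<Rightarrow> real \<Rightarrow> real" where
  "ring_wt2 a b s = inv_cut2 (s / a\<^sup>2) / a ^ 6 - inv_cut2 (s / b\<^sup>2) / b ^ 6"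

lemma has_deriv2_ring_wt: "has_deriv2 (ring_wt a b) (ring_wt1 a b) (ring_wt2 a b)"
proof -
  have "has_deriv2 (\<lambda>s. inv_cut (s / a\<^sup>2) / a\<^sup>2) (\<lambda>s. inv_cut1 (s / a\<^sup>2) / a ^ 4) (\<lambda>s. inv_cut2 (s / a\<^sup>2) / a ^ 6)" for a
    using has_deriv2_scale[OF has_deriv2_inv_cut, of "1 / a\<^sup>2" "1 / a\<^sup>2"]
    by (simp add: power_divide flip: power_mult power_add power_Suc)
  then show ?thesis unfolding ring_wt_def[abs_def] ring_wt1_def[abs_def] ring_wt2_def[abs_def] by (intro has_deriv2_diff)
qed

context
  fixes a b :: real
  assumes ab: "0 < a" "a \<le> b"
begin

lemma ring_wt_eq: "ring_wt a b s = (step (s / a\<^sup>2) - step (s / b\<^sup>2)) / s"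
  using ab by (simp add: ring_wt_def inv_cut_def diff_divide_distrib)

lemma ring_wt_nonneg: "0 \<le> ring_wt a b s"
proof (cases "s > 0")
  case True
  have "s / b\<^sup>2 \<le> s / a\<^sup>2" using True ab by (intro divide_left_mono power_mono) auto
  then show ?thesis using True step_mono by (simp add: ring_wt_eq)
next
  case False
  then have "s / a\<^sup>2 \<le> 1" "s / b\<^sup>2 \<le> 1" using ab by (auto simp: divide_simps intro: order_trans[of _ 0])
  then show ?thesis by (simp add: ring_wt_def inv_cut_0)
qed

lemma ring_wt_inner: "s \<le> a\<^sup>2 \<Longrightarrow> ring_wt a b s = 0" "s \<le> a\<^sup>2 \<Longrightarrow> ring_wt1 a b s = 0" "s \<le> a\<^sup>2 \<Longrightarrow> ring_wt2 a b s = 0"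
proof -
  assume s: "s \<le> a\<^sup>2"
  have "a\<^sup>2 \<le> b\<^sup>2" using ab by (intro power_mono) auto
  then have "s \<le> b\<^sup>2" using s by linarith
  then have "s / a\<^sup>2 \<le> 1" "s / b\<^sup>2 \<le> 1" using ab s by (auto simp: divide_simps)
  then show "ring_wt a b s = 0" "ring_wt1 a b s = 0" "ring_wt2 a b s = 0"
    by (simp_all add: ring_wt_def ring_wt1_def ring_wt2_def inv_cut_0)
qed

lemma ring_wt_outer: "s \<ge> 4 * b\<^sup>2 \<Longrightarrow> ring_wt a b s = 0" "s \<ge> 4 * b\<^sup>2 \<Longrightarrow> ring_wt1 a b s = 0" "s \<ge> 4 * b\<^sup>2 \<Longrightarrow> ring_wt2 a b s = 0"
proof -
  assume s: "s \<ge> 4 * b\<^sup>2"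
  have "a\<^sup>2 \<le> b\<^sup>2" using ab by (intro power_mono) auto
  then have "s \<ge> 4 * a\<^sup>2" using s by linarith
  then have "s / a\<^sup>2 \<ge> 4" "s / b\<^sup>2 \<ge> 4" "s > 0"
    using ab s by (auto simp: field_simps intro: less_le_trans[of _ "4 * b\<^sup>2"])
  then show "ring_wt a b s = 0" "ring_wt1 a b s = 0" "ring_wt2 a b s = 0"
    using ab by (simp_all add: ring_wt_def ring_wt1_def ring_wt2_def inv_cut_4 power_divide flip: power_mult)
qed

lemma ring_wt_mid: "4 * a\<^sup>2 \<le> s \<Longrightarrow> s \<le> b\<^sup>2 \<Longrightarrow> ring_wt a b s = 1 / s"
proof -
  assume "4 * a\<^sup>2 \<le> s" "s \<le> b\<^sup>2"
  then have "s / a\<^sup>2 \<ge> 4" "s / b\<^sup>2 \<le> 1" using ab by (auto simp: field_simps)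
  then show ?thesis using ab by (simp add: ring_wt_eq step_1 step_0)
qed

lemma ring_wt_le: "s > 0 \<Longrightarrow> ring_wt a b s \<le> 1 / s"
  using step_bounds[of "s / a\<^sup>2"] step_bounds[of "s / b\<^sup>2"] by (simp add: ring_wt_eq divide_right_mono)

text \<open>The left-hand side is the Laplacian of \<open>x\<close> times the weight, divided by
  \<open>x\<close>. It splits into one term for each cutoff circle, which is the origin of the two
  flux terms of a ring.\<close>

lemma ring_wt_lap: "8 * ring_wt1 a b s + 4 * s * ring_wt2 a b s = inv_cut_lap (s / a\<^sup>2) / a ^ 4 - inv_cut_lap (s / b\<^sup>2) / b ^ 4"
  using ab by (simp add: ring_wt1_def ring_wt2_def inv_cut_lap_def field_simps)

end

text \<open>The powers of \<open>a\<close> are dictated by scaling; the terms at scale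
  \<open>b\<close> are smaller because \<open>a \<le> b\<close>.\<close>

lemma ring_wt_bounds: "\<exists>C>0. \<forall>a b s. 0 < a \<longrightarrow> a \<le> b \<longrightarrow> \<bar>ring_wt a b s\<bar> \<le> C / a\<^sup>2 \<and> \<bar>ring_wt1 a b s\<bar> \<le> C / a ^ 4
   \<and> \<bar>s * ring_wt2 a b s\<bar> \<le> C / a ^ 4"
proof -
  obtain C where C: "C > 0" "\<And>s. \<bar>inv_cut s\<bar> \<le> C" "\<And>s. \<bar>inv_cut1 s\<bar> \<le> C" "\<And>s. \<bar>s * inv_cut2 s\<bar> \<le> C"
    using inv_cut_bounds by blast
  have "\<bar>ring_wt a b s\<bar> \<le> 2 * C / a\<^sup>2 \<and> \<bar>ring_wt1 a b s\<bar> \<le> 2 * C / a ^ 4 \<and> \<bar>s * ring_wt2 a b s\<bar> \<le> 2 * C / a ^ 4"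
    if "0 < a" "a \<le> b" for a b s
  proof -
    have le: "\<bar>x / a ^ n - y / b ^ n\<bar> \<le> 2 * C / a ^ n" if "\<bar>x\<bar> \<le> C" "\<bar>y\<bar> \<le> C" for x y n
    proof -
      have "\<bar>x / a ^ n - y / b ^ n\<bar> \<le> \<bar>x / a ^ n\<bar> + \<bar>y / b ^ n\<bar>" by (rule abs_triangle_ineq4)
      also have "\<bar>x / a ^ n\<bar> \<le> C / a ^ n" using that \<open>0 < a\<close> by (simp add: divide_right_mono)
      also have "\<bar>y / b ^ n\<bar> \<le> C / a ^ n"
        unfolding abs_divide using that \<open>0 < a\<close> \<open>a \<le> b\<close> C(1) by (intro frac_le) (auto intro: power_mono)
      finally show ?thesis by simp
    qed
    have *: "s * ring_wt2 a b s = (s / a\<^sup>2 * inv_cut2 (s / a\<^sup>2)) / a ^ 4 - (s / b\<^sup>2 * inv_cut2 (s / b\<^sup>2)) / b ^ 4"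
      using that by (simp add: ring_wt2_def field_simps)
    show ?thesis unfolding * ring_wt_def ring_wt1_def using le C(2-4) by blast
  qed
  then show ?thesis using C(1) by (intro exI[of _ "2 * C"]) auto
qed


section \<open>Subharmonic functions of finite type\<close>

lemma measurable_cball [measurable]: "cball (z::complex) r \<in> sets borel"
  by simp

lemma subharmonic_usc:
  assumes "subharmonic_C u"
  shows "open {w. u w < c}"
  unfolding open_subopen[of "{w. u w < c}"]
proof (intro ballI)
  fix z assume "z \<in> {w. u w < c}"
  then have z: "u z < c" by simp
  then have "Limsup (at z) u < c" using assms unfolding subharmonic_C_def by (meson le_less_trans)
  then have "eventually (\<lambda>w. u w < c) (at z)" by (rule Limsup_lessD)
  then have "eventually (\<lambda>w. u w < c) (nhds z)" using z by (auto simp: eventually_at_filter elim: eventually_mono)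
  then show "\<exists>T. open T \<and> z \<in> T \<and> T \<subseteq> {w. u w < c}" unfolding eventually_nhds by auto
qed

lemma subharmonic_borel: "subharmonic_C u \<Longrightarrow> u \<in> borel_measurable borel"
  by (rule borel_measurableI_less) (simp add: subharmonic_usc)

lemma subharmonic_bounded_above:
  assumes u: "subharmonic_C u" and "compact K"
  obtains c :: real where "\<And>z. z \<in> K \<Longrightarrow> u z \<le> ereal c"
proof -
  have "K \<subseteq> \<Union> ((\<lambda>n::nat. {w. u w < ereal n}) ` UNIV)"
  proof
    fix z
    have "u z < \<infinity>" using u by (auto simp: subharmonic_C_def)
    then obtain n :: nat where "u z < ereal n" using less_PInf_Ex_of_nat by auto
    then show "z \<in> \<Union> ((\<lambda>n::nat. {w. u w < ereal n}) ` UNIV)" by auto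
  qed
  then obtain C where C: "C \<subseteq> UNIV" "finite C" "K \<subseteq> \<Union> ((\<lambda>n::nat. {w. u w < ereal n}) ` C)"
    using compactE_image[OF \<open>compact K\<close>, of UNIV "\<lambda>n::nat. {w. u w < ereal n}"] subharmonic_usc[OF u]
    by metis
  show thesis
  proof
    fix z assume "z \<in> K"
    then obtain n where n: "n \<in> C" "u z < ereal n" using C by auto
    then have "n \<le> Max (insert 0 C)" using C by simp
    then have "ereal n \<le> ereal (Max (insert 0 C))" by simp
    then show "u z \<le> ereal (Max (insert 0 C))" using n(2) by (meson less_imp_le order_trans)
  qed
qed

text \<open>Near the origin compactness gives a constant, which \<open>t \<ge> 1\<close> turns into
  a multiple of \<open>t\<close>. The factor 20 leaves room for all discs used at scale
  \<open>t\<close>; test functions will live in radius \<open>16 * t\<close>.\<close>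

lemma finite_type_linear_bound:
  assumes u: "subharmonic_C u" and ft: "finite_type u"
  obtains B where "B > 0" "\<And>t z. t \<ge> 1 \<Longrightarrow> cmod z \<le> 20 * t \<Longrightarrow> u z \<le> ereal (B * t)"
proof -
  obtain c :: real where c: "Limsup at_infinity (\<lambda>z. u z / ereal (norm z)) < ereal c"
    using ft less_PInf_Ex_of_nat[of "Limsup at_infinity (\<lambda>z. u z / ereal (norm z))"]
    unfolding finite_type_def by auto
  have "eventually (\<lambda>z. u z / ereal (norm z) < ereal c) at_infinity" by (rule Limsup_lessD[OF c])
  then obtain b where b: "\<And>z. norm z \<ge> b \<Longrightarrow> u z / ereal (norm z) < ereal c"
    unfolding eventually_at_infinity by auto
  obtain d where d: "\<And>z. z \<in> cball 0 (max 1 b) \<Longrightarrow> u z \<le> ereal d"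
    using subharmonic_bounded_above[OF u compact_cball] by blast
  define B where "B = 20 * \<bar>c\<bar> + \<bar>d\<bar> + 1"
  show thesis
  proof
    show "B > 0" by (simp add: B_def)
    fix t z assume t: "(t::real) \<ge> 1" "cmod z \<le> 20 * t"
    have dt: "\<bar>d\<bar> \<le> \<bar>d\<bar> * t" using t(1) by (simp add: mult_le_cancel_left1)
    show "u z \<le> ereal (B * t)"
    proof (cases "cmod z \<le> max 1 b")
      case True
      then have "u z \<le> ereal d" using d by simp
      also have "d \<le> B * t"
        using dt t(1) mult_nonneg_nonneg[of "20 * \<bar>c\<bar>" t]
        by (simp add: B_def algebra_simps del: mult_nonneg_nonneg)
      finally show ?thesis by simp
    next
      case False
      then have z: "cmod z > 0" and "u z / ereal (cmod z) < ereal c" using b by auto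
      then have "u z \<le> ereal (c * cmod z)"
        by (cases "u z") (auto simp: divide_simps)
      also have "c * cmod z \<le> \<bar>c\<bar> * (20 * t)" using t z by (intro mult_mono) auto
      also have "\<dots> \<le> B * t" using t(1) by (simp add: B_def algebra_simps)
      finally show ?thesis by simp
    qed
  qed
qed

text \<open>Subtraction truncated at 0. Where u is at most A nothing is cut off, and the value is
  infinite exactly where u is \<open>-\<infinity>\<close>.\<close>

definition defect :: "real \<Rightarrow> (complex \<Rightarrow> ereal) \<Rightarrow> complex \<Rightarrow> ennreal" where
  "defect A u z = e2ennreal (ereal A - u z)"

lemma less_e2ennreal_iff: "a < e2ennreal x \<longleftrightarrow> enn2ereal a < x"
proof (cases "x \<ge> 0")
  case True then show ?thesis by (simp add: less_ennreal.rep_eq enn2ereal_e2ennreal)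
next
  case False
  then have "e2ennreal x = 0" by (simp add: e2ennreal_neg)
  moreover have "\<not> enn2ereal a < x" using False enn2ereal_nonneg[of a] by (meson less_imp_le order_trans)
  ultimately show ?thesis by simp
qed

lemma lsc_defect:
  assumes u: "subharmonic_C u"
  shows "lsc (defect A u)"
  unfolding lsc_def
proof
  fix a :: ennreal
  have "enn2ereal a < ereal A - u w \<longleftrightarrow> u w < ereal A - enn2ereal a" for w
    by (cases "u w"; cases "enn2ereal a"; use enn2ereal_nonneg[of a] in auto)
  then have "{w. a < defect A u w} = {w. u w < ereal A - enn2ereal a}"
    by (simp add: defect_def less_e2ennreal_iff)
  then show "open {w. a < defect A u w}" using subharmonic_usc[OF u] by simp
qed

text \<open>The bound on the circle makes the integral of the positive part of u finite, but that of
  the negative part may be infinite. Therefore the identity (A - u) + u^+ = A + u^- is integrated,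
  which contains no subtraction of integrals, and solved afterwards.\<close>

lemma cavg_defect:
  assumes u: "subharmonic_C u" and A: "A \<ge> 0" and le: "\<And>w. w \<in> sphere z \<bar>r\<bar> \<Longrightarrow> u w \<le> ereal A"
  shows "cavg (defect A u) z (of_real r) = e2ennreal (ereal A - circle_mean u z r)"
proof -
  note [measurable] = subharmonic_borel[OF u] lsc_measurable[OF lsc_defect[OF u]]
  let ?I = "\<lambda>t. indicator {0..2*pi} t :: ennreal"
  let ?w = "\<lambda>\<theta>. z + of_real r * cis \<theta>"
  define P where "P = (\<integral>\<^sup>+ \<theta>. ?I \<theta> * e2ennreal (u (?w \<theta>)) \<partial>lborel)"
  define Q where "Q = (\<integral>\<^sup>+ \<theta>. ?I \<theta> * e2ennreal (- u (?w \<theta>)) \<partial>lborel)"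
  define X where "X = (\<integral>\<^sup>+ \<theta>. ?I \<theta> * defect A u (?w \<theta>) \<partial>lborel)"
  have w: "u (?w \<theta>) \<le> ereal A" for \<theta> by (rule le) (simp add: dist_norm norm_mult)
  have ptw: "defect A u (?w \<theta>) + e2ennreal (u (?w \<theta>)) = ennreal A + e2ennreal (- u (?w \<theta>))" for \<theta>
    using w[of \<theta>] A unfolding defect_def
  proof (cases "u (?w \<theta>)")
    case (real x)
    then have "x \<le> A" using w[of \<theta>] by simp
    then have "ennreal (A - x) + ennreal x = ennreal A + ennreal (- x)"
      by (cases "x \<ge> 0") (use A in \<open>auto simp: ennreal_plus[symmetric] ennreal_neg simp del: ennreal_plus\<close>)
    then show "e2ennreal (ereal A - u (?w \<theta>)) + e2ennreal (u (?w \<theta>)) = ennreal A + e2ennreal (- u (?w \<theta>))"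
      using real by simp
  qed auto
  have "X + P = (\<integral>\<^sup>+ \<theta>. ?I \<theta> * (defect A u (?w \<theta>) + e2ennreal (u (?w \<theta>))) \<partial>lborel)"
    unfolding X_def P_def distrib_left by (rule nn_integral_add[symmetric]) measurable
  also have "\<dots> = (\<integral>\<^sup>+ \<theta>. ennreal A * ?I \<theta> + ?I \<theta> * e2ennreal (- u (?w \<theta>)) \<partial>lborel)"
    unfolding ptw by (simp add: distrib_left mult.commute)
  also have "\<dots> = ennreal (A * (2 * pi)) + Q"
    unfolding Q_def using A by (subst nn_integral_add) (auto simp: nn_integral_cmult_indicator ennreal_mult)
  finally have XP: "X + P = ennreal (A * (2 * pi)) + Q" .
  have "P \<le> (\<integral>\<^sup>+ \<theta>. ennreal A * ?I \<theta> \<partial>lborel)"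
    unfolding P_def using e2ennreal_mono[OF w] by (intro nn_integral_mono) (auto simp: indicator_def)
  also have "\<dots> = ennreal (A * (2 * pi))" using A by (simp add: nn_integral_cmult_indicator ennreal_mult)
  finally have "P < \<infinity>" by (rule le_less_trans) simp
  then obtain p where p: "p \<ge> 0" "P = ennreal p" by (cases P) auto
  have cm: "circle_mean u z r = ereal (1 / (2 * pi)) * (enn2ereal P - enn2ereal Q)"
    by (simp add: circle_mean_def P_def Q_def)
  have ca: "cavg (defect A u) z (of_real r) = ennreal (1 / (2 * pi)) * X"
    by (simp add: cavg_def X_def mult.commute)
  show ?thesis
  proof (cases Q)
    case top
    then have "X = \<infinity>" using XP p by (cases X) (auto simp: ennreal_plus[symmetric] simp del: ennreal_plus)
    moreover have "circle_mean u z r = - \<infinity>" unfolding cm using top p by (simp add: top_ereal_def)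
    ultimately show ?thesis unfolding ca by (simp add: ennreal_mult_top)
  next
    case (real q)
    then obtain x where x: "x \<ge> 0" "X = ennreal x"
      using XP p A by (cases X) (auto simp: ennreal_plus[symmetric] simp del: ennreal_plus)
    have "ennreal (x + p) = ennreal (A * (2 * pi) + q)"
      using XP x p real A by (simp add: ennreal_plus)
    then have xp: "x + p = A * (2 * pi) + q" using x p real A by (subst (asm) ennreal_inj) auto
    have "circle_mean u z r = ereal (1 / (2 * pi) * (p - q))"
      unfolding cm using p real by simp
    then have "ereal A - circle_mean u z r = ereal (A - 1 / (2 * pi) * (p - q))" by simp
    also have "A - 1 / (2 * pi) * (p - q) = 1 / (2 * pi) * x"
      using xp by (simp add: field_simps)
    finally show ?thesis unfolding ca using x by (simp add: ennreal_mult' del: times_divide_eq_left)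
  qed
qed

lemma supermean_defect:
  assumes u: "subharmonic_C u" and A: "A \<ge> 0" and le: "\<And>w. w \<in> D \<Longrightarrow> u w \<le> ereal A"
  shows "supermean_on D (defect A u)"
  unfolding supermean_on_def
proof (intro allI impI)
  fix p :: complex and r :: real assume r: "r > 0" "cball p r \<subseteq> D"
  have "cavg (defect A u) p (of_real r) = e2ennreal (ereal A - circle_mean u p r)"
    by (rule cavg_defect[OF u A]) (use le r in auto)
  also have "\<dots> \<le> defect A u p"
    unfolding defect_def using u r(1) by (intro e2ennreal_mono ereal_minus_mono) (auto simp: subharmonic_C_def)
  finally show "cavg (defect A u) p (of_real r) \<le> defect A u p" .
qed

text \<open>A subharmonic function with its Riesz measure, observed at scale t: it is at most B t on a
  large disc, and its defect below that bound and its mass have the size dictated by finite type.\<close>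

locale subharmonic_scale =
  fixes u :: "complex \<Rightarrow> ereal" and \<mu> :: "complex measure" and B C t :: real
  assumes sh: "subharmonic_C u" and riesz: "riesz_measure u \<mu>"
    and B: "B > 0" and C: "C > 0" and t: "t \<ge> 1"
    and above: "\<And>z. cmod z \<le> 20 * t \<Longrightarrow> u z \<le> ereal (B * t)"
    and below: "(\<integral>\<^sup>+ z. indicator (cball 0 (16 * t)) z * defect (B * t) u z \<partial>lborel) \<le> ennreal (C * t ^ 3)"
begin

abbreviation "N \<equiv> defect (B * t) u"
text \<open>A real-valued version for Bochner integrals; by local integrability it agrees with
  \<open>N\<close> almost everywhere on the disc of radius \<open>16 * t\<close>.\<close>

definition "n z = enn2real (N z)"

lemma N_measurable [measurable]: "N \<in> borel_measurable borel"
  by (rule lsc_measurable[OF lsc_defect[OF sh]])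

lemma n_measurable [measurable]: "n \<in> borel_measurable borel"
  unfolding n_def by measurable

lemma n_nonneg: "n z \<ge> 0" by (simp add: n_def)

lemma sets_\<mu> [measurable_cong]: "sets \<mu> = sets borel"
  using riesz by (simp add: riesz_measure_def)

lemma AE_N: "AE z in lborel. z \<in> cball 0 (16 * t) \<longrightarrow> N z = ennreal (n z) \<and> real_of_ereal (u z) = B * t - n z"
proof -
  have "AE z in lborel. indicator (cball 0 (16 * t)) z * N z \<noteq> \<infinity>"
    by (rule nn_integral_PInf_AE) (measurable, use below in \<open>auto simp: top_unique\<close>)
  then show ?thesis
  proof eventually_elim
    case (elim z)
    show ?case
    proof
      assume z: "z \<in> cball 0 (16 * t)"
      then have fin: "N z \<noteq> \<infinity>" using elim by simp
      have le: "u z \<le> ereal (B * t)" using above z t by simp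
      have "u z \<noteq> - \<infinity>" using fin by (auto simp: defect_def)
      then obtain x where x: "u z = ereal x" using le by (cases "u z") auto
      then have "x \<le> B * t" using le by simp
      then show "N z = ennreal (n z) \<and> real_of_ereal (u z) = B * t - n z"
        using x by (simp add: n_def defect_def)
    qed
  qed
qed

lemma nn_integral_n:
  assumes "\<And>z. cmod z > 16 * t \<Longrightarrow> h z = 0"
  shows "(\<integral>\<^sup>+ z. N z * h z \<partial>lborel) = (\<integral>\<^sup>+ z. ennreal (n z) * h z \<partial>lborel)"
proof (rule nn_integral_cong_AE)
  show "AE z in lborel. N z * h z = ennreal (n z) * h z"
    using AE_N
  proof eventually_elim
    case (elim z)
    then show ?case using assms[of z] by (cases "cmod z > 16 * t") auto
  qed
qed

lemma integral_n:
  fixes h :: "complex \<Rightarrow> real"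
  assumes [measurable]: "h \<in> borel_measurable borel" and c: "\<And>z. \<bar>h z\<bar> \<le> c"
    and 0: "\<And>z. cmod z > 16 * t \<Longrightarrow> h z = 0"
  shows "integrable lborel (\<lambda>z. n z * h z)" "\<bar>\<integral>z. n z * h z \<partial>lborel\<bar> \<le> c * (C * t ^ 3)"
proof -
  have c0: "c \<ge> 0" using c[of 0] by linarith
  have "(\<integral>\<^sup>+ z. norm (n z * h z) \<partial>lborel) \<le> (\<integral>\<^sup>+ z. ennreal c * (indicator (cball 0 (16 * t)) z * N z) \<partial>lborel)"
  proof (rule nn_integral_mono_AE)
    show "AE z in lborel. ennreal (norm (n z * h z)) \<le> ennreal c * (indicator (cball 0 (16 * t)) z * N z)"
      using AE_N
    proof eventually_elim
      case (elim z)
      show ?case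
      proof (cases "cmod z > 16 * t")
        case False
        have "ennreal (norm (n z * h z)) \<le> ennreal (c * n z)"
          using c[of z] n_nonneg[of z] by (intro ennreal_leI) (simp add: abs_mult mult.commute[of "n z"] mult_right_mono)
        then show ?thesis using False elim c0 n_nonneg by (simp add: ennreal_mult)
      qed (simp add: 0)
    qed
  qed
  also have "\<dots> = ennreal c * (\<integral>\<^sup>+ z. indicator (cball 0 (16 * t)) z * N z \<partial>lborel)"
    by (rule nn_integral_cmult) measurable
  also have "\<dots> \<le> ennreal c * ennreal (C * t ^ 3)" by (intro mult_left_mono below) simp
  also have "\<dots> = ennreal (c * (C * t ^ 3))" using c0 C t by (simp add: ennreal_mult)
  finally have le: "(\<integral>\<^sup>+ z. norm (n z * h z) \<partial>lborel) \<le> ennreal (c * (C * t ^ 3))" .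
  then show i: "integrable lborel (\<lambda>z. n z * h z)"
    by (intro integrableI_bounded) (auto intro: le_less_trans)
  show "\<bar>\<integral>z. n z * h z \<partial>lborel\<bar> \<le> c * (C * t ^ 3)"
  proof -
    have "ennreal \<bar>\<integral>z. n z * h z \<partial>lborel\<bar> \<le> ennreal (c * (C * t ^ 3))"
      using order_trans[OF integral_norm_bound_ennreal[OF i] le] by simp
    then show ?thesis using c0 C t by (subst (asm) ennreal_le_iff) auto
  qed
qed

lemma riesz_n:
  assumes \<phi>: "test_fun \<phi>" and 0: "\<And>z. cmod z > 16 * t \<Longrightarrow> \<phi> z = 0"
  shows "(\<integral>z. n z * laplacian \<phi> z \<partial>lborel) = - 2 * pi * (\<integral>z. \<phi> z \<partial>\<mu>)"
proof -
  have L: "continuous_on UNIV (laplacian \<phi>)" "\<And>z. cmod z > 16 * t \<Longrightarrow> laplacian \<phi> z = 0"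
    "(\<integral>z. laplacian \<phi> z \<partial>lborel) = 0"
    using laplacian_test_fun[OF \<phi>, of "16 * t"] 0 by blast+
  have [measurable]: "laplacian \<phi> \<in> borel_measurable borel"
    by (rule borel_measurable_continuous_onI[OF L(1)])
  have iL: "integrable lborel (laplacian \<phi>)" by (rule integrable_compact_support[OF L(1,2)])
  have "bounded (laplacian \<phi> ` cball 0 (16 * t))"
    by (intro compact_imp_bounded compact_continuous_image continuous_on_subset[OF L(1)]) auto
  then obtain c where c': "\<forall>x\<in>laplacian \<phi> ` cball 0 (16 * t). norm x \<le> c"
    unfolding bounded_iff by blast
  have c: "\<bar>laplacian \<phi> z\<bar> \<le> c" if "z \<in> cball 0 (16 * t)" for z
    using c' that by auto
  have iN: "integrable lborel (\<lambda>z. n z * laplacian \<phi> z)"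
  proof (rule integral_n(1)[where c="max c 0"])
    show "\<bar>laplacian \<phi> z\<bar> \<le> max c 0" for z
      using c[of z] L(2)[of z] by (cases "cmod z > 16 * t") auto
  qed (use L(2) in auto)
  have [measurable]: "u \<in> borel_measurable borel" by (rule subharmonic_borel[OF sh])
  have "2 * pi * (\<integral>z. \<phi> z \<partial>\<mu>) = (\<integral>z. real_of_ereal (u z) * laplacian \<phi> z \<partial>lborel)"
    using riesz \<phi> by (simp add: riesz_measure_def)
  also have "\<dots> = (\<integral>z. B * t * laplacian \<phi> z - n z * laplacian \<phi> z \<partial>lborel)"
  proof (rule integral_cong_AE)
    show "AE z in lborel. real_of_ereal (u z) * laplacian \<phi> z = B * t * laplacian \<phi> z - n z * laplacian \<phi> z"
      using AE_N
    proof eventually_elim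
      case (elim z)
      then show ?case using L(2)[of z] by (cases "cmod z > 16 * t") (auto simp: left_diff_distrib)
    qed
  qed measurable
  also have "\<dots> = B * t * (\<integral>z. laplacian \<phi> z \<partial>lborel) - (\<integral>z. n z * laplacian \<phi> z \<partial>lborel)"
    using iL iN by simp
  finally show ?thesis using L(3) by simp
qed

end

text \<open>At one point \<open>z0\<close> the function u is finite. The area mean of N about
  \<open>z0\<close> is at most its value there, which is O(t), and the disc of radius
  \<open>17 * t\<close> about \<open>z0\<close> covers the disc of radius \<open>16 * t\<close>
  about 0.\<close>

lemma subharmonic_scale_exists:
  assumes sh: "subharmonic_C u" and riesz: "riesz_measure u \<mu>" and ne: "\<exists>z. u z \<noteq> - \<infinity>"
    and B: "B > 0" and above: "\<And>t z. t \<ge> 1 \<Longrightarrow> cmod z \<le> 20 * t \<Longrightarrow> u z \<le> ereal (B * t)"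
  obtains C T where "C > 0" "T \<ge> 1" "\<And>t. t \<ge> T \<Longrightarrow> subharmonic_scale u \<mu> B C t"
proof -
  obtain z0 x0 where z0: "u z0 = ereal x0" using ne sh by (metis ereal_cases less_irrefl subharmonic_C_def)
  \<comment> \<open>1156 is 4 times the square of 17, from enclosing the disc in a square; the other
    factor bounds \<open>N z0 / t\<close>.\<close>
  define C where "C = 1156 * (B + \<bar>x0\<bar>)"
  define T where "T = max 1 (cmod z0)"
  show thesis
  proof
    show "C > 0" "T \<ge> 1" using B by (auto simp: C_def T_def)
    fix t assume "t \<ge> T"
    then have t: "t \<ge> 1" "cmod z0 \<le> t" by (auto simp: T_def)
    let ?N = "defect (B * t) u" and ?k = "indicator (cball 0 (17 * t)) :: complex \<Rightarrow> ennreal"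
    note [measurable] = lsc_measurable[OF lsc_defect[OF sh]]
    have "(\<integral>\<^sup>+ z. indicator (cball 0 (16 * t)) z * ?N z \<partial>lborel) = (\<integral>\<^sup>+ w. indicator (cball 0 (16 * t)) (z0 + w) * ?N (z0 + w) \<partial>lborel)"
      by (rule nn_integral_translate[symmetric]) measurable
    also have "\<dots> \<le> (\<integral>\<^sup>+ w. ?N (z0 + of_real 1 * w) * ?k w \<partial>lborel)"
    proof (rule nn_integral_mono)
      fix w :: complex
      have "cmod w \<le> cmod (z0 + w) + cmod z0" using norm_triangle_ineq4[of "z0 + w" z0] by simp
      then show "indicator (cball 0 (16 * t)) (z0 + w) * ?N (z0 + w) \<le> ?N (z0 + of_real 1 * w) * ?k w"
        using t by (auto simp: indicator_def)
    qed
    also have "\<dots> \<le> cavg ?N z0 (of_real 0) * (\<integral>\<^sup>+ w. ?k w \<partial>lborel)"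
    proof (rule radial_mean_le_cavg[where D="cball 0 (20 * t)" and s="17 * t"])
      show "lsc ?N" by (rule lsc_defect[OF sh])
      show "supermean_on (cball 0 (20 * t)) ?N"
        by (rule supermean_defect[OF sh]) (use B t above in auto)
      show "cball z0 (17 * t) \<subseteq> cball 0 (20 * t)"
        using t by (intro cball_subset_cball_iff[THEN iffD2] disjI1) (simp add: dist_norm)
    qed (auto simp: indicator_def norm_mult)
    also have "\<dots> = ?N z0 * emeasure lborel (cball (0::complex) (17 * t))"
      by (simp add: cavg_0)
    also have "\<dots> \<le> ennreal ((B + \<bar>x0\<bar>) * t) * ennreal (4 * (17 * t)\<^sup>2)"
    proof (intro mult_mono emeasure_cball_le)
      have "\<bar>x0\<bar> \<le> \<bar>x0\<bar> * t" using t by (simp add: mult_le_cancel_left1)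
      then show "?N z0 \<le> ennreal ((B + \<bar>x0\<bar>) * t)"
        unfolding defect_def z0 by (simp add: algebra_simps) (intro ennreal_leI, linarith)
    qed (use t in auto)
    also have "\<dots> = ennreal (C * t ^ 3)"
      using B t by (subst ennreal_mult[symmetric]) (auto simp: C_def power2_eq_square power3_eq_cube algebra_simps)
    finally have "(\<integral>\<^sup>+ z. indicator (cball 0 (16 * t)) z * ?N z \<partial>lborel) \<le> ennreal (C * t ^ 3)" .
    then show "subharmonic_scale u \<mu> B C t"
      using sh riesz B \<open>C > 0\<close> t above by unfold_locales auto
  qed
qed


section \<open>Mass bounds and smoothing of the positive part\<close>

lemma step_deriv_bounds: "\<exists>K>0. \<forall>s. \<bar>step1 s\<bar> \<le> K \<and> \<bar>s * step2 s\<bar> \<le> K"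
proof -
  note c = has_deriv2_continuous[OF has_deriv2_step]
  obtain C1 where C1: "\<And>s. s \<in> {1..4} \<Longrightarrow> \<bar>step1 s\<bar> \<le> C1" using continuous_bounded_Icc[OF c(2)] by blast
  obtain C2 where C2: "\<And>s. s \<in> {1..4} \<Longrightarrow> \<bar>s * step2 s\<bar> \<le> C2"
    using continuous_bounded_Icc[of "\<lambda>s. s * step2 s", OF continuous_on_mult[OF continuous_on_id c(3)]] by blast
  define K where "K = 1 + \<bar>C1\<bar> + \<bar>C2\<bar>"
  have "\<bar>step1 s\<bar> \<le> K \<and> \<bar>s * step2 s\<bar> \<le> K" for s
  proof -
    consider "s \<le> 1" | "s \<in> {1..4}" | "s \<ge> 4" by force
    then show ?thesis
    proof cases
      case 1 then show ?thesis by (simp add: step_0 K_def)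
    next
      case 2 then show ?thesis using C1[OF 2] C2[OF 2] by (auto simp: K_def)
    next
      case 3 then show ?thesis by (simp add: step_1 K_def)
    qed
  qed
  then show ?thesis by (intro exI[of _ K]) (auto simp: K_def)
qed

lemma integral_bounded_support:
  fixes h :: "'a \<Rightarrow> real"
  assumes [measurable]: "h \<in> borel_measurable M" "S \<in> sets M" and m: "emeasure M S \<le> ennreal m" and m0: "m \<ge> 0"
    and c: "\<And>x. \<bar>h x\<bar> \<le> c" and 0: "\<And>x. x \<in> space M \<Longrightarrow> x \<notin> S \<Longrightarrow> h x = 0"
  shows "integrable M h" "\<bar>\<integral>x. h x \<partial>M\<bar> \<le> c * m"
proof -
  have c0: "c \<ge> 0" using c[of undefined] by linarith
  have "(\<integral>\<^sup>+ x. norm (h x) \<partial>M) \<le> (\<integral>\<^sup>+ x. ennreal c * indicator S x \<partial>M)"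
    using c 0 by (intro nn_integral_mono) (auto simp: indicator_def ennreal_leI)
  also have "\<dots> = ennreal c * emeasure M S" by (simp add: nn_integral_cmult_indicator)
  also have "\<dots> \<le> ennreal c * ennreal m" by (intro mult_left_mono m) simp
  also have "\<dots> = ennreal (c * m)" using c0 m0 by (simp add: ennreal_mult)
  finally have le: "(\<integral>\<^sup>+ x. norm (h x) \<partial>M) \<le> ennreal (c * m)" .
  then show i: "integrable M h"
    by (intro integrableI_bounded) (auto intro: le_less_trans)
  have "ennreal \<bar>\<integral>x. h x \<partial>M\<bar> \<le> ennreal (c * m)"
    using order_trans[OF integral_norm_bound_ennreal[OF i] le] by simp
  then show "\<bar>\<integral>x. h x \<partial>M\<bar> \<le> c * m" using c0 m0 by (subst (asm) ennreal_le_iff) auto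
qed

text \<open>The test function is 1 up to radius \<open>8 * t\<close> and 0 beyond
  \<open>16 * t\<close>; the scale \<open>c\<close> places the thresholds 1 and 4 of
  \<open>step\<close> there. Its Laplacian is O(1/t^2), and the integral of N is O(t^3).\<close>

lemma (in subharmonic_scale) mass_bound:
  assumes K: "K > 0" "\<And>s. \<bar>step1 s\<bar> \<le> K" "\<And>s. \<bar>s * step2 s\<bar> \<le> K"
  shows "emeasure \<mu> (cball 0 (8 * t)) \<le> ennreal (K * C * t)"
proof -
  define c where "c = 1 / (64 * t\<^sup>2)"
  have c: "c > 0" using t by (simp add: c_def)
  let ?p = "\<lambda>s. 1 - 1 * step (c * s)"
  let ?\<phi> = "\<lambda>z. (\<lambda>_. 1) (Re z) * ?p (sqd 0 z)"
  have p2: "has_deriv2 ?p (\<lambda>s. 0 - 1 * c * step1 (c * s)) (\<lambda>s. 0 - 1 * c\<^sup>2 * step2 (c * s))"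
    by (intro has_deriv2_diff has_deriv2_const has_deriv2_scale has_deriv2_step)
  have far: "?p s = 0" if "s \<ge> (16 * t)\<^sup>2" for s
  proof -
    have "c * s \<ge> c * (16 * t)\<^sup>2" using that c by (intro mult_left_mono) auto
    also have "c * (16 * t)\<^sup>2 = 4" using t by (simp add: c_def power2_eq_square)
    finally show ?thesis by (simp add: step_1)
  qed
  have tf: "test_fun ?\<phi>" "\<And>z. laplacian ?\<phi> z = 0 * ?p (sqd 0 z) + 4 * (Re z - Re 0) * 0 * (0 - 1 * c * step1 (c * sqd 0 z))
      + 1 * (4 * (0 - 1 * c * step1 (c * sqd 0 z)) + 4 * sqd 0 z * (0 - 1 * c\<^sup>2 * step2 (c * sqd 0 z)))"
    by (rule test_fun_radial[OF has_deriv2_const p2], erule far)+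
  have farz: "?\<phi> z = 0" if "cmod z > 16 * t" for z
  proof -
    have "sqd 0 z \<ge> (16 * t)\<^sup>2" using that t unfolding sqd_eq by (intro power_mono) auto
    then show ?thesis using far by simp
  qed
  have lap: "laplacian ?\<phi> z = - 4 * c * (step1 (c * sqd 0 z) + (c * sqd 0 z) * step2 (c * sqd 0 z))" for z
    using tf(2)[of z] by (simp add: algebra_simps power2_eq_square)
  have lapb: "\<bar>laplacian ?\<phi> z\<bar> \<le> 4 * c * (2 * K)" for z
  proof -
    have "\<bar>step1 (c * sqd 0 z) + (c * sqd 0 z) * step2 (c * sqd 0 z)\<bar> \<le> 2 * K"
      using K(2)[of "c * sqd 0 z"] K(3)[of "c * sqd 0 z"] by linarith
    then show ?thesis unfolding lap using c by (simp add: abs_mult)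
  qed
  have [measurable]: "laplacian ?\<phi> \<in> borel_measurable borel"
    by (rule borel_measurable_continuous_onI, rule laplacian_test_fun(1)[OF tf(1) farz])
  have lapfar: "laplacian ?\<phi> z = 0" if "cmod z > 16 * t" for z
    by (rule laplacian_test_fun(2)[OF tf(1), where R="16 * t"]) (use farz that in auto)
  have \<phi>c: "continuous_on UNIV ?\<phi>"
    unfolding sqd_def
    by (intro continuous_intros continuous_on_compose2[OF has_deriv2_continuous(1)[OF p2]]) auto
  then have [measurable]: "?\<phi> \<in> borel_measurable borel" by (rule borel_measurable_continuous_onI)
  have \<phi>b: "0 \<le> ?\<phi> z" "?\<phi> z \<le> 1" for z using step_bounds by auto
  obtain m where m: "m \<ge> 0" "emeasure \<mu> (cball 0 (16 * t)) \<le> ennreal m"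
  proof -
    have "emeasure \<mu> (cball 0 (16 * t)) < \<infinity>" using riesz by (auto simp: riesz_measure_def)
    then show thesis using that by (cases "emeasure \<mu> (cball 0 (16 * t))") auto
  qed
  have \<phi>m: "?\<phi> \<in> borel_measurable \<mu>" by measurable
  have i\<phi>: "integrable \<mu> ?\<phi>"
    by (rule integral_bounded_support(1)[where S="cball 0 (16 * t)" and c=1, OF \<phi>m _ m(2,1)])
      (use \<phi>b farz in \<open>auto simp: abs_le_iff sets_\<mu>\<close>)
  have "emeasure \<mu> (cball 0 (8 * t)) = (\<integral>\<^sup>+ z. indicator (cball 0 (8 * t)) z \<partial>\<mu>)"
    by (simp add: sets_\<mu>)
  also have "\<dots> \<le> (\<integral>\<^sup>+ z. ennreal (?\<phi> z) \<partial>\<mu>)"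
  proof (intro nn_integral_mono)
    fix z
    show "indicator (cball 0 (8 * t)) z \<le> ennreal (?\<phi> z)"
    proof (cases "z \<in> cball 0 (8 * t)")
      case True
      then have "sqd 0 z \<le> (8 * t)\<^sup>2" unfolding sqd_eq by (intro power_mono) auto
      then have "c * sqd 0 z \<le> c * (8 * t)\<^sup>2" using c by (intro mult_left_mono) auto
      also have "\<dots> = 1" using t by (simp add: c_def power2_eq_square)
      finally show ?thesis using True by (simp add: step_0)
    qed simp
  qed
  also have "\<dots> = ennreal (\<integral>z. ?\<phi> z \<partial>\<mu>)"
    by (rule nn_integral_eq_integral[OF i\<phi>]) (use \<phi>b in auto)
  also have "(\<integral>z. ?\<phi> z \<partial>\<mu>) \<le> K * C * t"
  proof -
    have "2 * pi * (\<integral>z. ?\<phi> z \<partial>\<mu>) = - (\<integral>z. n z * laplacian ?\<phi> z \<partial>lborel)"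
      using riesz_n[OF tf(1) farz] by simp
    also have "\<dots> \<le> \<bar>\<integral>z. n z * laplacian ?\<phi> z \<partial>lborel\<bar>" by simp
    also have "\<dots> \<le> 4 * c * (2 * K) * (C * t ^ 3)"
      by (rule integral_n(2)[OF _ lapb lapfar]) measurable
    also have "\<dots> = K * C * t / 8" using t by (simp add: c_def power2_eq_square power3_eq_cube)
    finally have "(\<integral>z. ?\<phi> z \<partial>\<mu>) \<le> K * C * t / (16 * pi)" by (simp add: field_simps)
    also have "\<dots> \<le> K * C * t / 1" using pi_gt3 K C t by (intro divide_left_mono) auto
    finally show ?thesis by simp
  qed
  finally show ?thesis by (simp add: ennreal_leI)
qed

locale ring_scale = subharmonic_scale +
  assumes mass: "emeasure \<mu> (cball 0 (16 * t)) \<le> ennreal (C * t)"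

lemma subharmonic_scale_mono:
  assumes "subharmonic_scale u \<mu> B C t" "C \<le> C'"
  shows "subharmonic_scale u \<mu> B C' t"
proof -
  interpret subharmonic_scale u \<mu> B C t by fact
  show ?thesis
  proof
    have "ennreal (C * t ^ 3) \<le> ennreal (C' * t ^ 3)"
      using assms(2) t by (intro ennreal_leI mult_right_mono) auto
    then show "(\<integral>\<^sup>+ z. indicator (cball 0 (16 * t)) z * defect (B * t) u z \<partial>lborel) \<le> ennreal (C' * t ^ 3)"
      using below order_trans by blast
  qed (use sh riesz B C t above assms(2) in auto)
qed

text \<open>Lets M and u share one constant.\<close>

lemma ring_scale_mono:
  assumes "ring_scale u \<mu> B C t" "C \<le> C'"
  shows "ring_scale u \<mu> B C' t"
proof -
  interpret ring_scale u \<mu> B C t by fact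
  have "ennreal (C * t) \<le> ennreal (C' * t)"
    using assms(2) t by (intro ennreal_leI mult_right_mono) auto
  then show ?thesis
    by (intro ring_scale.intro subharmonic_scale_mono[OF subharmonic_scale_axioms assms(2)]
        ring_scale_axioms.intro order_trans[OF mass])
qed

lemma ring_scale_exists:
  assumes sh: "subharmonic_C u" and riesz: "riesz_measure u \<mu>" and ne: "\<exists>z. u z \<noteq> - \<infinity>"
    and B: "B > 0" and above: "\<And>t z. t \<ge> 1 \<Longrightarrow> cmod z \<le> 20 * t \<Longrightarrow> u z \<le> ereal (B * t)"
  obtains C T where "C > 0" "T \<ge> 1" "\<And>t. t \<ge> T \<Longrightarrow> ring_scale u \<mu> B C t"
proof -
  obtain C T where CT: "C > 0" "T \<ge> 1" "\<And>t. t \<ge> T \<Longrightarrow> subharmonic_scale u \<mu> B C t"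
    using subharmonic_scale_exists[OF sh riesz ne B above] by blast
  obtain K where K: "K > 0" "\<And>s. \<bar>step1 s\<bar> \<le> K" "\<And>s. \<bar>s * step2 s\<bar> \<le> K"
    using step_deriv_bounds by blast
  show thesis
  proof
    show "C + 2 * K * C > 0" using CT K by (intro add_pos_pos) auto
    show "T \<ge> 1" by fact
    fix t assume t: "t \<ge> T"
    \<comment> \<open>The mass bound reaches only half the radius of the integral bound, so the disc
      of radius \<open>16 * t\<close> is handled at scale \<open>2 * t\<close>.\<close>
    interpret s2: subharmonic_scale u \<mu> B C "2 * t" by (rule CT) (use t CT in auto)
    have "emeasure \<mu> (cball 0 (16 * t)) \<le> ennreal (K * C * (2 * t))"
      using s2.mass_bound[OF K] by simp
    also have "\<dots> \<le> ennreal ((C + 2 * K * C) * t)"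
      using CT t by (intro ennreal_leI) (simp add: algebra_simps)
    finally show "ring_scale u \<mu> B (C + 2 * K * C) t"
      using subharmonic_scale_mono[OF CT(3)[OF t], of "C + 2 * K * C"] CT K
      by (intro ring_scale.intro ring_scale_axioms.intro) auto
  qed
qed

text \<open>The kernel k averages over the annulus 1 \<le> |w| \<le> 2, kappa is the density of Re w under k, and f is a
  C2 smoothing of the positive part with second derivative kappa.\<close>

locale mollifier =
  fixes k :: "complex \<Rightarrow> real" and \<kappa> f f1 :: "real \<Rightarrow> real"
  assumes k_nonneg: "k w \<ge> 0" and k_cont: "continuous_on UNIV k"
    and k_rotate: "cmod c = 1 \<Longrightarrow> k (c * w) = k w"
    and k_support: "k w \<noteq> 0 \<Longrightarrow> 1 \<le> cmod w \<and> cmod w \<le> 2"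
    and k_mass: "(\<integral>\<^sup>+ w. ennreal (k w) \<partial>lborel) = 1"
    and \<kappa>_nonneg: "\<kappa> x \<ge> 0" and \<kappa>_even: "\<kappa> (- x) = \<kappa> x"
    and \<kappa>_marginal: "h \<in> borel_measurable borel \<Longrightarrow>
       (\<integral>\<^sup>+ w. h (Re w) * ennreal (k w) \<partial>lborel) = (\<integral>\<^sup>+ x. h x * ennreal (\<kappa> x) \<partial>lborel)"
    and f_deriv2: "has_deriv2 f f1 \<kappa>" and f_nonneg: "f x \<ge> 0"
    and f_approx: "\<bar>f x - max 0 x\<bar> \<le> 4" and f1_approx: "\<bar>x * f1 x - max 0 x\<bar> \<le> 2"

text \<open>\<open>k\<close> is the normalised positive part of (|w| - 1)(2 - |w|), \<kappa> its
  marginal, and \<open>f1\<close>, \<open>f\<close> are successive antiderivatives vanishing at -2.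
  Unit mass forces \<open>f1 = 1\<close> beyond 2, so \<open>f x - x\<close> is constant
  there.\<close>

lemma mollifier_exists: "\<exists>k \<kappa> f f1. mollifier k \<kappa> f f1"
proof -
  define k0 where "k0 = (\<lambda>w::complex. max 0 ((cmod w - 1) * (2 - cmod w)))"
  have k0c: "continuous_on UNIV k0" unfolding k0_def by (intro continuous_intros)
  then have [measurable]: "k0 \<in> borel_measurable borel" by (rule borel_measurable_continuous_onI)
  have k0_supp: "1 \<le> cmod w \<and> cmod w \<le> 2" if "k0 w \<noteq> 0" for w
    using that by (auto simp: k0_def max_def zero_le_mult_iff split: if_splits)
  have k0_0: "k0 w = 0" if "cmod w > 2" for w using k0_supp[of w] that by auto
  have k0_nonneg: "k0 w \<ge> 0" for w by (simp add: k0_def)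
  have ik0: "integrable lborel k0" by (rule integrable_compact_support[OF k0c k0_0])
  define Z where "Z = (\<integral>w. k0 w \<partial>lborel)"
  have "Z \<noteq> 0"
  proof
    assume "Z = 0"
    then have "AE w in lborel. k0 w = 0"
      unfolding Z_def using integral_nonneg_eq_0_iff_AE[OF ik0] k0_nonneg by auto
    \<comment> \<open>A box of positive measure on which 7/5 \<le> |w| \<le> 8/5, so the kernel is
      strictly positive on it; this contradicts \<open>Z = 0\<close>.\<close>
    then have "AE w in lborel. w \<notin> cbox (Complex (7/5) 0) (Complex (3/2) (1/10))"
    proof eventually_elim
      case (elim w)
      show ?case
      proof
        assume "w \<in> cbox (Complex (7/5) 0) (Complex (3/2) (1/10))"
        then have b: "7/5 \<le> Re w" "Re w \<le> 3/2" "0 \<le> Im w" "Im w \<le> 1/10"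
          by (auto simp: in_cbox_complex_iff)
        have "cmod w \<ge> 7/5" using abs_Re_le_cmod[of w] b by linarith
        moreover have "cmod w \<le> 8/5" using cmod_le[of w] b by linarith
        ultimately have "(cmod w - 1) * (2 - cmod w) > 0" by (intro mult_pos_pos) auto
        then have "k0 w > 0" unfolding k0_def by linarith
        then show False using elim by simp
      qed
    qed
    then have "emeasure lborel (cbox (Complex (7/5) 0) (Complex (3/2) (1/10))) = 0"
      by (subst (asm) AE_iff_measurable[where N="cbox (Complex (7/5) 0) (Complex (3/2) (1/10))"]) auto
    then show False by (subst (asm) emeasure_lborel_cbox_eq) (auto simp: Basis_complex_def complex_eq_iff)
  qed
  moreover have "Z \<ge> 0" unfolding Z_def using k0_nonneg by (intro integral_nonneg_AE) auto
  ultimately have Z: "Z > 0" by simp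
  define k where "k = (\<lambda>w. k0 w / Z)"
  have kc: "continuous_on UNIV k" unfolding k_def by (intro continuous_intros k0c) (use Z in auto)
  then have [measurable]: "k \<in> borel_measurable borel" by (rule borel_measurable_continuous_onI)
  have k_nonneg: "k w \<ge> 0" for w using k0_nonneg Z by (simp add: k_def)
  have k_supp: "1 \<le> cmod w \<and> cmod w \<le> 2" if "k w \<noteq> 0" for w
    using k0_supp[of w] that by (auto simp: k_def)
  have ik: "integrable lborel k" using ik0 by (simp add: k_def)
  have kmass: "(\<integral>\<^sup>+ w. ennreal (k w) \<partial>lborel) = 1"
    using nn_integral_eq_integral[OF ik] k_nonneg Z by (simp add: k_def Z_def[symmetric])
  have k_far: "k (Complex a b) = 0" if "\<bar>a\<bar> > 2 \<or> \<bar>b\<bar> > 2" for a b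
    using k_supp[of "Complex a b"] that abs_Re_le_cmod[of "Complex a b"] abs_Im_le_cmod[of "Complex a b"]
    by (cases "k (Complex a b) = 0") auto
  \<comment> \<open>The integral is taken over a compact interval, outside which the kernel
    vanishes, so that continuity in the parameter is immediate.\<close>
  define \<kappa> where "\<kappa> = (\<lambda>a. integral (cbox (-2) 2) (\<lambda>b. k (Complex a b)))"
  have kcc: "continuous_on UNIV (\<lambda>b. k (Complex a b))" for a
    by (rule continuous_on_compose2[OF kc]) (auto simp: Complex_eq intro!: continuous_intros)
  have ikb: "integrable lborel (\<lambda>b. k (Complex a b))" for a
    by (rule integrable_compact_support[OF kcc, of 2]) (use k_far in auto)
  have \<kappa>: "(\<integral>\<^sup>+ b. ennreal (k (Complex a b)) \<partial>lborel) = ennreal (\<kappa> a)" for a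
  proof -
    have "(\<integral>\<^sup>+ b. ennreal (k (Complex a b)) \<partial>lborel) = ennreal (\<integral>b. k (Complex a b) \<partial>lborel)"
      by (rule nn_integral_eq_integral[OF ikb]) (use k_nonneg in auto)
    also have "(\<integral>b. k (Complex a b) \<partial>lborel) = integral UNIV (\<lambda>b. k (Complex a b))"
      by (rule integral_lborel[symmetric]) (rule ikb)
    also have "\<dots> = integral UNIV (\<lambda>b. if b \<in> cbox (-2) 2 then k (Complex a b) else 0)"
      using k_far by (intro arg_cong[where f="integral UNIV"]) (auto simp: fun_eq_iff)
    also have "\<dots> = \<kappa> a" unfolding \<kappa>_def by (rule integral_restrict_UNIV)
    finally show ?thesis .
  qed
  have \<kappa>c: "continuous_on UNIV \<kappa>"
    unfolding \<kappa>_def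
    by (rule integral_continuous_on_param)
      (auto simp: case_prod_beta' Complex_eq intro!: continuous_on_compose2[OF kc] continuous_intros)
  then have [measurable]: "\<kappa> \<in> borel_measurable borel" by (rule borel_measurable_continuous_onI)
  have \<kappa>_nonneg: "\<kappa> x \<ge> 0" for x unfolding \<kappa>_def using k_nonneg by (intro integral_nonneg) (auto intro!: integrable_continuous_interval continuous_on_subset[OF kcc])
  have \<kappa>_far: "\<kappa> x = 0" if "\<bar>x\<bar> > 2" for x using k_far that by (simp add: \<kappa>_def)
  have \<kappa>_even: "\<kappa> (- x) = \<kappa> x" for x
  proof -
    have "cmod (Complex (- x) b) = cmod (Complex x b)" for b by (simp add: cmod_def)
    then show ?thesis by (simp add: \<kappa>_def k_def k0_def)
  qed
  have marg: "(\<integral>\<^sup>+ w. h (Re w) * ennreal (k w) \<partial>lborel) = (\<integral>\<^sup>+ x. h x * ennreal (\<kappa> x) \<partial>lborel)"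
    if [measurable]: "h \<in> borel_measurable borel" for h
    by (subst nn_integral_complex) (auto simp: nn_integral_cmult \<kappa>)
  have \<kappa>mass: "(\<integral>\<^sup>+ x. ennreal (\<kappa> x) \<partial>lborel) = 1" using marg[of "\<lambda>_. 1"] kmass by simp
  have anti: "\<exists>F. \<forall>x. (F has_real_derivative g x) (at x)" if "continuous_on UNIV g" for g :: "real \<Rightarrow> real"
  proof -
    have "isCont g x" for x using that by (simp add: continuous_on_eq_continuous_at)
    then show ?thesis
      using einterval_antiderivative[of "-\<infinity>" "\<infinity>" g] by (auto simp: has_real_derivative_iff_has_vector_derivative)
  qed
  obtain F0 where F0: "\<And>x. (F0 has_real_derivative \<kappa> x) (at x)" using anti[OF \<kappa>c] by blast
  define f1 where "f1 = (\<lambda>x. F0 x - F0 (-2))"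
  have f1: "(f1 has_real_derivative \<kappa> x) (at x)" for x
    unfolding f1_def by (auto intro!: derivative_eq_intros F0)
  have f1mono: "f1 x \<le> f1 y" if "x \<le> y" for x y
    by (rule DERIV_nonneg_imp_nondecreasing[OF that]) (use f1 \<kappa>_nonneg in blast)
  have flat: "f1 x = f1 y" if "x \<le> y" "\<forall>z. x < z \<longrightarrow> z < y \<longrightarrow> \<kappa> z = 0" for x y
  proof (cases "x = y")
    case False
    have "(f1 has_real_derivative 0) (at z)" if "x < z" "z < y" for z
      using f1[of z] \<open>\<forall>z. x < z \<longrightarrow> z < y \<longrightarrow> \<kappa> z = 0\<close> that by auto
    moreover have "continuous_on {x..y} f1"
      using f1 by (blast intro: DERIV_isCont continuous_at_imp_continuous_on)
    ultimately show ?thesis using False that(1) DERIV_isconst_end[of x y f1] by simp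
  qed simp
  have f1l: "f1 x = 0" if "x \<le> -2" for x using flat[of x "-2"] that \<kappa>_far by (simp add: f1_def)
  have f1m: "f1 2 = 1"
  proof -
    have "(\<integral>x. \<kappa> x * indicator {-2..2} x \<partial>lborel) = f1 2 - f1 (-2)"
      by (rule integral_FTC_Icc_real) (use f1 \<kappa>c in \<open>auto simp: continuous_on_eq_continuous_at\<close>)
    also have "(\<lambda>x. \<kappa> x * indicator {-2..2} x) = \<kappa>"
    proof
      fix x show "\<kappa> x * indicator {-2..2} x = \<kappa> x"
        using \<kappa>_far[of x] by (cases "\<bar>x\<bar> > 2") (auto simp: indicator_def)
    qed
    finally have e: "(\<integral>x. \<kappa> x \<partial>lborel) = f1 2" by (simp add: f1_def)
    have "integrable lborel \<kappa>" by (rule integrable_compact_support[OF \<kappa>c, of 2]) (use \<kappa>_far in auto)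
    then have "ennreal (f1 2) = 1"
      using nn_integral_eq_integral[of lborel \<kappa>] \<kappa>mass \<kappa>_nonneg e by simp
    then show ?thesis using f1mono[of "-2" 2] f1l[of "-2"] by simp
  qed
  have f1r: "f1 x = 1" if "x \<ge> 2" for x using flat[of 2 x] that \<kappa>_far f1m by simp
  have f1b: "0 \<le> f1 x" "f1 x \<le> 1" for x
    using f1mono[of "min x (-2)" x] f1l[of "min x (-2)"] f1mono[of x "max x 2"] f1r[of "max x 2"] by auto
  have f1c: "continuous_on UNIV f1" using f1 DERIV_isCont by (blast intro: continuous_at_imp_continuous_on)
  obtain G0 where G0: "\<And>x. (G0 has_real_derivative f1 x) (at x)" using anti[OF f1c] by blast
  define f where "f = (\<lambda>x. G0 x - G0 (-2))"
  have f: "(f has_real_derivative f1 x) (at x)" for x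
    unfolding f_def by (auto intro!: derivative_eq_intros G0)
  have fm: "f x \<le> f y" if "x \<le> y" for x y
    by (rule DERIV_nonneg_imp_nondecreasing[OF that]) (use f f1b in blast)
  \<comment> \<open>Since \<open>f1\<close> lies between 0 and 1, both \<open>f x\<close> and
    \<open>x - f x\<close> are nondecreasing; this pins \<open>f\<close> near the positive part on
    the middle interval.\<close>
  have fm': "f y - y \<le> f x - x" if "x \<le> y" for x y
  proof (rule DERIV_nonpos_imp_nonincreasing[OF that])
    fix z
    have "((\<lambda>x. f x - x) has_real_derivative f1 z - 1) (at z)" by (auto intro!: derivative_eq_intros f)
    then show "\<exists>d. ((\<lambda>x. f x - x) has_real_derivative d) (at z) \<and> d \<le> 0" using f1b[of z] by force
  qed
  have f0: "f (-2) = 0" by (simp add: f_def)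
  have fl: "f x = 0" if "x \<le> -2" for x
  proof (cases "x = -2")
    case False
    have "f (-2) = f x"
    proof (rule DERIV_isconst_end[of x "-2" f])
      show "(f has_real_derivative 0) (at z)" if "z < -2" for z using f[of z] f1l[of z] that by simp
      show "continuous_on {x..-2} f" using f by (blast intro: DERIV_isCont continuous_at_imp_continuous_on)
    qed (use that False in auto)
    then show ?thesis using f0 by simp
  qed (simp add: f0)
  have fr: "f x - x = f 2 - 2" if "x \<ge> 2" for x
  proof (cases "x = 2")
    case False
    have d: "((\<lambda>x. f x - x) has_real_derivative f1 z - 1) (at z)" for z by (auto intro!: derivative_eq_intros f)
    show ?thesis
    proof (rule DERIV_isconst_end[of 2 x "\<lambda>x. f x - x"])
      show "((\<lambda>x. f x - x) has_real_derivative 0) (at z)" if "2 < z" for z using d[of z] f1r[of z] that by simp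
      show "continuous_on {2..x} (\<lambda>x. f x - x)" using d by (blast intro: DERIV_isCont continuous_at_imp_continuous_on)
    qed (use that False in auto)
  qed simp
  have "\<bar>f x - max 0 x\<bar> \<le> 4" for x
  proof -
    consider "x \<le> -2" | "-2 \<le> x" "x \<le> 2" | "x \<ge> 2" by linarith
    then show ?thesis
    proof cases
      case 1 then show ?thesis using fl[OF 1] by simp
    next
      case 2 then show ?thesis using fm[of "-2" x] fm'[of "-2" x] f0 by auto
    next
      case 3 then show ?thesis using fr[OF 3] fm[of "-2" 2] fm'[of "-2" 2] f0 by auto
    qed
  qed
  moreover have "\<bar>x * f1 x - max 0 x\<bar> \<le> 2" for x
  proof -
    consider "x \<le> -2" | "-2 \<le> x" "x \<le> 0" | "0 \<le> x" "x \<le> 2" | "x \<ge> 2" by linarith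
    then show ?thesis
    proof cases
      case 1 then show ?thesis using f1l[OF 1] by simp
    next
      case 2
      then have "\<bar>x * f1 x\<bar> \<le> 2 * 1" unfolding abs_mult using f1b[of x] by (intro mult_mono) auto
      then show ?thesis using 2 by simp
    next
      case 3
      then have "0 \<le> x * f1 x" "x * f1 x \<le> x * 1" using f1b[of x] by (auto intro!: mult_left_mono simp del: mult_1_right)
      then show ?thesis using 3 by simp
    next
      case 4 then show ?thesis using f1r[OF 4] by simp
    qed
  qed
  moreover have "f x \<ge> 0" for x using fm[of "min x (-2)" x] fl[of "min x (-2)"] by auto
  moreover have "has_deriv2 f f1 \<kappa>" using f f1 \<kappa>c by (simp add: has_deriv2_def)
  moreover have "k (c * w) = k w" if "cmod c = 1" for c w using that by (simp add: k_def k0_def norm_mult)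
  ultimately have "mollifier k \<kappa> f f1"
    using k_nonneg kc k_supp kmass \<kappa>_nonneg \<kappa>_even marg by unfold_locales auto
  then show ?thesis by blast
qed


section \<open>The ring identity and the imaginary axis\<close>

definition ring_bound :: "real \<Rightarrow> bool" where
  "ring_bound C \<longleftrightarrow> C > 0 \<and> (\<forall>a b s. 0 < a \<longrightarrow> a \<le> b \<longrightarrow> \<bar>ring_wt a b s\<bar> \<le> C / a\<^sup>2 \<and> \<bar>ring_wt1 a b s\<bar> \<le> C / a ^ 4
   \<and> \<bar>s * ring_wt2 a b s\<bar> \<le> C / a ^ 4) \<and> (\<forall>s. \<bar>inv_cut_lap s\<bar> \<le> C)"

text \<open>One absolute constant, independent of all radii, is fixed once so that later estimates
  are uniform in the scale.\<close>

definition ring_const :: real where "ring_const = (SOME C. ring_bound C)"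

lemma ring_const:
  shows ring_const_pos: "ring_const > 0"
    and ring_const_wt: "\<And>a b s. 0 < a \<Longrightarrow> a \<le> b \<Longrightarrow> \<bar>ring_wt a b s\<bar> \<le> ring_const / a\<^sup>2"
    and ring_const_wt1: "\<And>a b s. 0 < a \<Longrightarrow> a \<le> b \<Longrightarrow> \<bar>ring_wt1 a b s\<bar> \<le> ring_const / a ^ 4"
    and ring_const_wt2: "\<And>a b s. 0 < a \<Longrightarrow> a \<le> b \<Longrightarrow> \<bar>s * ring_wt2 a b s\<bar> \<le> ring_const / a ^ 4"
    and ring_const_lap: "\<And>s. \<bar>inv_cut_lap s\<bar> \<le> ring_const"
proof -
  obtain C where C: "C > 0" "\<And>a b s. 0 < a \<Longrightarrow> a \<le> b \<Longrightarrow> \<bar>ring_wt a b s\<bar> \<le> C / a\<^sup>2 \<and> \<bar>ring_wt1 a b s\<bar> \<le> C / a ^ 4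
   \<and> \<bar>s * ring_wt2 a b s\<bar> \<le> C / a ^ 4" using ring_wt_bounds by blast
  obtain D where D: "D > 0" "\<And>s. \<bar>inv_cut1 s\<bar> \<le> D" "\<And>s. \<bar>s * inv_cut2 s\<bar> \<le> D" using inv_cut_bounds by blast
  have lap: "\<bar>inv_cut_lap s\<bar> \<le> C + 12 * D" for s
    using D(2)[of s] D(3)[of s] C(1) unfolding inv_cut_lap_def mult.assoc by linarith
  have le: "C / a ^ n \<le> (C + 12 * D) / a ^ n" if "0 < a" for a :: real and n
    using that D(1) by (intro divide_right_mono) auto
  have "ring_bound (C + 12 * D)"
    unfolding ring_bound_def
  proof (intro conjI allI impI)
    fix a b s :: real assume ab: "0 < a" "a \<le> b"
    show "\<bar>ring_wt a b s\<bar> \<le> (C + 12 * D) / a\<^sup>2" using C(2)[OF ab, of s] le[OF ab(1), of 2] by linarith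
    show "\<bar>ring_wt1 a b s\<bar> \<le> (C + 12 * D) / a ^ 4" using C(2)[OF ab, of s] le[OF ab(1), of 4] by linarith
    show "\<bar>s * ring_wt2 a b s\<bar> \<le> (C + 12 * D) / a ^ 4" using C(2)[OF ab, of s] le[OF ab(1), of 4] by linarith
  qed (use C(1) D(1) lap in auto)
  then have "ring_bound ring_const" unfolding ring_const_def by (rule someI)
  then show "ring_const > 0"
    "\<And>a b s. 0 < a \<Longrightarrow> a \<le> b \<Longrightarrow> \<bar>ring_wt a b s\<bar> \<le> ring_const / a\<^sup>2"
    "\<And>a b s. 0 < a \<Longrightarrow> a \<le> b \<Longrightarrow> \<bar>ring_wt1 a b s\<bar> \<le> ring_const / a ^ 4"
    "\<And>a b s. 0 < a \<Longrightarrow> a \<le> b \<Longrightarrow> \<bar>s * ring_wt2 a b s\<bar> \<le> ring_const / a ^ 4"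
    "\<And>s. \<bar>inv_cut_lap s\<bar> \<le> ring_const" unfolding ring_bound_def by blast+
qed

lemma compact_support_bounded:
  fixes h :: "complex \<Rightarrow> real"
  assumes "continuous_on UNIV h" "\<And>z. cmod z > R \<Longrightarrow> h z = 0"
  obtains c where "\<And>z. \<bar>h z\<bar> \<le> c"
proof -
  have "bounded (h ` cball 0 R)"
    by (intro compact_imp_bounded compact_continuous_image continuous_on_subset[OF assms(1)]) auto
  then obtain c where c: "\<forall>x\<in>h ` cball 0 R. norm x \<le> c" unfolding bounded_iff by blast
  have "\<bar>h z\<bar> \<le> max c 0" for z
    using c assms(2)[of z] by (cases "cmod z > R") (auto simp: le_max_iff_disj)
  then show thesis by (rule that)
qed

text \<open>A value below the product forces a positive weight at \<open>x\<close>, so points where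
  N is infinite and the weight is 0 cause no trouble. Elsewhere N is replaced by a constant
  \<open>c\<close> below it, and \<open>c\<close> times the weight is continuous.\<close>

lemma liminf_mult_ennreal:
  assumes N: "lsc N" and X: "X \<longlonglongrightarrow> x" and R: "continuous_on UNIV R" "\<And>z. (R z::real) \<ge> 0"
  shows "N x * ennreal (R x) \<le> liminf (\<lambda>n. N (X n) * ennreal (R (X n)))"
  unfolding le_Liminf_iff
proof (intro allI impI)
  fix a assume a: "a < N x * ennreal (R x)"
  then have Rx: "0 < R x" using R(2)[of x] by (cases "R x = 0") auto
  obtain a' where a': "a < a'" "a' < N x * ennreal (R x)" using dense[OF a] by blast
  define c where "c = a' / ennreal (R x)"
  have cx: "c < N x" unfolding c_def using Rx a'(2) by (subst divide_less_ennreal) auto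
  have cR: "c * ennreal (R x) = a'" unfolding c_def using Rx by (simp add: ennreal_divide_times)
  have cfin: "c < top" using cx by (meson less_le_trans top_greatest)
  have "(\<lambda>n. R (X n)) \<longlonglongrightarrow> R x"
    using R(1) X by (metis continuous_on_eq_continuous_at continuous_within_tendsto_compose' open_UNIV UNIV_I isCont_tendsto_compose)
  then have "(\<lambda>n. c * ennreal (R (X n))) \<longlonglongrightarrow> c * ennreal (R x)"
    by (intro ennreal_tendsto_cmult cfin tendsto_ennrealI)
  then have "\<forall>\<^sub>F n in sequentially. a < c * ennreal (R (X n))"
    using a'(1) cR by (intro order_tendstoD(1)) auto
  moreover have "\<forall>\<^sub>F n in sequentially. c < N (X n)"
    using lsc_liminf[OF N X] cx unfolding le_Liminf_iff by blast
  ultimately show "\<forall>\<^sub>F n in sequentially. a < N (X n) * ennreal (R (X n))"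
    by eventually_elim (meson less_le_trans less_imp_le mult_right_mono zero_le)
qed

context ring_scale
begin

lemma integrable_n_cont:
  assumes "continuous_on UNIV h" "\<And>z. cmod z > 16 * t \<Longrightarrow> h z = 0"
  shows "integrable lborel (\<lambda>z. n z * h z)"
proof -
  obtain c where "\<And>z. \<bar>h z\<bar> \<le> c" using compact_support_bounded[OF assms] by blast
  then show ?thesis
    using assms by (intro integral_n(1)[where c=c] borel_measurable_continuous_onI) auto
qed

lemma mass_integral:
  fixes h :: "complex \<Rightarrow> real"
  assumes c: "continuous_on UNIV h" and 0: "\<And>z. cmod z > 16 * t \<Longrightarrow> h z = 0"
  shows "integrable \<mu> h" and "(\<And>z. \<bar>h z\<bar> \<le> c) \<Longrightarrow> \<bar>\<integral>z. h z \<partial>\<mu>\<bar> \<le> c * (C * t)"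
proof -
  have [measurable]: "h \<in> borel_measurable borel" using c by (rule borel_measurable_continuous_onI)
  have m: "h \<in> borel_measurable \<mu>" by measurable
  obtain c' where "\<And>z. \<bar>h z\<bar> \<le> c'" using compact_support_bounded[OF assms] by blast
  then show "integrable \<mu> h"
    using integral_bounded_support(1)[OF m _ mass] 0 C t by (force simp: sets_\<mu>)
  show "\<bar>\<integral>z. h z \<partial>\<mu>\<bar> \<le> c * (C * t)" if "\<And>z. \<bar>h z\<bar> \<le> c"
    using integral_bounded_support(2)[OF m _ mass _ that] 0 C t by (force simp: sets_\<mu>)
qed

end

text \<open>The sign \<open>s\<close> selects the half-plane: 1 for the right one, -1 for the left
  one.\<close>

locale ring_side = ring_scale u \<mu> B C t + mollifier k \<kappa> f f1
  for u :: "complex \<Rightarrow> ereal" and \<mu> :: "complex measure" and B C t :: real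
    and k :: "complex \<Rightarrow> real" and \<kappa> f f1 :: "real \<Rightarrow> real" +
  fixes s :: real
  assumes s: "s = 1 \<or> s = -1"
begin

definition "fs \<rho> x = \<rho> * f (s / \<rho> * x)"
definition "fs1 \<rho> x = \<rho> * (s / \<rho>) * f1 (s / \<rho> * x)"
definition "fs2 \<rho> x = \<rho> * (s / \<rho>)\<^sup>2 * \<kappa> (s / \<rho> * x)"

lemma fs_deriv2: "has_deriv2 (fs \<rho>) (fs1 \<rho>) (fs2 \<rho>)"
  unfolding fs_def[abs_def] fs1_def[abs_def] fs2_def[abs_def] by (rule has_deriv2_scale[OF f_deriv2])

text \<open>Evenness of \<kappa> removes the sign \<open>s\<close>: the axis average is the same for
  both half-planes, which is what allows them to be mixed later.\<close>

lemma fs2_eq: "\<rho> > 0 \<Longrightarrow> fs2 \<rho> x = \<kappa> (x / \<rho>) / \<rho>"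
  using s \<kappa>_even[of "x / \<rho>"] by (auto simp: fs2_def power2_eq_square)

lemma fs2_nonneg: "\<rho> > 0 \<Longrightarrow> fs2 \<rho> x \<ge> 0"
  by (simp add: fs2_eq \<kappa>_nonneg)

lemma fs_approx:
  assumes \<rho>: "\<rho> > 0"
  shows "\<bar>fs \<rho> x - max 0 (s * x)\<bar> \<le> 4 * \<rho>" "\<bar>x * fs1 \<rho> x - max 0 (s * x)\<bar> \<le> 2 * \<rho>"
proof -
  define y where "y = s / \<rho> * x"
  have ry: "\<rho> * y = s * x" using \<rho> by (simp add: y_def)
  have mx: "max 0 (s * x) = \<rho> * max 0 y"
    unfolding ry[symmetric] using \<rho> by (simp add: max_mult_distrib_left)
  have "fs \<rho> x - max 0 (s * x) = \<rho> * (f y - max 0 y)"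
    unfolding mx fs_def y_def by (simp add: algebra_simps)
  then show "\<bar>fs \<rho> x - max 0 (s * x)\<bar> \<le> 4 * \<rho>" using f_approx[of y] \<rho> by (simp add: abs_mult)
  have "x * fs1 \<rho> x = \<rho> * (y * f1 y)"
    unfolding fs1_def y_def[symmetric] using ry \<rho> by (simp add: algebra_simps)
  then have "x * fs1 \<rho> x - max 0 (s * x) = \<rho> * (y * f1 y - max 0 y)"
    unfolding mx by (simp add: algebra_simps)
  then show "\<bar>x * fs1 \<rho> x - max 0 (s * x)\<bar> \<le> 2 * \<rho>" using f1_approx[of y] \<rho> by (simp add: abs_mult)
qed

text \<open>The flux terms come from the cutoff at a circle of radius a; over consecutive dyadic rings they telescope.\<close>

definition flux_ker :: "real \<Rightarrow> complex \<Rightarrow> real" where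
  "flux_ker a z = max 0 (s * Re z) * (inv_cut_lap (sqd 0 z / a\<^sup>2) / a ^ 4)"
definition "flux a = (\<integral>z. n z * flux_ker a z \<partial>lborel)"
definition "half_mass a b = (\<integral>z. max 0 (s * Re z) * ring_wt a b (sqd 0 z) \<partial>\<mu>)"

lemma continuous_Re_sqd:
  "continuous_on UNIV h \<Longrightarrow> continuous_on UNIV (\<lambda>z. (h (Re z) :: real))"
  "continuous_on UNIV h \<Longrightarrow> continuous_on UNIV (\<lambda>z. (h (sqd z0 z) :: real))"
  by (rule continuous_on_compose2, assumption; auto simp: sqd_def intro!: continuous_intros)+

lemma inv_cut_lap_cont: "continuous_on UNIV inv_cut_lap"
  unfolding inv_cut_lap_def[abs_def] by (intro continuous_intros has_deriv2_continuous[OF has_deriv2_inv_cut])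

lemma flux_ker_cont: "continuous_on UNIV (flux_ker a)"
proof (cases "a = 0")
  case False
  have "continuous_on UNIV (\<lambda>y. inv_cut_lap (y / a\<^sup>2))"
    by (rule continuous_on_compose2[OF inv_cut_lap_cont]) (use False in \<open>auto intro!: continuous_intros\<close>)
  then show ?thesis unfolding flux_ker_def[abs_def]
    using False by (intro continuous_intros continuous_Re_sqd(2)) auto
qed (simp add: flux_ker_def[abs_def])

lemma flux_ker_far: "cmod z > 2 * a \<Longrightarrow> a > 0 \<Longrightarrow> flux_ker a z = 0"
proof -
  assume a: "cmod z > 2 * a" "a > 0"
  then have "(2 * a)\<^sup>2 \<le> (cmod z)\<^sup>2" by (intro power_mono) auto
  then have "sqd 0 z / a\<^sup>2 \<ge> 4" using a by (simp add: sqd_eq field_simps)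
  then show ?thesis by (simp add: flux_ker_def inv_cut_lap_0)
qed

lemma flux_ker_bound: "a > 0 \<Longrightarrow> \<bar>flux_ker a z\<bar> \<le> 2 * ring_const / a ^ 3"
proof -
  assume a: "a > 0"
  show ?thesis
  proof (cases "cmod z > 2 * a")
    case False
    have "\<bar>max 0 (s * Re z)\<bar> \<le> 2 * a" using False abs_Re_le_cmod[of z] s by auto
    moreover have "\<bar>inv_cut_lap (sqd 0 z / a\<^sup>2) / a ^ 4\<bar> \<le> ring_const / a ^ 4"
      using ring_const_lap a by (simp add: divide_right_mono)
    ultimately have "\<bar>flux_ker a z\<bar> \<le> 2 * a * (ring_const / a ^ 4)"
      unfolding flux_ker_def abs_mult using a by (intro mult_mono) auto
    also have "\<dots> = 2 * ring_const / a ^ 3" using a by (simp add: field_simps eval_nat_numeral)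
    finally show ?thesis .
  qed (use flux_ker_far a ring_const_pos in auto)
qed

text \<open>The kernel has size 1/a^3 and the integral of N size t^3, so fluxes are bounded
  uniformly in the scale and a telescoped sum of them costs only a constant.\<close>

lemma flux_bound:
  assumes "t / 4 \<le> a" "a \<le> 8 * t"
  shows "\<bar>flux a\<bar> \<le> 128 * ring_const * C"
proof -
  have a: "a > 0" using assms t by linarith
  have "\<bar>flux a\<bar> \<le> 2 * ring_const / a ^ 3 * (C * t ^ 3)"
    unfolding flux_def
    by (rule integral_n(2)[OF borel_measurable_continuous_onI[OF flux_ker_cont] flux_ker_bound[OF a]])
      (use flux_ker_far assms a in auto)
  also have "\<dots> \<le> 2 * ring_const / (t / 4) ^ 3 * (C * t ^ 3)"
    using assms t C ring_const_pos a by (intro mult_right_mono divide_left_mono power_mono) auto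
  also have "\<dots> = 128 * ring_const * C" using t by (simp add: field_simps eval_nat_numeral)
  finally show ?thesis .
qed

text \<open>The Riesz formula for \<open>fs \<rho> (Re z)\<close> times the ring weight. The second
  derivative of \<open>fs\<close> gives the left-hand term. In the other terms of the Laplacian, and
  in the integral against \<mu>, the smoothed positive part is replaced by the exact one with an
  error O(\<rho>).\<close>

lemma ring_identity:
  assumes \<rho>: "\<rho> > 0" and ab: "t / 4 \<le> a" "a \<le> b" "2 * b \<le> 16 * t"
  shows "\<bar>(\<integral>z. n z * (fs2 \<rho> (Re z) * ring_wt a b (sqd 0 z)) \<partial>lborel)
      - (- 2 * pi * half_mass a b - (flux a - flux b))\<bar> \<le> 11000 * ring_const * C * \<rho> / t"
proof -
  have a0: "a > 0" using ab t by linarith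
  let ?R = "\<lambda>z. ring_wt a b (sqd 0 z)" and ?R1 = "\<lambda>z. ring_wt1 a b (sqd 0 z)" and ?R2 = "\<lambda>z. ring_wt2 a b (sqd 0 z)"
  define \<phi> where "\<phi> = (\<lambda>z. fs \<rho> (Re z) * ?R z)"
  have far4: "ring_wt a b y = 0" if "y \<ge> 4 * b\<^sup>2" for y using ring_wt_outer(1)[OF a0 ab(2) that] .
  have tf: "test_fun \<phi>" "\<And>z. laplacian \<phi> z = fs2 \<rho> (Re z) * ?R z + 4 * (Re z - Re 0) * fs1 \<rho> (Re z) * ?R1 z
       + fs \<rho> (Re z) * (4 * ?R1 z + 4 * sqd 0 z * ?R2 z)"
    unfolding \<phi>_def by (rule test_fun_radial[OF fs_deriv2 has_deriv2_ring_wt], erule far4)+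
  have sq: "sqd 0 z \<ge> 4 * b\<^sup>2" if "cmod z > 16 * t" for z
  proof -
    have "(2 * b)\<^sup>2 \<le> (cmod z)\<^sup>2" using that ab a0 by (intro power_mono) auto
    then show ?thesis by (simp add: sqd_eq power2_eq_square)
  qed
  have far: "?R z = 0" "?R1 z = 0" "?R2 z = 0" if "cmod z > 16 * t" for z
    using ring_wt_outer[OF a0 ab(2) sq[OF that]] by auto
  note cR = has_deriv2_continuous[OF has_deriv2_ring_wt, THEN continuous_Re_sqd(2)]
  note cf = has_deriv2_continuous[OF fs_deriv2, THEN continuous_Re_sqd(1)]
  have csq: "continuous_on UNIV (sqd 0)" unfolding sqd_def by (intro continuous_intros)
  define H where "H = (\<lambda>z. flux_ker a z - flux_ker b z)"
  have H: "H z = max 0 (s * Re z) * (8 * ?R1 z + 4 * sqd 0 z * ?R2 z)" for z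
    unfolding H_def flux_ker_def ring_wt_lap[OF a0 ab(2)] by (simp add: algebra_simps)
  define E where "E = (\<lambda>z. 4 * Re z * fs1 \<rho> (Re z) * ?R1 z + fs \<rho> (Re z) * (4 * ?R1 z + 4 * sqd 0 z * ?R2 z) - H z)"
  have cH: "continuous_on UNIV H" unfolding H_def by (intro continuous_intros flux_ker_cont)
  have cE: "continuous_on UNIV E" unfolding E_def by (intro continuous_intros cR cf csq cH)
  have cF: "continuous_on UNIV (\<lambda>z. fs2 \<rho> (Re z) * ?R z)" by (intro continuous_intros cR cf)
  have farH: "H z = 0" if "cmod z > 16 * t" for z using far[OF that] by (simp add: H)
  have farE: "E z = 0" if "cmod z > 16 * t" for z using far[OF that] farH[OF that] by (simp add: E_def)
  have split: "laplacian \<phi> z = fs2 \<rho> (Re z) * ?R z + H z + E z" for z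
    unfolding tf(2) E_def by simp
  have bE: "\<bar>E z\<bar> \<le> 40 * \<rho> * ring_const / a ^ 4" for z
  proof -
    define m where "m = max 0 (s * Re z)"
    \<comment> \<open>The regrouping lets \<open>fs1\<close> occur only in the product
      \<open>Re z * fs1 \<rho> (Re z)\<close>, which is uniformly within \<open>2 * \<rho>\<close>
      of the positive part; \<open>fs1\<close> alone is not uniformly close to a step
      function.\<close>
    have "E z = 4 * (Re z * fs1 \<rho> (Re z) - m) * ?R1 z + (fs \<rho> (Re z) - m) * (4 * ?R1 z + 4 * (sqd 0 z * ?R2 z))"
      by (simp add: E_def H m_def algebra_simps)
    also have "\<bar>\<dots>\<bar> \<le> 4 * (2 * \<rho>) * (ring_const / a ^ 4) + (4 * \<rho>) * (8 * (ring_const / a ^ 4))"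
    proof (rule order_trans[OF abs_triangle_ineq add_mono])
      show "\<bar>4 * (Re z * fs1 \<rho> (Re z) - m) * ?R1 z\<bar> \<le> 4 * (2 * \<rho>) * (ring_const / a ^ 4)"
        unfolding abs_mult m_def using fs_approx(2)[OF \<rho>, of "Re z"] ring_const_wt1[OF a0 ab(2)] \<rho>
        by (intro mult_mono) auto
      have "\<bar>4 * ?R1 z + 4 * (sqd 0 z * ?R2 z)\<bar> \<le> 8 * (ring_const / a ^ 4)"
        using ring_const_wt1[OF a0 ab(2), of "sqd 0 z"] ring_const_wt2[OF a0 ab(2), of "sqd 0 z"] by linarith
      then show "\<bar>(fs \<rho> (Re z) - m) * (4 * ?R1 z + 4 * (sqd 0 z * ?R2 z))\<bar> \<le> (4 * \<rho>) * (8 * (ring_const / a ^ 4))"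
        unfolding m_def using fs_approx(1)[OF \<rho>, of "Re z"] \<rho>
        by (subst abs_mult, intro mult_mono) auto
    qed
    finally show ?thesis by (simp add: mult_ac)
  qed
  have iE: "\<bar>\<integral>z. n z * E z \<partial>lborel\<bar> \<le> 40 * \<rho> * ring_const / a ^ 4 * (C * t ^ 3)"
    by (rule integral_n(2)[OF borel_measurable_continuous_onI[OF cE] bE farE])
  have "- 2 * pi * (\<integral>z. \<phi> z \<partial>\<mu>) = (\<integral>z. n z * laplacian \<phi> z \<partial>lborel)"
    by (rule riesz_n[OF tf(1), symmetric]) (simp add: \<phi>_def far)
  also have "\<dots> = (\<integral>z. n z * (fs2 \<rho> (Re z) * ?R z) + n z * H z + n z * E z \<partial>lborel)"
    unfolding split by (simp add: algebra_simps)
  also have "\<dots> = (\<integral>z. n z * (fs2 \<rho> (Re z) * ?R z) \<partial>lborel) + (\<integral>z. n z * H z \<partial>lborel) + (\<integral>z. n z * E z \<partial>lborel)"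
    using integrable_n_cont[OF cF] integrable_n_cont[OF cH] integrable_n_cont[OF cE] far farH farE
    by (subst Bochner_Integration.integral_add, simp_all)
  also have "(\<integral>z. n z * H z \<partial>lborel) = flux a - flux b"
    unfolding H_def flux_def right_diff_distrib
    by (rule Bochner_Integration.integral_diff; rule integrable_n_cont[OF flux_ker_cont])
      (use flux_ker_far ab a0 in auto)
  finally have main: "- 2 * pi * (\<integral>z. \<phi> z \<partial>\<mu>) = (\<integral>z. n z * (fs2 \<rho> (Re z) * ?R z) \<partial>lborel)
     + (flux a - flux b) + (\<integral>z. n z * E z \<partial>lborel)" .
  have c\<phi>: "continuous_on UNIV \<phi>" unfolding \<phi>_def by (intro continuous_intros cR cf)
  define \<phi>0 where "\<phi>0 = (\<lambda>z. max 0 (s * Re z) * ?R z)"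
  have c\<phi>0: "continuous_on UNIV \<phi>0" unfolding \<phi>0_def by (intro continuous_intros cR)
  have "\<bar>\<integral>z. \<phi> z - \<phi>0 z \<partial>\<mu>\<bar> \<le> 4 * \<rho> * (ring_const / a\<^sup>2) * (C * t)"
  proof (rule mass_integral(2))
    show "continuous_on UNIV (\<lambda>z. \<phi> z - \<phi>0 z)" by (intro continuous_intros c\<phi> c\<phi>0)
    fix z
    have "\<phi> z - \<phi>0 z = (fs \<rho> (Re z) - max 0 (s * Re z)) * ?R z" by (simp add: \<phi>_def \<phi>0_def algebra_simps)
    also have "\<bar>\<dots>\<bar> \<le> 4 * \<rho> * (ring_const / a\<^sup>2)"
      unfolding abs_mult using fs_approx(1)[OF \<rho>, of "Re z"] ring_const_wt[OF a0 ab(2)] \<rho> by (intro mult_mono) auto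
    finally show "\<bar>\<phi> z - \<phi>0 z\<bar> \<le> 4 * \<rho> * (ring_const / a\<^sup>2)" .
  qed (simp add: \<phi>_def \<phi>0_def far)
  also have "(\<integral>z. \<phi> z - \<phi>0 z \<partial>\<mu>) = (\<integral>z. \<phi> z \<partial>\<mu>) - half_mass a b"
    unfolding half_mass_def \<phi>0_def[symmetric]
    by (rule Bochner_Integration.integral_diff; rule mass_integral(1)[OF c\<phi>] mass_integral(1)[OF c\<phi>0])
      (simp_all add: \<phi>_def \<phi>0_def far)
  finally have m: "\<bar>(\<integral>z. \<phi> z \<partial>\<mu>) - half_mass a b\<bar> \<le> 4 * \<rho> * (ring_const / a\<^sup>2) * (C * t)" .
  have "\<bar>(\<integral>z. n z * (fs2 \<rho> (Re z) * ?R z) \<partial>lborel) - (- 2 * pi * half_mass a b - (flux a - flux b))\<bar>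
     = \<bar>2 * pi * ((\<integral>z. \<phi> z \<partial>\<mu>) - half_mass a b) + (\<integral>z. n z * E z \<partial>lborel)\<bar>"
    using main by (simp add: algebra_simps)
  also have "\<dots> \<le> 2 * pi * \<bar>(\<integral>z. \<phi> z \<partial>\<mu>) - half_mass a b\<bar> + \<bar>\<integral>z. n z * E z \<partial>lborel\<bar>"
    by (rule order_trans[OF abs_triangle_ineq]) (simp add: abs_mult)
  also have "\<dots> \<le> 8 * (4 * \<rho> * (ring_const / a\<^sup>2) * (C * t)) + 40 * \<rho> * ring_const / a ^ 4 * (C * t ^ 3)"
    using pi_less_4 m iE by (intro add_mono mult_mono) auto
  also have "\<dots> \<le> 8 * (4 * \<rho> * (ring_const / (t / 4)\<^sup>2) * (C * t)) + 40 * \<rho> * ring_const / (t / 4) ^ 4 * (C * t ^ 3)"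
    using ab t C ring_const_pos a0 \<rho> by (intro add_mono mult_left_mono mult_right_mono divide_left_mono power_mono) auto
  \<comment> \<open>With \<open>a \<ge> t / 4\<close> the two errors contribute 32 * 16 = 512 and 40
    * 256 = 10240.\<close>
  also have "\<dots> = 10752 * ring_const * C * \<rho> / t"
    using t by (simp add: field_simps eval_nat_numeral)
  also have "\<dots> \<le> 11000 * ring_const * C * \<rho> / t"
    using t C ring_const_pos \<rho> by (intro divide_right_mono mult_right_mono) auto
  finally show ?thesis .
qed

lemma nn_integral_ring:
  assumes \<rho>: "\<rho> > 0" and ab: "t / 4 \<le> a" "a \<le> b" "2 * b \<le> 16 * t"
  shows "(\<integral>\<^sup>+ z. (N z * ennreal (ring_wt a b (sqd 0 z))) * ennreal (fs2 \<rho> (Re z)) \<partial>lborel)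
    = ennreal (\<integral>z. n z * (fs2 \<rho> (Re z) * ring_wt a b (sqd 0 z)) \<partial>lborel)"
proof -
  have a0: "a > 0" using ab t by linarith
  have far: "ring_wt a b (sqd 0 z) = 0" if "cmod z > 16 * t" for z
  proof -
    have "(2 * b)\<^sup>2 \<le> (cmod z)\<^sup>2" using that ab a0 by (intro power_mono) auto
    then show ?thesis using ring_wt_outer(1)[OF a0 ab(2), of "sqd 0 z"] by (simp add: sqd_eq power2_eq_square)
  qed
  have c: "continuous_on UNIV (\<lambda>z. fs2 \<rho> (Re z) * ring_wt a b (sqd 0 z))"
    by (intro continuous_intros has_deriv2_continuous[OF has_deriv2_ring_wt, THEN continuous_Re_sqd(2)]
         has_deriv2_continuous[OF fs_deriv2, THEN continuous_Re_sqd(1)])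
  have pos: "fs2 \<rho> (Re z) * ring_wt a b (sqd 0 z) \<ge> 0" for z
    by (intro mult_nonneg_nonneg fs2_nonneg ring_wt_nonneg \<rho> a0 ab)
  have "(\<integral>\<^sup>+ z. (N z * ennreal (ring_wt a b (sqd 0 z))) * ennreal (fs2 \<rho> (Re z)) \<partial>lborel)
     = (\<integral>\<^sup>+ z. N z * ennreal (fs2 \<rho> (Re z) * ring_wt a b (sqd 0 z)) \<partial>lborel)"
    using ring_wt_nonneg[OF a0 ab(2)] fs2_nonneg[OF \<rho>] by (simp add: ennreal_mult mult_ac)
  also have "\<dots> = (\<integral>\<^sup>+ z. ennreal (n z) * ennreal (fs2 \<rho> (Re z) * ring_wt a b (sqd 0 z)) \<partial>lborel)"
    by (rule nn_integral_n) (simp add: far)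
  also have "\<dots> = (\<integral>\<^sup>+ z. ennreal (n z * (fs2 \<rho> (Re z) * ring_wt a b (sqd 0 z))) \<partial>lborel)"
    using n_nonneg pos by (simp add: ennreal_mult)
  also have "\<dots> = ennreal (\<integral>z. n z * (fs2 \<rho> (Re z) * ring_wt a b (sqd 0 z)) \<partial>lborel)"
    by (rule nn_integral_eq_integral[OF integrable_n_cont[OF c]])
      (use far n_nonneg pos in \<open>auto intro!: AE_I2 mult_nonneg_nonneg\<close>)
  finally show ?thesis .
qed

text \<open>Rescaling the real part turns \<open>fs2 \<rho>\<close> into the density \<kappa>, which
  no longer depends on \<rho>; a limit in \<rho> then concerns \<open>W\<close> alone.\<close>

lemma nn_integral_slices:
  assumes [measurable]: "W \<in> borel_measurable borel" and \<rho>: "\<rho> > 0"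
  shows "(\<integral>\<^sup>+ z. W z * ennreal (fs2 \<rho> (Re z)) \<partial>lborel)
    = (\<integral>\<^sup>+ x. (\<integral>\<^sup>+ y. W (Complex (\<rho> * x) y) \<partial>lborel) * ennreal (\<kappa> x) \<partial>lborel)"
proof -
  have [measurable]: "fs2 \<rho> \<in> borel_measurable borel" "\<kappa> \<in> borel_measurable borel"
    using has_deriv2_continuous(3)[OF fs_deriv2] has_deriv2_continuous(3)[OF f_deriv2]
    by (auto intro: borel_measurable_continuous_onI)
  have "(\<integral>\<^sup>+ z. W z * ennreal (fs2 \<rho> (Re z)) \<partial>lborel)
     = (\<integral>\<^sup>+ x. \<integral>\<^sup>+ y. W (Complex x y) * ennreal (fs2 \<rho> x) \<partial>lborel \<partial>lborel)"
    by (subst nn_integral_complex) auto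
  also have "\<dots> = (\<integral>\<^sup>+ x. (\<integral>\<^sup>+ y. W (Complex x y) \<partial>lborel) * ennreal (fs2 \<rho> x) \<partial>lborel)"
    by (intro nn_integral_cong nn_integral_multc) measurable
  also have "\<dots> = ennreal \<bar>\<rho>\<bar> * (\<integral>\<^sup>+ x. (\<integral>\<^sup>+ y. W (Complex (0 + \<rho> * x) y) \<partial>lborel) * ennreal (fs2 \<rho> (0 + \<rho> * x)) \<partial>lborel)"
    by (rule nn_integral_real_affine[OF _ \<rho>[THEN less_imp_neq, symmetric]]) measurable
  also have "\<dots> = (\<integral>\<^sup>+ x. ennreal \<bar>\<rho>\<bar> * ((\<integral>\<^sup>+ y. W (Complex (0 + \<rho> * x) y) \<partial>lborel) * ennreal (fs2 \<rho> (0 + \<rho> * x))) \<partial>lborel)"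
    by (rule nn_integral_cmult[symmetric]) measurable
  also have "\<dots> = (\<integral>\<^sup>+ x. (\<integral>\<^sup>+ y. W (Complex (\<rho> * x) y) \<partial>lborel) * ennreal (\<kappa> x) \<partial>lborel)"
  proof (rule nn_integral_cong)
    fix x
    have "ennreal \<bar>\<rho>\<bar> * ennreal (fs2 \<rho> (0 + \<rho> * x)) = ennreal (\<kappa> x)"
      using \<rho> \<kappa>_nonneg by (simp add: fs2_eq ennreal_mult[symmetric])
    then show "ennreal \<bar>\<rho>\<bar> * ((\<integral>\<^sup>+ y. W (Complex (0 + \<rho> * x) y) \<partial>lborel) * ennreal (fs2 \<rho> (0 + \<rho> * x)))
       = (\<integral>\<^sup>+ y. W (Complex (\<rho> * x) y) \<partial>lborel) * ennreal (\<kappa> x)"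
      by (metis add_0 mult.left_commute)
  qed
  finally show ?thesis .
qed

text \<open>The limit of the smoothed axis integrals as \<rho> tends to 0, by the ring identity:
  mass in the ring and flux at its two cutoff circles.\<close>

definition "ring_defect = - 2 * pi * half_mass t (2 * t) - (flux t - flux (2 * t))"

text \<open>Lower semicontinuity of N and Fatou on vertical lines, then Fatou once more in the
  average over \<kappa>, along a sequence of scales tending to 0. The O(\<rho>) error of the ring
  identity disappears in the limit.\<close>

lemma axis_upper:
  "(\<integral>\<^sup>+ y. N (Complex 0 y) * ennreal (ring_wt t (2 * t) (y\<^sup>2)) \<partial>lborel) \<le> ennreal ring_defect"
proof -
  let ?R = "\<lambda>z. ring_wt t (2 * t) (sqd 0 z)"
  let ?D = "11000 * ring_const * C / t"
  define W where "W = (\<lambda>z. N z * ennreal (?R z))"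
  have t0: "t > 0" using t by simp
  have Rc: "continuous_on UNIV ?R" by (rule has_deriv2_continuous(1)[OF has_deriv2_ring_wt, THEN continuous_Re_sqd(2)])
  then have [measurable]: "?R \<in> borel_measurable borel" by (rule borel_measurable_continuous_onI)
  have [measurable]: "\<kappa> \<in> borel_measurable borel"
    using has_deriv2_continuous(3)[OF f_deriv2] by (rule borel_measurable_continuous_onI)
  have Wm [measurable]: "W \<in> borel_measurable borel" unfolding W_def by measurable
  have \<kappa>mass: "(\<integral>\<^sup>+ x. ennreal (\<kappa> x) \<partial>lborel) = 1" using \<kappa>_marginal[of "\<lambda>_. 1"] k_mass by simp
  define r where "r = (\<lambda>j::nat. 1 / real (Suc j))"
  have r: "r j > 0" for j by (simp add: r_def)
  have rlim: "r \<longlonglongrightarrow> 0" unfolding r_def by (rule LIMSEQ_Suc[OF lim_1_over_n])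
  have fat: "W (Complex 0 y) \<le> liminf (\<lambda>j. W (Complex (r j * x) y))" for x y
    unfolding W_def
  proof (rule liminf_mult_ennreal[OF lsc_defect[OF sh] _ Rc])
    have "(\<lambda>j. of_real (r j * x) + \<i> * of_real y) \<longlonglongrightarrow> of_real (0 * x) + \<i> * complex_of_real y"
      by (intro tendsto_intros rlim)
    then show "(\<lambda>j. Complex (r j * x) y) \<longlonglongrightarrow> Complex 0 y" by (simp add: Complex_eq)
    show "0 \<le> ?R z" for z by (rule ring_wt_nonneg) (use t0 in auto)
  qed
  have "(\<integral>\<^sup>+ y. N (Complex 0 y) * ennreal (ring_wt t (2 * t) (y\<^sup>2)) \<partial>lborel) = (\<integral>\<^sup>+ y. W (Complex 0 y) \<partial>lborel)"
    by (simp add: W_def sqd_def)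
  also have "\<dots> = (\<integral>\<^sup>+ x. (\<integral>\<^sup>+ y. W (Complex 0 y) \<partial>lborel) * ennreal (\<kappa> x) \<partial>lborel)"
    by (subst nn_integral_cmult) (auto simp: \<kappa>mass)
  also have "\<dots> \<le> (\<integral>\<^sup>+ x. liminf (\<lambda>j. (\<integral>\<^sup>+ y. W (Complex (r j * x) y) \<partial>lborel) * ennreal (\<kappa> x)) \<partial>lborel)"
  proof (rule nn_integral_mono)
    fix x
    have "(\<integral>\<^sup>+ y. W (Complex 0 y) \<partial>lborel) \<le> (\<integral>\<^sup>+ y. liminf (\<lambda>j. W (Complex (r j * x) y)) \<partial>lborel)"
      by (intro nn_integral_mono fat)
    also have "\<dots> \<le> liminf (\<lambda>j. \<integral>\<^sup>+ y. W (Complex (r j * x) y) \<partial>lborel)"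
      by (rule nn_integral_liminf) measurable
    finally have "(\<integral>\<^sup>+ y. W (Complex 0 y) \<partial>lborel) * ennreal (\<kappa> x)
       \<le> ennreal (\<kappa> x) * liminf (\<lambda>j. \<integral>\<^sup>+ y. W (Complex (r j * x) y) \<partial>lborel)"
      by (subst mult.commute) (rule mult_left_mono, auto)
    also have "\<dots> = liminf (\<lambda>j. ennreal (\<kappa> x) * (\<integral>\<^sup>+ y. W (Complex (r j * x) y) \<partial>lborel))"
      by (rule Liminf_compose_continuous_mono[symmetric])
        (auto intro!: ennreal_continuous_on_cmult monoI mult_left_mono continuous_on_id)
    finally show "(\<integral>\<^sup>+ y. W (Complex 0 y) \<partial>lborel) * ennreal (\<kappa> x)
      \<le> liminf (\<lambda>j. (\<integral>\<^sup>+ y. W (Complex (r j * x) y) \<partial>lborel) * ennreal (\<kappa> x))" by (simp add: mult.commute)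
  qed
  also have "\<dots> \<le> liminf (\<lambda>j. \<integral>\<^sup>+ x. (\<integral>\<^sup>+ y. W (Complex (r j * x) y) \<partial>lborel) * ennreal (\<kappa> x) \<partial>lborel)"
    by (rule nn_integral_liminf) measurable
  also have "\<dots> = liminf (\<lambda>j. \<integral>\<^sup>+ z. W z * ennreal (fs2 (r j) (Re z)) \<partial>lborel)"
    by (simp add: nn_integral_slices[OF Wm r])
  also have "\<dots> \<le> liminf (\<lambda>j. ennreal (ring_defect + ?D * r j))"
  proof (intro Liminf_mono always_eventually allI)
    fix j
    have "(\<integral>\<^sup>+ z. W z * ennreal (fs2 (r j) (Re z)) \<partial>lborel) = ennreal (\<integral>z. n z * (fs2 (r j) (Re z) * ?R z) \<partial>lborel)"
      unfolding W_def by (rule nn_integral_ring[OF r]) (use t0 in auto)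
    also have "\<dots> \<le> ennreal (ring_defect + ?D * r j)"
      using ring_identity[OF r, of t "2 * t" j] t0 by (intro ennreal_leI) (simp add: ring_defect_def)
    finally show "(\<integral>\<^sup>+ z. W z * ennreal (fs2 (r j) (Re z)) \<partial>lborel) \<le> ennreal (ring_defect + ?D * r j)" .
  qed
  also have "\<dots> = ennreal ring_defect"
  proof -
    have "(\<lambda>j. ennreal (ring_defect + ?D * r j)) \<longlonglongrightarrow> ennreal (ring_defect + ?D * 0)"
      by (intro tendsto_intros rlim)
    then show ?thesis by (simp add: lim_imp_Liminf)
  qed
  finally show ?thesis .
qed

end


section \<open>The axis integral of circle means from below\<close>

context ring_side
begin

lemma half_mass_nonneg: "0 < a \<Longrightarrow> a \<le> b \<Longrightarrow> half_mass a b \<ge> 0"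
  unfolding half_mass_def by (intro integral_nonneg_AE AE_I2 mult_nonneg_nonneg ring_wt_nonneg) auto

lemma ring_wt_Lipschitz:
  assumes "0 < a" "a \<le> b"
  shows "\<bar>ring_wt a b x - ring_wt a b y\<bar> \<le> ring_const / a ^ 4 * \<bar>x - y\<bar>"
proof -
  have *: "\<bar>ring_wt a b y - ring_wt a b x\<bar> \<le> ring_const / a ^ 4 * (y - x)" if "x < y" for x y
  proof -
    have "\<exists>z>x. z < y \<and> ring_wt a b y - ring_wt a b x = (y - x) * ring_wt1 a b z"
      by (rule MVT2[OF that]) (use has_deriv2_ring_wt[of a b] in \<open>auto simp: has_deriv2_def\<close>)
    then obtain z where "ring_wt a b y - ring_wt a b x = (y - x) * ring_wt1 a b z" by blast
    moreover have "\<bar>(y - x) * ring_wt1 a b z\<bar> \<le> (y - x) * (ring_const / a ^ 4)"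
      unfolding abs_mult using ring_const_wt1[OF assms, of z] that by (intro mult_mono) auto
    ultimately show ?thesis by (simp only: mult.commute)
  qed
  show ?thesis using *[of x y] *[of y x] by (cases x y rule: linorder_cases) auto
qed

text \<open>The ring identity weighs N by the modulus of the displaced point, while the axis
  integral needs the weight at the centre of the annulus. The difference is O(\<rho>/t) relative to
  1/s on the ring, and there 1/s is the value of the wider weight from \<open>t / 4\<close> to
  \<open>8 * t\<close>.\<close>

lemma ring_wt_shift:
  assumes \<rho>: "0 < \<rho>" "\<rho> \<le> t / 8" and ab: "\<bar>a\<bar> \<le> 2" "\<bar>b\<bar> \<le> 2"
  shows "ring_wt t (2 * t) ((\<rho> * a)\<^sup>2 + y\<^sup>2)
    \<le> ring_wt t (2 * t) ((y - \<rho> * b)\<^sup>2) + 272 * ring_const * \<rho> / t * ring_wt (t / 4) (8 * t) ((\<rho> * a)\<^sup>2 + y\<^sup>2)"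
    (is "?R ?X \<le> ?R ?X' + ?E * ?V ?X")
proof (cases "?R ?X = 0")
  case True
  have "?R ?X' \<ge> 0" "?V ?X \<ge> 0" using t by (auto intro!: ring_wt_nonneg)
  moreover have "?E \<ge> 0" using \<rho> t ring_const_pos by auto
  ultimately have "?R ?X' + ?E * ?V ?X \<ge> 0" by (intro add_nonneg_nonneg mult_nonneg_nonneg)
  then show ?thesis using True by simp
next
  case False
  have t0: "t > 0" "t \<le> 2 * t" using t by auto
  have X: "t\<^sup>2 < ?X" "?X < 16 * t\<^sup>2"
    using False ring_wt_inner(1)[OF t0, of ?X] ring_wt_outer(1)[OF t0, of ?X]
    by (force simp: power2_eq_square)+
  have V: "?V ?X = 1 / ?X"
    by (rule ring_wt_mid) (use t X in \<open>auto simp: power2_eq_square\<close>)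
  have "1 / (16 * t\<^sup>2) \<le> 1 / ?X" using X t0 zero_le_power2[of t] by (intro divide_left_mono mult_pos_pos) (auto intro: le_less_trans)
  then have "?E / (16 * t\<^sup>2) \<le> ?E * ?V ?X"
    unfolding V using \<rho> t ring_const_pos by (metis (no_types, opaque_lifting) less_eq_real_def mult_left_mono divide_inverse mult_1 mult_nonneg_nonneg zero_le_numeral t0(1) inverse_nonnegative_iff_nonnegative)
  \<comment> \<open>272 = 16 * 17: the wide weight is at least \<open>1 / (16 * t\<^sup>2)\<close>
    on the ring, and the squared moduli differ by at most \<open>17 * t * \<rho>\<close>.\<close>
  then have EV: "17 * ring_const * \<rho> / t ^ 3 \<le> ?E * ?V ?X"
    using t by (simp add: power2_eq_square power3_eq_cube)
  have "(4 * t)\<^sup>2 = 16 * t\<^sup>2" by (simp add: power_mult_distrib)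
  then have "y\<^sup>2 \<le> (4 * t)\<^sup>2" using X(2) zero_le_power2[of "\<rho> * a"] by linarith
  then have y: "\<bar>y\<bar> \<le> 4 * t" using t by (subst (asm) power2_le_iff_abs_le) auto
  have "?X - ?X' = \<rho> * (\<rho> * a\<^sup>2 + 2 * y * b - \<rho> * b\<^sup>2)" by (simp add: power2_eq_square algebra_simps)
  also have "\<bar>\<dots>\<bar> \<le> \<rho> * (17 * t)"
  proof -
    have "a\<^sup>2 \<le> 2\<^sup>2" "b\<^sup>2 \<le> 2\<^sup>2" using ab by (subst power2_le_iff_abs_le; simp)+
    then have "\<rho> * a\<^sup>2 \<le> (t / 8) * 4" "\<rho> * b\<^sup>2 \<le> (t / 8) * 4" using \<rho> by (intro mult_mono; simp)+
    moreover have "0 \<le> \<rho> * a\<^sup>2" "0 \<le> \<rho> * b\<^sup>2" using \<rho> by auto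
    moreover have "\<bar>2 * y * b\<bar> \<le> 2 * (4 * t) * 2" unfolding abs_mult using y ab t by (intro mult_mono) auto
    ultimately have "\<bar>\<rho> * a\<^sup>2 + 2 * y * b - \<rho> * b\<^sup>2\<bar> \<le> 17 * t" using t by linarith
    then show ?thesis unfolding abs_mult[of \<rho>] using \<rho> by (intro mult_mono) auto
  qed
  finally have d: "\<bar>?X - ?X'\<bar> \<le> \<rho> * (17 * t)" .
  have "\<bar>?R ?X - ?R ?X'\<bar> \<le> ring_const / t ^ 4 * \<bar>?X - ?X'\<bar>" by (rule ring_wt_Lipschitz[OF t0])
  also have "\<dots> \<le> ring_const / t ^ 4 * (\<rho> * (17 * t))"
    using d ring_const_pos t by (intro mult_left_mono) auto
  also have "\<dots> = 17 * ring_const * \<rho> / t ^ 3" using t by (simp add: field_simps eval_nat_numeral)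
  finally show ?thesis using EV by linarith
qed

text \<open>The three summands pay for the error of the ring identity, for the change of weight (272
  times the bound 2000 of the wide ring), and for the case \<rho> > t/8.\<close>

definition shift_const :: real where
  "shift_const = (11000 * ring_const + 544000 * ring_const\<^sup>2 + 2048 * ring_const) * C"

lemma shift_const_pos: "shift_const > 0"
  unfolding shift_const_def using ring_const_pos C by (intro mult_pos_pos add_pos_pos) auto

text \<open>The same planar average is read in two ways. Shifting \<open>y\<close> by
  \<open>\<rho> * Im w\<close> for each displacement \<open>w\<close> leaves only
  \<open>Re w\<close> in N, and \<open>Re w\<close> has density \<kappa> under \<open>k\<close>; so
  averages over annuli centred on the axis become the left-hand side of the ring identity, up to the
  change of weight.\<close>

lemma smoothed_axis_lower:
  assumes \<rho>: "\<rho> > 0" "\<rho> \<le> t / 8"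
  shows "ennreal (ring_defect - shift_const * \<rho> / t)
    \<le> (\<integral>\<^sup>+ y. (\<integral>\<^sup>+ w. N (Complex 0 y + of_real \<rho> * w) * ennreal (k w) \<partial>lborel) * ennreal (ring_wt t (2 * t) (y\<^sup>2)) \<partial>lborel)"
proof -
  let ?R = "ring_wt t (2 * t)" and ?V = "ring_wt (t / 4) (8 * t)"
  define E where "E = 272 * ring_const * \<rho> / t"
  have E0: "E \<ge> 0" using \<rho> t ring_const_pos by (simp add: E_def)
  have t0: "t > 0" using t by simp
  have Rn: "?R x \<ge> 0" "?V x \<ge> 0" for x using t0 by (auto intro!: ring_wt_nonneg)
  have [measurable]: "ring_wt a b \<in> borel_measurable borel" for a b
    by (rule borel_measurable_continuous_onI[OF has_deriv2_continuous(1)[OF has_deriv2_ring_wt]])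
  have [measurable]: "k \<in> borel_measurable borel" by (rule borel_measurable_continuous_onI[OF k_cont])
  have [measurable]: "sqd 0 \<in> borel_measurable borel" unfolding sqd_def by measurable
  have marg: "(\<integral>\<^sup>+ z. W z * ennreal (fs2 \<rho> (Re z)) \<partial>lborel)
      = (\<integral>\<^sup>+ w. (\<integral>\<^sup>+ y. W (Complex (\<rho> * Re w) y) \<partial>lborel) * ennreal (k w) \<partial>lborel)"
    if [measurable]: "W \<in> borel_measurable borel" for W
    by (subst nn_integral_slices[OF that \<rho>(1)])
      (rule \<kappa>_marginal[symmetric, of "\<lambda>x. (\<integral>\<^sup>+ y. W (Complex (\<rho> * x) y) \<partial>lborel)"], measurable)
  have VI: "(\<integral>\<^sup>+ z. (N z * ennreal (?V (sqd 0 z))) * ennreal (fs2 \<rho> (Re z)) \<partial>lborel) \<le> ennreal (2000 * ring_const * C)"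
  proof -
    have f: "\<bar>flux (t / 4)\<bar> \<le> 128 * ring_const * C" "\<bar>flux (8 * t)\<bar> \<le> 128 * ring_const * C"
      using t0 by (auto intro!: flux_bound)
    have "11000 * ring_const * C * \<rho> / t = 11000 * ring_const * C * (\<rho> / t)" by simp
    also have "\<dots> \<le> 11000 * ring_const * C * (1 / 8)"
      using \<rho> t0 ring_const_pos C by (intro mult_left_mono) (auto simp: field_simps)
    finally have e: "11000 * ring_const * C * \<rho> / t \<le> 1375 * ring_const * C" by (simp add: mult_ac)
    have "half_mass (t / 4) (8 * t) \<ge> 0" using t0 by (intro half_mass_nonneg) auto
    then have "2 * pi * half_mass (t / 4) (8 * t) \<ge> 0" by simp
    moreover have "ring_const * C > 0" using ring_const_pos C by simp
    moreover have "\<bar>(\<integral>z. n z * (fs2 \<rho> (Re z) * ?V (sqd 0 z)) \<partial>lborel)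
      - (- 2 * pi * half_mass (t / 4) (8 * t) - (flux (t / 4) - flux (8 * t)))\<bar> \<le> 11000 * ring_const * C * \<rho> / t"
      by (rule ring_identity[OF \<rho>(1)]) (use t0 in auto)
    ultimately have "(\<integral>z. n z * (fs2 \<rho> (Re z) * ?V (sqd 0 z)) \<partial>lborel) \<le> 2000 * ring_const * C"
      using f e by (simp add: mult.assoc)
    moreover have "(\<integral>\<^sup>+ z. (N z * ennreal (?V (sqd 0 z))) * ennreal (fs2 \<rho> (Re z)) \<partial>lborel)
       = ennreal (\<integral>z. n z * (fs2 \<rho> (Re z) * ?V (sqd 0 z)) \<partial>lborel)"
      by (rule nn_integral_ring[OF \<rho>(1)]) (use t0 in auto)
    ultimately show ?thesis by (simp add: ennreal_leI)
  qed
  define Y where "Y = (\<integral>\<^sup>+ y. (\<integral>\<^sup>+ w. N (Complex 0 y + of_real \<rho> * w) * ennreal (k w) \<partial>lborel) * ennreal (?R (y\<^sup>2)) \<partial>lborel)"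
  have "Y = (\<integral>\<^sup>+ y. \<integral>\<^sup>+ w. N (Complex 0 y + of_real \<rho> * w) * ennreal (k w) * ennreal (?R (y\<^sup>2)) \<partial>lborel \<partial>lborel)"
    unfolding Y_def by (intro nn_integral_cong nn_integral_multc[symmetric]) measurable
  also have "\<dots> = (\<integral>\<^sup>+ w. \<integral>\<^sup>+ y. N (Complex 0 y + of_real \<rho> * w) * ennreal (k w) * ennreal (?R (y\<^sup>2)) \<partial>lborel \<partial>lborel)"
    by (rule lborel_pair.Fubini') measurable
  also have "\<dots> = (\<integral>\<^sup>+ w. (\<integral>\<^sup>+ y. N (Complex (\<rho> * Re w) y) * ennreal (?R ((y - \<rho> * Im w)\<^sup>2)) \<partial>lborel) * ennreal (k w) \<partial>lborel)"
  proof (rule nn_integral_cong)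
    fix w :: complex
    have eq: "Complex 0 y + of_real \<rho> * w = Complex (\<rho> * Re w) (y + \<rho> * Im w)" for y
      by (simp add: complex_eq_iff)
    have "(\<integral>\<^sup>+ y. N (Complex 0 y + of_real \<rho> * w) * ennreal (k w) * ennreal (?R (y\<^sup>2)) \<partial>lborel)
       = (\<integral>\<^sup>+ y. (N (Complex (\<rho> * Re w) (y + \<rho> * Im w)) * ennreal (?R ((y + \<rho> * Im w - \<rho> * Im w)\<^sup>2))) * ennreal (k w) \<partial>lborel)"
      unfolding eq by (simp add: mult_ac)
    also have "\<dots> = (\<integral>\<^sup>+ y. (N (Complex (\<rho> * Re w) y) * ennreal (?R ((y - \<rho> * Im w)\<^sup>2))) * ennreal (k w) \<partial>lborel)"
      by (rule nn_integral_shift[of "\<lambda>y. (N (Complex (\<rho> * Re w) y) * ennreal (?R ((y - \<rho> * Im w)\<^sup>2))) * ennreal (k w)"]) measurable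
    also have "\<dots> = (\<integral>\<^sup>+ y. N (Complex (\<rho> * Re w) y) * ennreal (?R ((y - \<rho> * Im w)\<^sup>2)) \<partial>lborel) * ennreal (k w)"
      by (rule nn_integral_multc) measurable
    finally show "(\<integral>\<^sup>+ y. N (Complex 0 y + of_real \<rho> * w) * ennreal (k w) * ennreal (?R (y\<^sup>2)) \<partial>lborel)
      = (\<integral>\<^sup>+ y. N (Complex (\<rho> * Re w) y) * ennreal (?R ((y - \<rho> * Im w)\<^sup>2)) \<partial>lborel) * ennreal (k w)" .
  qed
  finally have Y: "Y = (\<integral>\<^sup>+ w. (\<integral>\<^sup>+ y. N (Complex (\<rho> * Re w) y) * ennreal (?R ((y - \<rho> * Im w)\<^sup>2)) \<partial>lborel) * ennreal (k w) \<partial>lborel)" .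
  have "ennreal (ring_defect - 11000 * ring_const * C * \<rho> / t)
     \<le> ennreal (\<integral>z. n z * (fs2 \<rho> (Re z) * ?R (sqd 0 z)) \<partial>lborel)"
    using ring_identity[OF \<rho>(1), of t "2 * t"] t0 by (intro ennreal_leI) (simp add: ring_defect_def)
  also have "\<dots> = (\<integral>\<^sup>+ z. (N z * ennreal (?R (sqd 0 z))) * ennreal (fs2 \<rho> (Re z)) \<partial>lborel)"
    by (rule nn_integral_ring[OF \<rho>(1), symmetric]) (use t0 in auto)
  also have "\<dots> = (\<integral>\<^sup>+ w. (\<integral>\<^sup>+ y. N (Complex (\<rho> * Re w) y) * ennreal (?R ((\<rho> * Re w)\<^sup>2 + y\<^sup>2)) \<partial>lborel) * ennreal (k w) \<partial>lborel)"
    by (subst marg) (measurable, simp add: sqd_def)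
  also have "\<dots> \<le> (\<integral>\<^sup>+ w. (\<integral>\<^sup>+ y. N (Complex (\<rho> * Re w) y) * ennreal (?R ((y - \<rho> * Im w)\<^sup>2))
       + ennreal E * (N (Complex (\<rho> * Re w) y) * ennreal (?V ((\<rho> * Re w)\<^sup>2 + y\<^sup>2))) \<partial>lborel) * ennreal (k w) \<partial>lborel)"
  proof (rule nn_integral_mono)
    fix w :: complex
    show "(\<integral>\<^sup>+ y. N (Complex (\<rho> * Re w) y) * ennreal (?R ((\<rho> * Re w)\<^sup>2 + y\<^sup>2)) \<partial>lborel) * ennreal (k w)
       \<le> (\<integral>\<^sup>+ y. N (Complex (\<rho> * Re w) y) * ennreal (?R ((y - \<rho> * Im w)\<^sup>2))
       + ennreal E * (N (Complex (\<rho> * Re w) y) * ennreal (?V ((\<rho> * Re w)\<^sup>2 + y\<^sup>2))) \<partial>lborel) * ennreal (k w)"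
    proof (cases "k w = 0")
      case False
      then have w: "\<bar>Re w\<bar> \<le> 2" "\<bar>Im w\<bar> \<le> 2"
        using k_support[OF False] abs_Re_le_cmod[of w] abs_Im_le_cmod[of w] by auto
      have "ennreal (?R ((\<rho> * Re w)\<^sup>2 + y\<^sup>2)) \<le> ennreal (?R ((y - \<rho> * Im w)\<^sup>2)) + ennreal E * ennreal (?V ((\<rho> * Re w)\<^sup>2 + y\<^sup>2))" for y
      proof -
        have "ennreal (?R ((\<rho> * Re w)\<^sup>2 + y\<^sup>2)) \<le> ennreal (?R ((y - \<rho> * Im w)\<^sup>2) + E * ?V ((\<rho> * Re w)\<^sup>2 + y\<^sup>2))"
          unfolding E_def by (intro ennreal_leI ring_wt_shift \<rho> w)
        then show ?thesis using Rn E0 by (simp add: ennreal_mult)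
      qed
      then have "N (Complex (\<rho> * Re w) y) * ennreal (?R ((\<rho> * Re w)\<^sup>2 + y\<^sup>2)) \<le> N (Complex (\<rho> * Re w) y) *
         (ennreal (?R ((y - \<rho> * Im w)\<^sup>2)) + ennreal E * ennreal (?V ((\<rho> * Re w)\<^sup>2 + y\<^sup>2)))" for y
        by (intro mult_left_mono) auto
      then show ?thesis by (intro mult_right_mono nn_integral_mono) (simp_all add: distrib_left mult.left_commute)
    qed simp
  qed
  also have "\<dots> = (\<integral>\<^sup>+ w. (\<integral>\<^sup>+ y. N (Complex (\<rho> * Re w) y) * ennreal (?R ((y - \<rho> * Im w)\<^sup>2)) \<partial>lborel) * ennreal (k w)
       + ennreal E * ((\<integral>\<^sup>+ y. N (Complex (\<rho> * Re w) y) * ennreal (?V ((\<rho> * Re w)\<^sup>2 + y\<^sup>2)) \<partial>lborel) * ennreal (k w)) \<partial>lborel)"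
    by (intro nn_integral_cong) (subst nn_integral_add, measurable, subst nn_integral_cmult, measurable, simp add: distrib_right mult.assoc)
  also have "\<dots> = Y + ennreal E * (\<integral>\<^sup>+ w. (\<integral>\<^sup>+ y. N (Complex (\<rho> * Re w) y) * ennreal (?V ((\<rho> * Re w)\<^sup>2 + y\<^sup>2)) \<partial>lborel) * ennreal (k w) \<partial>lborel)"
    unfolding Y by (subst nn_integral_add, measurable, subst nn_integral_cmult, measurable)
  also have "(\<integral>\<^sup>+ w. (\<integral>\<^sup>+ y. N (Complex (\<rho> * Re w) y) * ennreal (?V ((\<rho> * Re w)\<^sup>2 + y\<^sup>2)) \<partial>lborel) * ennreal (k w) \<partial>lborel)
     = (\<integral>\<^sup>+ z. (N z * ennreal (?V (sqd 0 z))) * ennreal (fs2 \<rho> (Re z)) \<partial>lborel)"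
    by (subst marg) (measurable, simp add: sqd_def)
  also have "Y + ennreal E * \<dots> \<le> Y + ennreal E * ennreal (2000 * ring_const * C)"
    by (intro add_left_mono mult_left_mono VI) simp
  also have "\<dots> = Y + ennreal (E * (2000 * ring_const * C))"
    using E0 ring_const_pos C by (simp add: ennreal_mult)
  finally have le: "ennreal (ring_defect - 11000 * ring_const * C * \<rho> / t) \<le> Y + ennreal (E * (2000 * ring_const * C))" .
  have e1: "E * (2000 * ring_const * C) = 544000 * ring_const\<^sup>2 * C * \<rho> / t"
    by (simp add: E_def power2_eq_square)
  have e2: "ring_const * C * \<rho> / t \<ge> 0" using ring_const_pos C \<rho> t0 by simp
  have e3: "shift_const * \<rho> / t = 11000 * ring_const * C * \<rho> / t + 544000 * ring_const\<^sup>2 * C * \<rho> / t + 2048 * (ring_const * C * \<rho> / t)"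
    by (simp add: shift_const_def add_divide_distrib distrib_left distrib_right mult_ac)
  have "a - (b + c + 2048 * d) \<le> a - b - c" if "d \<ge> 0" for a b c d :: real using that by simp
  from this[OF e2] have "ring_defect - shift_const * \<rho> / t \<le> ring_defect - 11000 * ring_const * C * \<rho> / t - E * (2000 * ring_const * C)"
    unfolding e1 e3 .
  then have "ennreal (ring_defect - shift_const * \<rho> / t)
     \<le> ennreal (ring_defect - 11000 * ring_const * C * \<rho> / t - E * (2000 * ring_const * C))" by (rule ennreal_leI)
  also have "\<dots> = ennreal (ring_defect - 11000 * ring_const * C * \<rho> / t) - ennreal (E * (2000 * ring_const * C))"
    using E0 ring_const_pos C by (intro ennreal_minus[symmetric]) auto
  also have "\<dots> \<le> Y" using le by (simp add: ennreal_minus_le_iff add.commute)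
  finally show ?thesis by (simp add: Y_def)
qed

text \<open>For small \<rho> the kernel uses radii between \<rho> and 2 \<rho>, all at least
  \<open>q y\<close>, so the average over the annulus is at most the circle mean of radius
  \<open>q y\<close>. For \<rho> > t/8 the left-hand side is not positive.\<close>

lemma axis_lower:
  assumes \<rho>: "\<rho> > 0" and q: "\<And>y. t \<le> \<bar>y\<bar> \<Longrightarrow> \<bar>y\<bar> \<le> 4 * t \<Longrightarrow> 0 \<le> q y \<and> q y \<le> \<rho>"
  shows "ennreal (ring_defect - shift_const * \<rho> / t)
    \<le> (\<integral>\<^sup>+ y. e2ennreal (ereal (B * t) - circle_mean u (Complex 0 y) (q y)) * ennreal (ring_wt t (2 * t) (y\<^sup>2)) \<partial>lborel)"
proof (cases "\<rho> \<le> t / 8")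
  case True
  have t0: "t > 0" using t by simp
  have [measurable]: "k \<in> borel_measurable borel" by (rule borel_measurable_continuous_onI[OF k_cont])
  show ?thesis
  proof (rule order_trans[OF smoothed_axis_lower[OF \<rho> True] nn_integral_mono])
    fix y
    show "(\<integral>\<^sup>+ w. N (Complex 0 y + of_real \<rho> * w) * ennreal (k w) \<partial>lborel) * ennreal (ring_wt t (2 * t) (y\<^sup>2))
      \<le> e2ennreal (ereal (B * t) - circle_mean u (Complex 0 y) (q y)) * ennreal (ring_wt t (2 * t) (y\<^sup>2))"
    proof (cases "ring_wt t (2 * t) (y\<^sup>2) = 0")
      case False
      then have "t\<^sup>2 < y\<^sup>2" "y\<^sup>2 < (4 * t)\<^sup>2"
        using ring_wt_inner(1)[of t "2 * t" "y\<^sup>2"] ring_wt_outer(1)[of t "2 * t" "y\<^sup>2"] t0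
        by (force simp: power2_eq_square)+
      then have y: "t \<le> \<bar>y\<bar>" "\<bar>y\<bar> \<le> 4 * t"
        using t0 power2_less_imp_less[of t "\<bar>y\<bar>"] power2_less_imp_less[of "\<bar>y\<bar>" "4 * t"] by auto
      have cb: "cball (Complex 0 y) (2 * \<rho>) \<subseteq> cball 0 (20 * t)"
        using y True t0 by (intro cball_subset_cball_iff[THEN iffD2] disjI1) (simp add: dist_norm cmod_def)
      have "(\<integral>\<^sup>+ w. N (Complex 0 y + of_real \<rho> * w) * ennreal (k w) \<partial>lborel)
         \<le> cavg N (Complex 0 y) (of_real (q y)) * (\<integral>\<^sup>+ w. ennreal (k w) \<partial>lborel)"
      proof (rule radial_mean_le_cavg[OF lsc_defect[OF sh] _ cb])
        show "supermean_on (cball 0 (20 * t)) N"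
          by (rule supermean_defect[OF sh]) (use B t0 above in auto)
        show "q y \<le> \<rho> * cmod w \<and> \<rho> * cmod w \<le> 2 * \<rho>" if "ennreal (k w) \<noteq> 0" for w
        proof -
          have "k w \<noteq> 0" using that by (intro notI) simp
          then have "1 \<le> cmod w" "cmod w \<le> 2" using k_support by blast+
          then have "\<rho> * 1 \<le> \<rho> * cmod w" "\<rho> * cmod w \<le> \<rho> * 2" using \<rho> by (auto intro!: mult_left_mono simp del: mult_1_right)
          then show ?thesis using q[OF y] by auto
        qed
      qed (use q[OF y] \<rho> k_rotate in auto)
      also have "\<dots> = e2ennreal (ereal (B * t) - circle_mean u (Complex 0 y) (q y))"
      proof -
        have "sphere (Complex 0 y) \<bar>q y\<bar> \<subseteq> cball (Complex 0 y) (2 * \<rho>)"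
          using q[OF y] \<rho> by auto
        then have "cavg N (Complex 0 y) (of_real (q y)) = e2ennreal (ereal (B * t) - circle_mean u (Complex 0 y) (q y))"
          using cb B t0 by (intro cavg_defect[OF sh] above) (auto simp: subset_iff)
        then show ?thesis by (simp add: k_mass)
      qed
      finally show ?thesis by (intro mult_right_mono) auto
    qed simp
  qed
next
  case False
  have t0: "t > 0" using t by simp
  have "half_mass t (2 * t) \<ge> 0" using t0 by (intro half_mass_nonneg) auto
  then have "2 * pi * half_mass t (2 * t) \<ge> 0" by simp
  moreover have "\<bar>flux t\<bar> \<le> 128 * ring_const * C" "\<bar>flux (2 * t)\<bar> \<le> 128 * ring_const * C"
    using t0 by (auto intro!: flux_bound)
  \<comment> \<open>Two fluxes of at most 128 make 256, written as 2048/8 to be compared with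
    \<rho>/t > 1/8.\<close>
  ultimately have "ring_defect \<le> 2048 * ring_const * C * (1 / 8)"
    unfolding ring_defect_def mult.assoc mult_minus_left by linarith
  also have "\<dots> \<le> shift_const * (\<rho> / t)"
    using False t0 ring_const_pos C \<rho> by (intro mult_mono) (auto simp: field_simps shift_const_def)
  finally have "ring_defect - shift_const * \<rho> / t \<le> 0" by simp
  then show ?thesis by (simp add: ennreal_neg)
qed

end


section \<open>The logarithmic potential bound\<close>

lemma DERIV_glue:
  fixes f g h :: "real \<Rightarrow> real"
  assumes g: "(g has_real_derivative D) (at c)" and h: "(h has_real_derivative D) (at c)"
    and fg: "\<And>x. x \<ge> c \<Longrightarrow> f x = g x" and fh: "\<And>x. x \<le> c \<Longrightarrow> f x = h x"
  shows "(f has_real_derivative D) (at c)"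
proof -
  have "(f has_real_derivative D) (at c within {c..})"
    by (rule has_field_derivative_transform_within[OF DERIV_subset[OF g subset_UNIV], of 1]) (use fg in auto)
  moreover have "(f has_real_derivative D) (at c within {..c})"
    by (rule has_field_derivative_transform_within[OF DERIV_subset[OF h subset_UNIV], of 1]) (use fh in auto)
  moreover have "at c = at c within ({..c} \<union> {c..})"
  proof -
    have "{..c} \<union> {c..} = (UNIV :: real set)" by auto
    then show ?thesis by simp
  qed
  ultimately show ?thesis
    unfolding has_field_derivative_iff at_within_union by (auto intro: filterlim_sup)
qed

text \<open>The function v \<mapsto> (ln v) / 2, continued below 1 by its second Taylor polynomial at 1.\<close>

definition log_profile :: "real \<Rightarrow> real" where "log_profile v = (if v \<le> 1 then ((v - 1) - (v - 1)\<^sup>2 / 2) / 2 else ln v / 2)"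
definition log_profile1 :: "real \<Rightarrow> real" where "log_profile1 v = (if v \<le> 1 then (2 - v) / 2 else 1 / (2 * v))"
definition log_profile2 :: "real \<Rightarrow> real" where "log_profile2 v = - 1 / (2 * (max 1 v)\<^sup>2)"

lemma has_deriv2_log_profile: "has_deriv2 log_profile log_profile1 log_profile2"
proof -
  have lo: "((\<lambda>v. ((v - 1) - (v - 1)\<^sup>2 / 2) / 2) has_real_derivative (2 - v) / 2) (at v)"
    "((\<lambda>v::real. (2 - v) / 2) has_real_derivative - 1 / 2) (at v)" for v :: real
    by (auto intro!: derivative_eq_intros simp: algebra_simps diff_divide_distrib)
  have hi: "((\<lambda>v. ln v / 2) has_real_derivative 1 / (2 * v)) (at v)"
    "((\<lambda>v. 1 / (2 * v)) has_real_derivative - 1 / (2 * v\<^sup>2)) (at v)" if "v > 0" for v :: real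
    using that by (auto intro!: derivative_eq_intros simp: field_simps power2_eq_square)
  have "(log_profile has_real_derivative log_profile1 v) (at v) \<and> (log_profile1 has_real_derivative log_profile2 v) (at v)" for v
  proof (cases v "1::real" rule: linorder_cases)
    case less
    have "eventually (\<lambda>y::real. y < 1) (nhds v)" using less by (rule order_tendstoD(2)[OF filterlim_ident])
    then have E: "eventually (\<lambda>y. log_profile y = ((y - 1) - (y - 1)\<^sup>2 / 2) / 2) (nhds v)" "eventually (\<lambda>y. log_profile1 y = (2 - y) / 2) (nhds v)"
      by (eventually_elim, simp add: log_profile_def log_profile1_def)+
    have "log_profile1 v = (2 - v) / 2" "log_profile2 v = - 1 / 2" using less by (auto simp: log_profile1_def log_profile2_def max_def)
    then show ?thesis using lo[of v] unfolding DERIV_cong_ev[OF refl E(1) refl] DERIV_cong_ev[OF refl E(2) refl] by metis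
  next
    case greater
    have "eventually (\<lambda>y::real. y > 1) (nhds v)" using greater by (rule order_tendstoD(1)[OF filterlim_ident])
    then have E: "eventually (\<lambda>y. log_profile y = ln y / 2) (nhds v)" "eventually (\<lambda>y. log_profile1 y = 1 / (2 * y)) (nhds v)"
      by (eventually_elim, simp add: log_profile_def log_profile1_def)+
    have "log_profile1 v = 1 / (2 * v)" "log_profile2 v = - 1 / (2 * v\<^sup>2)" "v > 0" using greater by (auto simp: log_profile1_def log_profile2_def max_def)
    then show ?thesis using hi[of v] unfolding DERIV_cong_ev[OF refl E(1) refl] DERIV_cong_ev[OF refl E(2) refl] by metis
  next
    case equal
    have "(log_profile has_real_derivative 1 / 2) (at 1)"
      by (rule DERIV_glue[of "\<lambda>v. ln v / 2" _ _ "\<lambda>v. ((v - 1) - (v - 1)\<^sup>2 / 2) / 2"])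
        (use hi(1)[of 1] lo(1)[of 1] in \<open>auto simp: log_profile_def\<close>)
    moreover have "(log_profile1 has_real_derivative - 1 / 2) (at 1)"
      by (rule DERIV_glue[of "\<lambda>v. 1 / (2 * v)" _ _ "\<lambda>v. (2 - v) / 2"])
        (use hi(2)[of 1] lo(2)[of 1] in \<open>auto simp: log_profile1_def\<close>)
    ultimately show ?thesis using equal by (simp add: log_profile1_def log_profile2_def)
  qed
  moreover have "continuous_on UNIV log_profile2" unfolding log_profile2_def[abs_def] by (intro continuous_intros) auto
  ultimately show ?thesis by (simp add: has_deriv2_def)
qed

text \<open>Four times the left-hand side is the radial Laplacian, so the charge that generates this
  potential is continuous and supported in the unit disc. Matching the logarithm to second order at
  1 is what makes it continuous.\<close>

lemma log_profile_lap: "log_profile1 v + v * log_profile2 v = max 0 (1 - v)"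
  by (auto simp: log_profile1_def log_profile2_def max_def power2_eq_square field_simps)

lemma log_profile_le_0: "v \<le> 1 \<Longrightarrow> log_profile v \<le> 0"
proof -
  assume v: "v \<le> 1"
  define d where "d = v - 1"
  have "log_profile v = (d - d\<^sup>2 / 2) / 2" using v by (simp add: log_profile_def d_def)
  moreover have "d \<le> 0" using v by (simp add: d_def)
  then have "d \<le> d\<^sup>2 / 2" by (rule order_trans) simp
  ultimately show ?thesis by simp
qed

lemma log_profile_ge_ln:
  assumes v: "v > 0"
  shows "log_profile v \<ge> ln v / 2"
proof (cases "v \<le> 1")
  case True
  have "log_profile 1 - ln 1 / 2 \<le> log_profile v - ln v / 2"
  proof (rule DERIV_nonpos_imp_nonincreasing[OF True, of "\<lambda>v. log_profile v - ln v / 2"])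
    fix x :: real assume x: "v \<le> x" "x \<le> 1"
    have "((\<lambda>v. log_profile v - ln v / 2) has_real_derivative log_profile1 x - 1 / (2 * x)) (at x)"
      using has_deriv2_log_profile x v by (auto simp: has_deriv2_def field_simps intro!: derivative_eq_intros)
    moreover have "log_profile1 x - 1 / (2 * x) = - ((x - 1)\<^sup>2) / (2 * x)"
      using x v by (simp add: log_profile1_def field_simps power2_eq_square)
    then have "log_profile1 x - 1 / (2 * x) \<le> 0" using x v by simp
    ultimately show "\<exists>y. ((\<lambda>v. log_profile v - ln v / 2) has_real_derivative y) (at x) \<and> y \<le> 0" by blast
  qed
  then show ?thesis by (simp add: log_profile_def)
qed (simp add: log_profile_def)

text \<open>The coercion to \<open>ennreal\<close> truncates, so this is the positive part of the
  logarithm. The value at 0 is set by hand, because division by 0 would give a finite one.\<close>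

definition log_ker :: "real \<Rightarrow> real \<Rightarrow> ennreal" where
  "log_ker T x = (if x = 0 then \<infinity> else ennreal (ln (T / \<bar>x\<bar>)))"

lemma log_ker_measurable [measurable]: "log_ker T \<in> borel_measurable borel"
  unfolding log_ker_def[abs_def] by measurable

lemma log_ker_antimono: "\<bar>x\<bar> \<le> \<bar>y\<bar> \<Longrightarrow> T > 0 \<Longrightarrow> log_ker T y \<le> log_ker T x"
  unfolding log_ker_def by (auto intro!: ennreal_leI divide_left_mono)

text \<open>Separates a constant, worth m ln(T/m) on a set of measure m, from a singular part whose
  integral over the whole line is at most 2m. Together they bound the integral over any such set,
  wherever it lies.\<close>

lemma log_ker_split: "0 < m \<Longrightarrow> m \<le> T \<Longrightarrow> log_ker T x \<le> ennreal (ln (T / m)) + log_ker m x"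
proof -
  assume m: "0 < m" "m \<le> T"
  have l0: "ln (T / m) \<ge> 0" using m by simp
  show ?thesis
  proof (cases "x = 0 \<or> \<bar>x\<bar> > m")
    case True
    then show ?thesis
    proof
      assume "\<bar>x\<bar> > m"
      then have "ln (T / \<bar>x\<bar>) \<le> ln (T / m)" using m by (intro ln_mono divide_left_mono) auto
      then have "log_ker T x \<le> ennreal (ln (T / m)) + 0" using \<open>\<bar>x\<bar> > m\<close> m by (auto simp: log_ker_def intro: ennreal_leI)
      also have "\<dots> \<le> ennreal (ln (T / m)) + log_ker m x" by (intro add_left_mono) simp
      finally show ?thesis .
    qed (simp add: log_ker_def)
  next
    case False
    then have "ln (T / \<bar>x\<bar>) = ln (T / m) + ln (m / \<bar>x\<bar>)" "ln (m / \<bar>x\<bar>) \<ge> 0" using m by (auto simp: ln_div)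
    then show ?thesis using False l0 by (simp add: log_ker_def)
  qed
qed

text \<open>On an interval away from 0 an antiderivative is \<open>x * ln (m / x) + x\<close>; Fatou
  lets the left end tend to 0, and the two halves of the line contribute equally.\<close>

lemma nn_integral_log_ker:
  assumes m: "m > 0"
  shows "(\<integral>\<^sup>+ x. log_ker m (x - b) \<partial>lborel) \<le> ennreal (2 * m)"
proof -
  have pos: "(\<integral>\<^sup>+ x. indicator {0<..} x * log_ker m x \<partial>lborel) \<le> ennreal m"
  proof -
    let ?f = "\<lambda>n x. ennreal (ln (m / x)) * indicator {m / real (n + 2)..m} x"
    have le: "(\<integral>\<^sup>+ x. ?f n x \<partial>lborel) \<le> ennreal m" for n :: nat
    proof -
      define a where "a = m / real (n + 2)"
      have a: "a > 0" "a \<le> m" using m by (auto simp: a_def divide_simps mult_le_cancel_left1)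
      have "(\<integral>\<^sup>+ x. ?f n x \<partial>lborel) = ennreal ((m * ln (m / m) + m) - (a * ln (m / a) + a))"
        unfolding a_def[symmetric]
      proof (rule nn_integral_FTC_Icc[where F="\<lambda>x. x * ln (m / x) + x"])
        fix x assume "x \<in> {a..m}"
        then have x: "x > 0" "x \<le> m" using a by auto
        show "((\<lambda>x. x * ln (m / x) + x) has_real_derivative ln (m / x)) (at x)"
          using m x by (auto intro!: derivative_eq_intros simp: field_simps)
        show "0 \<le> ln (m / x)" using x by simp
      qed (use a in auto)
      also have "\<dots> \<le> ennreal m"
      proof (rule ennreal_leI)
        have "a * ln (m / a) \<ge> 0" using a by (intro mult_nonneg_nonneg) auto
        then show "m * ln (m / m) + m - (a * ln (m / a) + a) \<le> m" using a(1) m by (simp add: add_increasing)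
      qed
      finally show ?thesis .
    qed
    have "(\<integral>\<^sup>+ x. indicator {0<..} x * log_ker m x \<partial>lborel) \<le> (\<integral>\<^sup>+ x. liminf (\<lambda>n. ?f n x) \<partial>lborel)"
    proof (rule nn_integral_mono)
      fix x :: real
      show "indicator {0<..} x * log_ker m x \<le> liminf (\<lambda>n. ?f n x)"
      proof (cases "x > 0 \<and> x \<le> m")
        case True
        obtain n0 :: nat where n0: "m / x < real n0" using reals_Archimedean2 by blast
        have "\<forall>\<^sub>F n in sequentially. log_ker m x \<le> ?f n x"
        proof (rule eventually_sequentiallyI[of n0])
          fix n assume "n0 \<le> n"
          then have "m / x < real (n + 2)" using n0 by simp
          then have "m / real (n + 2) \<le> x" using True by (simp add: field_simps)
          then show "log_ker m x \<le> ?f n x" using True by (simp add: log_ker_def)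
        qed
        then show ?thesis using True by (simp add: Liminf_bounded)
      next
        case False
        then have "indicator {0<..} x * log_ker m x = 0" using m by (auto simp: log_ker_def indicator_def ennreal_eq_0_iff)
        then show ?thesis by (simp only: zero_le)
      qed
    qed
    also have "\<dots> \<le> liminf (\<lambda>n. \<integral>\<^sup>+ x. ?f n x \<partial>lborel)" by (rule nn_integral_liminf) measurable
    also have "\<dots> \<le> liminf (\<lambda>n. ennreal m)" by (intro Liminf_mono always_eventually allI le)
    finally show ?thesis by (simp add: Liminf_const)
  qed
  have "(\<integral>\<^sup>+ x. log_ker m (x - b) \<partial>lborel) = (\<integral>\<^sup>+ x. log_ker m x \<partial>lborel)"
    using nn_integral_shift[of "log_ker m" "- b"] by simp
  also have "\<dots> = (\<integral>\<^sup>+ x. indicator {0<..} x * log_ker m x + indicator {0<..} (- x) * log_ker m (- x) \<partial>lborel)"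
  proof (rule nn_integral_cong_AE)
    show "AE x in lborel. log_ker m x = indicator {0<..} x * log_ker m x + indicator {0<..} (- x) * log_ker m (- x)"
      using AE_lborel_singleton[of 0] by eventually_elim (auto simp: indicator_def log_ker_def)
  qed
  also have "\<dots> = (\<integral>\<^sup>+ x. indicator {0<..} x * log_ker m x \<partial>lborel) + (\<integral>\<^sup>+ x. indicator {0<..} (- x) * log_ker m (- x) \<partial>lborel)"
    by (rule nn_integral_add) measurable
  also have "(\<integral>\<^sup>+ x. indicator {0<..} (- x) * log_ker m (- x) \<partial>lborel) = (\<integral>\<^sup>+ x. indicator {0<..} x * log_ker m x \<partial>lborel)"
    using nn_integral_real_affine[of "\<lambda>x. indicator {0<..} x * log_ker m x" "-1" 0] by simp
  also have "(\<integral>\<^sup>+ x. indicator {0<..} x * log_ker m x \<partial>lborel) + (\<integral>\<^sup>+ x. indicator {0<..} x * log_ker m x \<partial>lborel)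
     \<le> ennreal m + ennreal m" by (intro add_mono pos)
  also have "\<dots> = ennreal (2 * m)" using m by (simp flip: ennreal_plus)
  finally show ?thesis .
qed

section \<open>The Riesz potential and exceptional sets\<close>

context ring_scale
begin

text \<open>The Laplacian in \<open>w\<close> of \<open>log_profile (sqd z w / r\<^sup>2)\<close>: a
  charge spread over the disc of radius \<open>r\<close> about \<open>z\<close>.\<close>

definition bump :: "real \<Rightarrow> complex \<Rightarrow> complex \<Rightarrow> real" where
  "bump r z w = 4 / r\<^sup>2 * max 0 (1 - sqd z w / r\<^sup>2)"

lemma bump_cont: "continuous_on UNIV (bump r z)"
  unfolding bump_def[abs_def] sqd_def
  by (cases "r = 0") (auto intro!: continuous_intros)

lemma bump_nonneg: "bump r z w \<ge> 0"
  by (simp add: bump_def)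

lemma bump_bound: "bump r z w \<le> 4 / r\<^sup>2"
  unfolding bump_def by (intro mult_left_le) (auto simp: sqd_def)

lemma bump_far: "r > 0 \<Longrightarrow> cmod (w - z) \<ge> r \<Longrightarrow> bump r z w = 0"
proof -
  assume r: "r > 0" "cmod (w - z) \<ge> r"
  then have "r\<^sup>2 \<le> sqd z w" unfolding sqd_eq by (intro power_mono) auto
  then show ?thesis using r by (simp add: bump_def)
qed

text \<open>A square of side r/2 about \<open>z\<close> already carries this much, since
  \<open>sqd z w \<le> r\<^sup>2 / 8\<close> on it and the bump is at least
  \<open>3 / r\<^sup>2\<close>.\<close>

lemma bump_mass:
  assumes r: "r > 0"
  shows "ennreal (3 / 4) \<le> (\<integral>\<^sup>+ w. ennreal (bump r z w) \<partial>lborel)"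
proof -
  let ?Q = "cbox (z - Complex (r/4) (r/4)) (z + Complex (r/4) (r/4))"
  have "ennreal (3 / 4) = ennreal (3 / r\<^sup>2) * emeasure lborel ?Q"
    using r by (subst emeasure_lborel_cbox_eq) (auto simp: Basis_complex_def complex_eq_iff ennreal_mult[symmetric] power2_eq_square)
  also have "\<dots> = (\<integral>\<^sup>+ w. ennreal (3 / r\<^sup>2) * indicator ?Q w \<partial>lborel)"
    by (subst nn_integral_cmult_indicator) auto
  also have "\<dots> \<le> (\<integral>\<^sup>+ w. ennreal (bump r z w) \<partial>lborel)"
  proof (rule nn_integral_mono)
    fix w
    show "ennreal (3 / r\<^sup>2) * indicator ?Q w \<le> ennreal (bump r z w)"
    proof (cases "w \<in> ?Q")
      case True
      then have "Re z - r/4 \<le> Re w" "Re w \<le> Re z + r/4" "Im z - r/4 \<le> Im w" "Im w \<le> Im z + r/4"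
        by (auto simp: in_cbox_complex_iff)
      then have "\<bar>Re w - Re z\<bar> \<le> r/4" "\<bar>Im w - Im z\<bar> \<le> r/4" by linarith+
      then have "(Re w - Re z)\<^sup>2 \<le> (r/4)\<^sup>2" "(Im w - Im z)\<^sup>2 \<le> (r/4)\<^sup>2"
        using r by (metis abs_ge_zero power2_abs power_mono)+
      then have "sqd z w \<le> r\<^sup>2 / 8" by (simp add: sqd_def power_divide)
      then have "sqd z w / r\<^sup>2 \<le> 1 / 8" using r by (simp add: field_simps)
      then have "4 / r\<^sup>2 * (3 / 4) \<le> bump r z w" unfolding bump_def by (intro mult_left_mono, linarith, simp)
      then show ?thesis using True by (auto intro!: ennreal_leI)
    qed simp
  qed
  finally show ?thesis .
qed

text \<open>The test function is the potential of the charge at scale 4t minus that of the charge at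
  scale \<epsilon>. The Riesz formula turns the small average into the large one, which the integral
  of N controls, plus an integral against \<mu>.\<close>

lemma bump_riesz:
  assumes \<epsilon>: "0 < \<epsilon>" "\<epsilon> \<le> 4 * t" and z: "cmod z \<le> 4 * t"
  shows "(\<integral>\<^sup>+ w. N w * ennreal (bump \<epsilon> z w) \<partial>lborel)
    \<le> ennreal (C * t / 4) + ennreal (2 * pi) * (\<integral>\<^sup>+ w. log_ker (4 * t) (cmod (w - z)) \<partial>\<mu>)"
proof -
  define T where "T = 4 * t"
  have T: "T > 0" "\<epsilon> \<le> T" using t \<epsilon> by (auto simp: T_def)
  \<comment> \<open>Beyond its own radius r each profile is half the logarithm of s minus ln r;
    subtracting \<open>ln \<epsilon> - ln T\<close> makes \<open>G\<close> vanish beyond radius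
    \<open>T\<close>.\<close>
  define G where "G = (\<lambda>s. 1 * log_profile (1 / T\<^sup>2 * s) - 1 * log_profile (1 / \<epsilon>\<^sup>2 * s) - (ln \<epsilon> - ln T))"
  define G1 where "G1 = (\<lambda>s. 1 * (1 / T\<^sup>2) * log_profile1 (1 / T\<^sup>2 * s) - 1 * (1 / \<epsilon>\<^sup>2) * log_profile1 (1 / \<epsilon>\<^sup>2 * s) - 0)"
  define G2 where "G2 = (\<lambda>s. 1 * (1 / T\<^sup>2)\<^sup>2 * log_profile2 (1 / T\<^sup>2 * s) - 1 * (1 / \<epsilon>\<^sup>2)\<^sup>2 * log_profile2 (1 / \<epsilon>\<^sup>2 * s) - 0)"
  have G: "has_deriv2 G G1 G2"
    unfolding G_def G1_def G2_def by (intro has_deriv2_diff has_deriv2_scale has_deriv2_log_profile has_deriv2_const)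
  have lgpT: "log_profile (1 / r\<^sup>2 * s) = ln s / 2 - ln r" if "s \<ge> r\<^sup>2" "r > 0" for r s
  proof -
    have "1 / r\<^sup>2 * s \<ge> 1" "s > 0" using that by (auto simp: field_simps intro: less_le_trans[of _ "r\<^sup>2"])
    moreover have "ln (s / r\<^sup>2) = ln s - 2 * ln r"
      using that \<open>s > 0\<close> by (simp add: ln_div ln_realpow)
    ultimately show ?thesis by (cases "s = r\<^sup>2") (auto simp: log_profile_def ln_realpow diff_divide_distrib)
  qed
  have Gfar: "G s = 0" if "s \<ge> T\<^sup>2" for s
  proof -
    have "\<epsilon>\<^sup>2 \<le> T\<^sup>2" using T \<epsilon> by (intro power_mono) auto
    then have "s \<ge> \<epsilon>\<^sup>2" using that by linarith
    then show ?thesis using lgpT[OF that T(1)] lgpT[of \<epsilon> s] \<epsilon> by (simp add: G_def)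
  qed
  have Gle: "ennreal (G (sqd z w)) \<le> log_ker T (cmod (w - z))" for w
  proof (cases "w = z")
    case False
    then have s: "sqd z w > 0" by (simp add: sqd_eq)
    have lns: "ln (sqd z w) / 2 = ln (cmod (w - z))" using False by (simp add: sqd_eq ln_realpow)
    show ?thesis
    proof (cases "sqd z w \<ge> T\<^sup>2")
      case False
      then have "log_profile (1 / T\<^sup>2 * sqd z w) \<le> 0" using T by (intro log_profile_le_0) (simp add: field_simps)
      \<comment> \<open>The profile lies above the logarithm, so subtracting it at scale \<epsilon>
        only lowers \<open>G\<close>; the bound by the logarithmic kernel is thus uniform in
        \<epsilon>.\<close>
      moreover have "log_profile (1 / \<epsilon>\<^sup>2 * sqd z w) \<ge> ln (sqd z w) / 2 - ln \<epsilon>"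
        using log_profile_ge_ln[of "1 / \<epsilon>\<^sup>2 * sqd z w"] s \<epsilon> by (simp add: ln_div ln_realpow diff_divide_distrib)
      ultimately have "G (sqd z w) \<le> ln T - ln (cmod (w - z))" unfolding G_def lns[symmetric] by linarith
      also have "\<dots> = ln (T / \<bar>cmod (w - z)\<bar>)" using T \<open>w \<noteq> z\<close> by (simp add: ln_div)
      finally show ?thesis using \<open>w \<noteq> z\<close> by (simp add: log_ker_def ennreal_leI)
    qed (simp add: Gfar)
  qed (simp add: log_ker_def)
  define \<phi> where "\<phi> = (\<lambda>w. (\<lambda>_. 1) (Re w) * G (sqd z w))"
  have tf: "test_fun \<phi>" "\<And>w. laplacian \<phi> w = 0 * G (sqd z w) + 4 * (Re w - Re z) * 0 * G1 (sqd z w)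
       + 1 * (4 * G1 (sqd z w) + 4 * sqd z w * G2 (sqd z w))"
    unfolding \<phi>_def by (rule test_fun_radial[OF has_deriv2_const G], erule Gfar)+
  have lap: "laplacian \<phi> w = bump T z w - bump \<epsilon> z w" for w
  proof -
    have b: "bump r z w = 4 / r\<^sup>2 * (log_profile1 (1 / r\<^sup>2 * sqd z w) + (1 / r\<^sup>2 * sqd z w) * log_profile2 (1 / r\<^sup>2 * sqd z w))" for r
      unfolding log_profile_lap bump_def by simp
    show ?thesis unfolding tf(2) b G1_def G2_def by (simp add: algebra_simps power2_eq_square)
  qed
  have out: "cmod (w - z) \<ge> T" if "cmod w > 16 * t" for w
    using that z norm_triangle_ineq2[of w z] t unfolding T_def by linarith
  have far\<phi>: "\<phi> w = 0" if "cmod w > 16 * t" for w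
  proof -
    have "T\<^sup>2 \<le> sqd z w" unfolding sqd_eq using out[OF that] T by (intro power_mono) auto
    then show ?thesis by (simp add: \<phi>_def Gfar)
  qed
  have farT: "bump T z w = 0" "bump \<epsilon> z w = 0" if "cmod w > 16 * t" for w
    using out[OF that] bump_far T \<epsilon> by auto
  note iT = integrable_n_cont[OF bump_cont farT(1)] and i\<epsilon> = integrable_n_cont[OF bump_cont farT(2)]
  have \<phi>c: "continuous_on UNIV \<phi>" unfolding \<phi>_def sqd_def
    by (intro continuous_intros continuous_on_compose2[OF has_deriv2_continuous(1)[OF G]]) auto
  note i\<phi> = mass_integral(1)[OF \<phi>c far\<phi>]
  have "- 2 * pi * (\<integral>w. \<phi> w \<partial>\<mu>) = (\<integral>w. n w * bump T z w - n w * bump \<epsilon> z w \<partial>lborel)"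
    using riesz_n[OF tf(1) far\<phi>] unfolding lap by (simp add: right_diff_distrib)
  also have "\<dots> = (\<integral>w. n w * bump T z w \<partial>lborel) - (\<integral>w. n w * bump \<epsilon> z w \<partial>lborel)"
    by (rule Bochner_Integration.integral_diff[OF iT i\<epsilon>])
  finally have eq: "(\<integral>w. n w * bump \<epsilon> z w \<partial>lborel) = (\<integral>w. n w * bump T z w \<partial>lborel) + 2 * pi * (\<integral>w. \<phi> w \<partial>\<mu>)"
    by simp
  have "\<bar>\<integral>w. n w * bump T z w \<partial>lborel\<bar> \<le> 4 / T\<^sup>2 * (C * t ^ 3)"
    by (rule integral_n(2)[OF borel_measurable_continuous_onI[OF bump_cont]])
      (use bump_nonneg bump_bound farT in auto)
  also have "\<dots> = C * t / 4" using t by (simp add: T_def power2_eq_square power3_eq_cube)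
  finally have A: "(\<integral>w. n w * bump T z w \<partial>lborel) \<le> C * t / 4" by simp
  have "(\<integral>w. \<phi> w \<partial>\<mu>) \<le> (\<integral>w. max 0 (\<phi> w) \<partial>\<mu>)"
    using i\<phi> by (intro integral_mono) auto
  then have "ennreal (\<integral>w. \<phi> w \<partial>\<mu>) \<le> ennreal (\<integral>w. max 0 (\<phi> w) \<partial>\<mu>)" by (rule ennreal_leI)
  also have "\<dots> = (\<integral>\<^sup>+ w. ennreal (max 0 (\<phi> w)) \<partial>\<mu>)"
    using i\<phi> by (intro nn_integral_eq_integral[symmetric]) auto
  also have "\<dots> \<le> (\<integral>\<^sup>+ w. log_ker T (cmod (w - z)) \<partial>\<mu>)"
    using Gle by (intro nn_integral_mono) (simp add: \<phi>_def max_def)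
  finally have P: "ennreal (\<integral>w. \<phi> w \<partial>\<mu>) \<le> (\<integral>\<^sup>+ w. log_ker T (cmod (w - z)) \<partial>\<mu>)" .
  have "(\<integral>\<^sup>+ w. N w * ennreal (bump \<epsilon> z w) \<partial>lborel) = (\<integral>\<^sup>+ w. ennreal (n w * bump \<epsilon> z w) \<partial>lborel)"
    by (subst nn_integral_n) (use farT n_nonneg bump_nonneg in \<open>auto simp: ennreal_mult\<close>)
  also have "\<dots> = ennreal (\<integral>w. n w * bump \<epsilon> z w \<partial>lborel)"
    by (rule nn_integral_eq_integral[OF i\<epsilon>]) (use n_nonneg bump_nonneg in auto)
  also have "\<dots> \<le> ennreal (C * t / 4 + 2 * pi * max 0 (\<integral>w. \<phi> w \<partial>\<mu>))"
    unfolding eq using A by (intro ennreal_leI add_mono mult_left_mono) auto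
  also have "\<dots> = ennreal (C * t / 4) + ennreal (2 * pi) * ennreal (max 0 (\<integral>w. \<phi> w \<partial>\<mu>))"
    using C t by (simp add: ennreal_mult[symmetric] ennreal_plus[symmetric] del: ennreal_plus)
  also have "\<dots> \<le> ennreal (C * t / 4) + ennreal (2 * pi) * (\<integral>\<^sup>+ w. log_ker T (cmod (w - z)) \<partial>\<mu>)"
    using P by (intro add_left_mono mult_left_mono) (auto simp: max_def)
  finally show ?thesis by (simp add: T_def)
qed

text \<open>The averages of N over small discs are controlled by the logarithmic potential of the Riesz measure;
  by lower semicontinuity so is N itself.\<close>

lemma pointwise_potential_bound:
  assumes z: "cmod z \<le> 4 * t"
  shows "N z \<le> ennreal (C * t) + ennreal 16 * (\<integral>\<^sup>+ w. log_ker (4 * t) (cmod (w - z)) \<partial>\<mu>)"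
proof (rule dense_le)
  fix a assume a: "a < N z"
  let ?X = "ennreal (C * t / 4) + ennreal (2 * pi) * (\<integral>\<^sup>+ w. log_ker (4 * t) (cmod (w - z)) \<partial>\<mu>)"
  have "open {w. a < N w}" using lsc_defect[OF sh] by (simp add: lsc_def)
  then obtain \<delta> where \<delta>: "\<delta> > 0" "ball z \<delta> \<subseteq> {w. a < N w}" using a openE by blast
  define \<epsilon> where "\<epsilon> = min \<delta> (4 * t)"
  have \<epsilon>: "0 < \<epsilon>" "\<epsilon> \<le> 4 * t" using \<delta> t by (auto simp: \<epsilon>_def)
  have [measurable]: "bump \<epsilon> z \<in> borel_measurable borel" by (rule borel_measurable_continuous_onI[OF bump_cont])
  have "a * ennreal (3 / 4) \<le> a * (\<integral>\<^sup>+ w. ennreal (bump \<epsilon> z w) \<partial>lborel)"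
    by (intro mult_left_mono bump_mass \<epsilon>) simp
  also have "\<dots> = (\<integral>\<^sup>+ w. a * ennreal (bump \<epsilon> z w) \<partial>lborel)" by (rule nn_integral_cmult[symmetric]) measurable
  also have "\<dots> \<le> (\<integral>\<^sup>+ w. N w * ennreal (bump \<epsilon> z w) \<partial>lborel)"
  proof (rule nn_integral_mono)
    fix w
    show "a * ennreal (bump \<epsilon> z w) \<le> N w * ennreal (bump \<epsilon> z w)"
    proof (cases "cmod (w - z) \<ge> \<epsilon>")
      case False
      then have "w \<in> ball z \<delta>" by (simp add: \<epsilon>_def dist_norm norm_minus_commute)
      then have "a \<le> N w" using \<delta> by (auto intro: less_imp_le)
      then show ?thesis by (intro mult_right_mono) auto
    qed (simp add: bump_far \<epsilon>)
  qed
  also have "\<dots> \<le> ?X" by (rule bump_riesz[OF \<epsilon> z])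
  finally have *: "a * ennreal (3 / 4) \<le> ?X" .
  \<comment> \<open>The factor 4/3 undoes the lower bound for the mass of the bump, and
    \<open>2 * pi * (4 / 3)\<close> is below 16.\<close>
  have "a = a * ennreal (3 / 4) * ennreal (4 / 3)" by (simp add: mult.assoc ennreal_mult[symmetric])
  also have "\<dots> \<le> ?X * ennreal (4 / 3)" by (intro mult_right_mono *) simp
  also have "\<dots> = ennreal (C * t / 4 * (4 / 3)) + ennreal (2 * pi * (4 / 3)) * (\<integral>\<^sup>+ w. log_ker (4 * t) (cmod (w - z)) \<partial>\<mu>)"
    using C t by (simp only: distrib_right ennreal_mult'' zero_le_divide_iff zero_le_numeral simp_thms) (simp add: mult_ac)
  also have "\<dots> \<le> ennreal (C * t) + ennreal 16 * (\<integral>\<^sup>+ w. log_ker (4 * t) (cmod (w - z)) \<partial>\<mu>)"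
    using C t pi_less_4 by (intro add_mono mult_right_mono ennreal_leI) auto
  finally show "a \<le> ennreal (C * t) + ennreal 16 * (\<integral>\<^sup>+ w. log_ker (4 * t) (cmod (w - z)) \<partial>\<mu>)" .
qed

text \<open>The pointwise potential bound is integrated over \<open>F\<close> and the order of
  integration exchanged. For each \<open>w\<close> the kernel integrates to at most m ln(T/m) + 2m,
  and the mass contributes C t. The constant is 33 = 1 + 16 * 2.\<close>

lemma exceptional_bound:
  assumes F [measurable]: "F \<in> sets borel" and sub: "F \<subseteq> {-4 * t..4 * t}"
    and m: "emeasure lborel F = ennreal m" "0 < m" "m \<le> 4 * t"
  shows "(\<integral>\<^sup>+ y. indicator F y * N (Complex 0 y) \<partial>lborel) \<le> ennreal (33 * C * t * m * (1 + ln (4 * t / m)))"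
proof -
  have t0: "t > 0" using t by simp
  define T where "T = 4 * t"
  have l0: "ln (T / m) \<ge> 0" using m by (simp add: T_def)
  let ?K = "\<lambda>y w. log_ker T (cmod (w - Complex 0 y))"
  \<comment> \<open>Points beyond radius 16t are farther than 4t from the segment carrying
    \<open>F\<close>, so the kernel vanishes and only mass in the controlled disc counts.\<close>
  have cut: "?K y w \<le> indicator (cball 0 (16 * t)) w * ?K y w" if "y \<in> F" for y w
  proof (cases "w \<in> cball 0 (16 * t)")
    case False
    have "cmod (Complex 0 y) \<le> 4 * t" using that sub by (auto simp: cmod_def abs_le_iff)
    then have "cmod (w - Complex 0 y) > T"
      using False norm_triangle_ineq2[of w "Complex 0 y"] t0 by (simp add: T_def)
    then have "T / cmod (w - Complex 0 y) \<le> 1" "T / cmod (w - Complex 0 y) > 0" using t0 by (auto simp: T_def divide_simps)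
    then have "ln (T / cmod (w - Complex 0 y)) \<le> 0" by simp
    then have "?K y w = 0" using \<open>cmod (w - Complex 0 y) > T\<close> t0 by (auto simp: log_ker_def T_def ennreal_neg)
    then show ?thesis by simp
  qed simp
  have sf: "sigma_finite_measure \<mu>"
  proof
    show "\<exists>A. countable A \<and> A \<subseteq> sets \<mu> \<and> \<Union> A = space \<mu> \<and> (\<forall>a\<in>A. emeasure \<mu> a \<noteq> \<infinity>)"
    proof (intro exI[of _ "range (\<lambda>n::nat. cball (0::complex) n)"] conjI ballI)
      have "\<Union> (range (\<lambda>n::nat. cball (0::complex) n)) = UNIV"
        using real_arch_simple by (auto simp: dist_norm)
      then show "\<Union> (range (\<lambda>n::nat. cball (0::complex) n)) = space \<mu>"
        using sets_eq_imp_space_eq[OF sets_\<mu>] by simp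
      fix a assume "a \<in> range (\<lambda>n::nat. cball (0::complex) n)"
      then show "emeasure \<mu> a \<noteq> \<infinity>" using riesz by (auto simp: riesz_measure_def less_top)
    qed (auto simp: sets_\<mu>)
  qed
  interpret P: pair_sigma_finite lborel \<mu> using sf by (simp add: pair_sigma_finite_def sigma_finite_lborel)
  have meas: "(\<lambda>(y, w). indicator F y * (indicator (cball 0 (16 * t)) w * ?K y w)) \<in> borel_measurable (lborel \<Otimes>\<^sub>M \<mu>)"
    by measurable
  have inner: "(\<integral>\<^sup>+ y. indicator F y * ?K y w \<partial>lborel) \<le> ennreal (m * ln (T / m) + 2 * m)" for w
  proof -
    have "(\<integral>\<^sup>+ y. indicator F y * ?K y w \<partial>lborel)
       \<le> (\<integral>\<^sup>+ y. ennreal (ln (T / m)) * indicator F y + log_ker m (y - Im w) \<partial>lborel)"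
    proof (rule nn_integral_mono)
      fix y
      have "?K y w \<le> log_ker T (y - Im w)"
        using abs_Im_le_cmod[of "w - Complex 0 y"] t0 by (intro log_ker_antimono) (auto simp: T_def abs_minus_commute)
      also have "\<dots> \<le> ennreal (ln (T / m)) + log_ker m (y - Im w)"
        by (rule log_ker_split) (use m in \<open>auto simp: T_def\<close>)
      finally show "indicator F y * ?K y w \<le> ennreal (ln (T / m)) * indicator F y + log_ker m (y - Im w)"
        by (auto simp: indicator_def)
    qed
    also have "\<dots> = ennreal (ln (T / m)) * ennreal m + (\<integral>\<^sup>+ y. log_ker m (y - Im w) \<partial>lborel)"
      by (subst nn_integral_add) (auto simp: nn_integral_cmult_indicator m)
    also have "\<dots> \<le> ennreal (ln (T / m)) * ennreal m + ennreal (2 * m)"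
      by (intro add_left_mono nn_integral_log_ker m)
    also have "\<dots> = ennreal (m * ln (T / m) + 2 * m)" using l0 m by (simp add: ennreal_mult[symmetric] mult.commute)
    finally show ?thesis .
  qed
  have pot: "(\<integral>\<^sup>+ y. indicator F y * (\<integral>\<^sup>+ w. ?K y w \<partial>\<mu>) \<partial>lborel) \<le> ennreal (m * ln (T / m) + 2 * m) * ennreal (C * t)"
  proof -
    have "(\<integral>\<^sup>+ y. indicator F y * (\<integral>\<^sup>+ w. ?K y w \<partial>\<mu>) \<partial>lborel)
      \<le> (\<integral>\<^sup>+ y. (\<integral>\<^sup>+ w. indicator F y * (indicator (cball 0 (16 * t)) w * ?K y w) \<partial>\<mu>) \<partial>lborel)"
    proof (rule nn_integral_mono)
      fix y
      show "indicator F y * (\<integral>\<^sup>+ w. ?K y w \<partial>\<mu>) \<le> (\<integral>\<^sup>+ w. indicator F y * (indicator (cball 0 (16 * t)) w * ?K y w) \<partial>\<mu>)"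
      proof (cases "y \<in> F")
        case True
        then show ?thesis using cut[OF True] by (auto intro!: nn_integral_mono)
      qed simp
    qed
    also have "\<dots> = (\<integral>\<^sup>+ w. (\<integral>\<^sup>+ y. indicator F y * (indicator (cball 0 (16 * t)) w * ?K y w) \<partial>lborel) \<partial>\<mu>)"
      using P.Fubini[OF meas] by simp
    also have "\<dots> = (\<integral>\<^sup>+ w. indicator (cball 0 (16 * t)) w * (\<integral>\<^sup>+ y. indicator F y * ?K y w \<partial>lborel) \<partial>\<mu>)"
      by (intro nn_integral_cong) (auto simp: indicator_def)
    also have "\<dots> \<le> (\<integral>\<^sup>+ w. ennreal (m * ln (T / m) + 2 * m) * indicator (cball 0 (16 * t)) w \<partial>\<mu>)"
    proof (rule nn_integral_mono)
      fix w
      show "indicator (cball 0 (16 * t)) w * (\<integral>\<^sup>+ y. indicator F y * ?K y w \<partial>lborel)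
        \<le> ennreal (m * ln (T / m) + 2 * m) * indicator (cball 0 (16 * t)) w"
        using inner[of w] by (cases "w \<in> cball 0 (16 * t)") auto
    qed
    also have "\<dots> = ennreal (m * ln (T / m) + 2 * m) * emeasure \<mu> (cball 0 (16 * t))"
      by (rule nn_integral_cmult_indicator) (simp add: sets_\<mu>)
    also have "\<dots> \<le> ennreal (m * ln (T / m) + 2 * m) * ennreal (C * t)"
      by (intro mult_left_mono mass) simp
    finally show ?thesis .
  qed
  have "(\<integral>\<^sup>+ y. indicator F y * N (Complex 0 y) \<partial>lborel)
    \<le> (\<integral>\<^sup>+ y. ennreal (C * t) * indicator F y + ennreal 16 * (indicator F y * (\<integral>\<^sup>+ w. ?K y w \<partial>\<mu>)) \<partial>lborel)"
  proof (rule nn_integral_mono)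
    fix y
    show "indicator F y * N (Complex 0 y) \<le> ennreal (C * t) * indicator F y + ennreal 16 * (indicator F y * (\<integral>\<^sup>+ w. ?K y w \<partial>\<mu>))"
    proof (cases "y \<in> F")
      case True
      then have "cmod (Complex 0 y) \<le> 4 * t" using sub by (auto simp: cmod_def abs_le_iff)
      then show ?thesis using pointwise_potential_bound[of "Complex 0 y"] True by (simp add: T_def)
    qed simp
  qed
  also have "\<dots> = ennreal (C * t) * ennreal m + ennreal 16 * (\<integral>\<^sup>+ y. indicator F y * (\<integral>\<^sup>+ w. ?K y w \<partial>\<mu>) \<partial>lborel)"
  proof -
    have [measurable]: "(\<lambda>y. \<integral>\<^sup>+ w. ?K y w \<partial>\<mu>) \<in> borel_measurable lborel"
      by (rule P.M2.borel_measurable_nn_integral) measurable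
    show ?thesis by (subst nn_integral_add, measurable, subst nn_integral_cmult, measurable, simp add: nn_integral_cmult_indicator m)
  qed
  also have "\<dots> \<le> ennreal (C * t) * ennreal m + ennreal 16 * (ennreal (m * ln (T / m) + 2 * m) * ennreal (C * t))"
    by (intro add_left_mono mult_left_mono pot) simp
  also have "\<dots> = ennreal (C * t * m + 16 * ((m * ln (T / m) + 2 * m) * (C * t)))"
  proof -
    have p: "m * ln (T / m) + 2 * m \<ge> 0" "C * t \<ge> 0" using C t m l0 by auto
    show ?thesis
      using p m by (subst ennreal_plus) (auto simp only: ennreal_mult mult_nonneg_nonneg zero_le_numeral less_imp_le)
  qed
  also have "\<dots> \<le> ennreal (33 * C * t * m * (1 + ln (4 * t / m)))"
  proof (rule ennreal_leI)
    have "C * t * m * ln (T / m) \<ge> 0" "C * t * m \<ge> 0" using C t m l0 by (auto intro!: mult_nonneg_nonneg)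
    then show "C * t * m + 16 * ((m * ln (T / m) + 2 * m) * (C * t)) \<le> 33 * C * t * m * (1 + ln (4 * t / m))"
      by (simp only: T_def[symmetric]) (simp add: algebra_simps)
  qed
  finally show ?thesis .
qed

end


section \<open>Comparison on a ring\<close>

text \<open>The hypothesis bounds only the sum of the values at iy and -iy, so the comparison on the
  axis must be made in pairs.\<close>

lemma nn_integral_fold:
  fixes g :: "real \<Rightarrow> ennreal"
  assumes [measurable]: "g \<in> borel_measurable borel"
  shows "(\<integral>\<^sup>+ y. g y \<partial>lborel) = (\<integral>\<^sup>+ y. indicator {0<..} y * (g y + g (- y)) \<partial>lborel)"
proof -
  have "(\<integral>\<^sup>+ y. g y \<partial>lborel) = (\<integral>\<^sup>+ y. indicator {0<..} y * g y + indicator {0<..} (- y) * g y \<partial>lborel)"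
  proof (rule nn_integral_cong_AE)
    show "AE y in lborel. g y = indicator {0<..} y * g y + indicator {0<..} (- y) * g y"
      using AE_lborel_singleton[of 0] by eventually_elim (auto simp: indicator_def)
  qed
  also have "\<dots> = (\<integral>\<^sup>+ y. indicator {0<..} y * g y \<partial>lborel) + (\<integral>\<^sup>+ y. indicator {0<..} (- y) * g y \<partial>lborel)"
    by (rule nn_integral_add) measurable
  also have "(\<integral>\<^sup>+ y. indicator {0<..} (- y) * g y \<partial>lborel) = (\<integral>\<^sup>+ y. indicator {0<..} y * g (- y) \<partial>lborel)"
    using nn_integral_real_affine[of "\<lambda>y. indicator {0<..} (- y) * g y" "-1" 0] by simp
  also have "(\<integral>\<^sup>+ y. indicator {0<..} y * g y \<partial>lborel) + (\<integral>\<^sup>+ y. indicator {0<..} y * g (- y) \<partial>lborel)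
     = (\<integral>\<^sup>+ y. indicator {0<..} y * (g y + g (- y)) \<partial>lborel)"
    unfolding distrib_left by (rule nn_integral_add[symmetric]) measurable
  finally show ?thesis .
qed

text \<open>All four values are subtracted from the same level, which therefore cancels. If some q
  is infinite or some u is \<open>-\<infinity>\<close>, the right-hand side is infinite; otherwise
  the inequality forces all terms to be finite.\<close>

lemma defect_pair_le:
  assumes A: "u1 \<le> ereal A" "u2 \<le> ereal A" "c1 \<le> ereal A" "c2 \<le> ereal A" and q0: "q1 \<ge> 0" "q2 \<ge> 0"
    and le: "u1 + u2 \<le> c1 + c2 + q1 + q2"
  shows "e2ennreal (ereal A - c1) + e2ennreal (ereal A - c2)
    \<le> e2ennreal (ereal A - u1) + e2ennreal (ereal A - u2) + e2ennreal (q1 + q2)"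
proof (cases "q1 = \<infinity> \<or> q2 = \<infinity> \<or> u1 = -\<infinity> \<or> u2 = -\<infinity>")
  case True
  then have "e2ennreal (q1 + q2) = \<infinity> \<or> e2ennreal (ereal A - u1) = \<infinity> \<or> e2ennreal (ereal A - u2) = \<infinity>"
    using q0 by auto
  then show ?thesis by auto
next
  case False
  obtain x1 x2 y1 y2 where r: "u1 = ereal x1" "u2 = ereal x2" "q1 = ereal y1" "q2 = ereal y2"
    using False A q0 by (cases u1; cases u2; cases q1; cases q2) auto
  have "c1 \<noteq> -\<infinity>" "c2 \<noteq> -\<infinity>" using le A unfolding r by (cases c1; cases c2; auto)+
  then obtain z1 z2 where z: "c1 = ereal z1" "c2 = ereal z2" using A by (cases c1; cases c2) auto
  have "x1 \<le> A" "x2 \<le> A" "z1 \<le> A" "z2 \<le> A" "y1 \<ge> 0" "y2 \<ge> 0" "x1 + x2 \<le> z1 + z2 + y1 + y2"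
    using A q0 le unfolding r z by auto
  then show ?thesis unfolding r z by (simp add: ennreal_plus[symmetric] ennreal_leI del: ennreal_plus)
qed

lemma (in subharmonic_scale) circle_mean_le:
  assumes "cball z \<bar>r\<bar> \<subseteq> cball 0 (20 * t)"
  shows "circle_mean u z r \<le> ereal (B * t)"
proof -
  note [measurable] = subharmonic_borel[OF sh]
  let ?A = "B * t"
  have A0: "?A \<ge> 0" using B t by simp
  have "u (z + of_real r * cis \<theta>) \<le> ereal ?A" for \<theta>
    using assms by (intro above) (auto simp: subset_iff dist_norm norm_mult)
  then have "(\<integral>\<^sup>+ \<theta>. indicator {0..2*pi} \<theta> * e2ennreal (u (z + of_real r * cis \<theta>)) \<partial>lborel)
     \<le> (\<integral>\<^sup>+ \<theta>. ennreal ?A * indicator {0..2*pi} \<theta> \<partial>lborel)"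
    using e2ennreal_mono[of _ "ereal ?A"] by (intro nn_integral_mono) (auto simp: indicator_def)
  also have "\<dots> = ennreal (?A * (2 * pi))" using A0 by (simp add: nn_integral_cmult_indicator ennreal_mult)
  finally have "enn2ereal (\<integral>\<^sup>+ \<theta>. indicator {0..2*pi} \<theta> * e2ennreal (u (z + of_real r * cis \<theta>)) \<partial>lborel)
     \<le> ereal (?A * (2 * pi))" using A0 by (simp add: less_eq_ennreal.rep_eq)
  then have "enn2ereal (\<integral>\<^sup>+ \<theta>. indicator {0..2*pi} \<theta> * e2ennreal (u (z + of_real r * cis \<theta>)) \<partial>lborel)
     - enn2ereal (\<integral>\<^sup>+ \<theta>. indicator {0..2*pi} \<theta> * e2ennreal (- u (z + of_real r * cis \<theta>)) \<partial>lborel) \<le> ereal (?A * (2 * pi))"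
    by (rule order_trans[rotated]) (simp add: ereal_diff_le_self)
  then have "circle_mean u z r \<le> ereal (1 / (2 * pi)) * ereal (?A * (2 * pi))"
    unfolding circle_mean_def by (rule ereal_mult_left_mono) simp
  then show ?thesis by simp
qed

text \<open>It is approximated by integrals of nonnegative functions. For a negative value, \<rho>
  is chosen so that the error is half of its absolute value.\<close>

lemma (in ring_side) ring_defect_nonneg: "ring_defect \<ge> 0"
proof (rule ccontr)
  assume neg: "\<not> ring_defect \<ge> 0"
  define K where "K = 11000 * ring_const * C / t"
  have K: "K > 0" using ring_const_pos C t by (simp add: K_def)
  define \<rho> where "\<rho> = - ring_defect / (2 * K)"
  have \<rho>: "\<rho> > 0" using neg K by (simp add: \<rho>_def divide_neg_pos)
  have "0 \<le> (\<integral>z. n z * (fs2 \<rho> (Re z) * ring_wt t (2 * t) (sqd 0 z)) \<partial>lborel)"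
    using t by (intro integral_nonneg_AE AE_I2 mult_nonneg_nonneg n_nonneg fs2_nonneg \<rho> ring_wt_nonneg) auto
  also have "\<dots> \<le> ring_defect + 11000 * ring_const * C * \<rho> / t"
    using ring_identity[OF \<rho>, of t "2 * t"] t by (simp add: ring_defect_def)
  also have "\<dots> = ring_defect + K * \<rho>" by (simp add: K_def)
  also have "\<dots> = ring_defect / 2" using K by (simp add: \<rho>_def)
  finally show False using neg by simp
qed

text \<open>Level, constant, scale and mollifier are shared; the half-planes \<open>s'\<close> for M
  and \<open>s\<close> for u may differ.\<close>

locale ring_pair = mu: ring_side M \<mu> B C t k \<kappa> f f1 s' + nu: ring_side u \<nu> B C t k \<kappa> f f1 s
  for M u :: "complex \<Rightarrow> ereal" and \<mu> \<nu> :: "complex measure" and B C t :: real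
    and k :: "complex \<Rightarrow> real" and \<kappa> f f1 :: "real \<Rightarrow> real" and s' s :: real
begin

text \<open>Lower bound for M, hypothesis and upper bound for u are chained under the integral. On
  \<open>E\<close>, where the hypothesis says nothing, the circle mean of the defect of M is at most
  N, whose integral is charged to \<open>c\<close>.\<close>

lemma ring_comparison:
  fixes q :: "real \<Rightarrow> real" and q0 :: "real \<Rightarrow> ereal"
  assumes q_cont: "continuous_on UNIV q" and \<rho>: "\<rho> > 0"
    and q: "\<And>y. t \<le> \<bar>y\<bar> \<Longrightarrow> \<bar>y\<bar> \<le> 4 * t \<Longrightarrow> 0 \<le> q y \<and> q y \<le> \<rho> \<and> q y \<le> \<bar>y\<bar>"
    and q0: "\<And>y. q0 y \<ge> 0" and q0m: "q0 \<in> borel_measurable lebesgue"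
    and E: "E \<in> sets lebesgue"
    and ineq: "\<And>y. t \<le> y \<Longrightarrow> y \<le> 4 * t \<Longrightarrow> y \<notin> E \<Longrightarrow>
       u (Complex 0 y) + u (Complex 0 (- y)) \<le> circle_mean M (Complex 0 y) (q y) + circle_mean M (Complex 0 (- y)) (q (- y)) + q0 y + q0 (- y)"
    and c: "(\<integral>\<^sup>+ y. indicator {t..4 * t} y * e2ennreal (q0 y + q0 (- y)) * ennreal (ring_wt t (2 * t) (y\<^sup>2)) \<partial>lebesgue)
      + (\<integral>\<^sup>+ y. indicator (E \<inter> {t..4 * t}) y * (mu.N (Complex 0 y) + mu.N (Complex 0 (- y))) * ennreal (ring_wt t (2 * t) (y\<^sup>2)) \<partial>lebesgue) \<le> ennreal c" "c \<ge> 0"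
  shows "mu.ring_defect - mu.shift_const * \<rho> / t \<le> nu.ring_defect + c"
proof -
  let ?R = "\<lambda>y. ennreal (ring_wt t (2 * t) (y\<^sup>2))"
  have t0: "t > 0" using mu.t by simp
  have R0: "?R y = 0" if "\<not> (t \<le> \<bar>y\<bar> \<and> \<bar>y\<bar> \<le> 4 * t)" for y
  proof (cases "\<bar>y\<bar> < t")
    case True
    then have "y\<^sup>2 \<le> t\<^sup>2" using t0 by (subst power2_le_iff_abs_le) auto
    then show ?thesis using ring_wt_inner(1)[of t "2 * t" "y\<^sup>2"] t0 by simp
  next
    case False
    then have "4 * t \<le> \<bar>y\<bar>" using that by auto
    then have "(4 * t)\<^sup>2 \<le> \<bar>y\<bar>\<^sup>2" using t0 by (intro power_mono) auto
    then show ?thesis using ring_wt_outer(1)[of t "2 * t" "y\<^sup>2"] t0 by (simp add: power2_eq_square)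
  qed
  have [measurable]: "ring_wt t (2 * t) \<in> borel_measurable borel"
    by (rule borel_measurable_continuous_onI[OF has_deriv2_continuous(1)[OF has_deriv2_ring_wt]])
  have [measurable]: "q \<in> borel_measurable borel" by (rule borel_measurable_continuous_onI[OF q_cont])
  have ball: "cball (Complex 0 y) \<bar>q y\<bar> \<subseteq> cball 0 (20 * t)" if "t \<le> \<bar>y\<bar>" "\<bar>y\<bar> \<le> 4 * t" for y
    using q[OF that] that by (intro cball_subset_cball_iff[THEN iffD2] disjI1) (simp add: dist_norm cmod_def)
  have iyb: "cmod (Complex 0 y) \<le> 20 * t" if "\<bar>y\<bar> \<le> 4 * t" for y
    using that t0 by (simp add: cmod_def)
  \<comment> \<open>The integrand as an integral depending on the parameter \<open>y\<close>, which
    makes it Borel measurable; on the ring it agrees with the expression in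
    \<open>circle_mean\<close>.\<close>
  define h where "h = (\<lambda>y. cavg mu.N (Complex 0 y) (of_real (q y)) * ?R y)"
  have h: "e2ennreal (ereal (B * t) - circle_mean M (Complex 0 y) (q y)) * ?R y = h y" for y
  proof (cases "t \<le> \<bar>y\<bar> \<and> \<bar>y\<bar> \<le> 4 * t")
    case True
    have "cavg mu.N (Complex 0 y) (of_real (q y)) = e2ennreal (ereal (B * t) - circle_mean M (Complex 0 y) (q y))"
      using ball[of y] True mu.B t0 by (intro cavg_defect[OF mu.sh] mu.above) (auto simp: subset_iff)
    then show ?thesis by (simp add: h_def)
  qed (simp add: h_def R0)
  have cavgN: "cavg mu.N (Complex 0 y) (of_real (q y)) \<le> mu.N (Complex 0 y)" if y: "t \<le> \<bar>y\<bar>" "\<bar>y\<bar> \<le> 4 * t" for y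
  proof (cases "q y = 0")
    case False
    have "supermean_on (cball 0 (20 * t)) mu.N"
      by (rule supermean_defect[OF mu.sh]) (use mu.B t0 mu.above in auto)
    then show ?thesis using ball[OF y] q[OF y] False unfolding supermean_on_def by auto
  qed (simp add: cavg_0)
  have hm [measurable]: "h \<in> borel_measurable borel" unfolding h_def cavg_def by measurable
  define U where "U = (\<lambda>y. nu.N (Complex 0 y) * ?R y)"
  have Um [measurable]: "U \<in> borel_measurable borel" unfolding U_def by measurable
  define P where "P = (\<lambda>y. indicator {t..4 * t} y * e2ennreal (q0 y + q0 (- y)) * ?R y)"
  define X where "X = (\<lambda>y. indicator (E \<inter> {t..4 * t}) y * (mu.N (Complex 0 y) + mu.N (Complex 0 (- y))) * ?R y)"
  \<comment> \<open>The data \<open>q0\<close> and \<open>E\<close> are only Lebesgue measurable, so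
    the comparison takes place in the completion, where integrals keep their values.\<close>
  have toL: "g \<in> borel_measurable borel \<Longrightarrow> g \<in> borel_measurable lebesgue" for g :: "real \<Rightarrow> ennreal"
    by (rule measurable_completion) simp
  have refl: "(\<lambda>y. q0 (- y)) \<in> borel_measurable lebesgue"
  proof -
    have "(\<lambda>y::real. - y) \<in> lebesgue \<rightarrow>\<^sub>M lebesgue"
      using lebesgue_affine_measurable[of "\<lambda>_::real. -1" 0] by simp
    then show ?thesis using measurable_compose q0m by blast
  qed
  have Pm: "P \<in> borel_measurable lebesgue"
  proof -
    have 1: "?R \<in> borel_measurable lebesgue" by (rule toL) measurable
    have 2: "indicator {t..4*t} \<in> borel_measurable lebesgue" by (rule borel_measurable_indicator) simp
    show ?thesis unfolding P_def
      using borel_measurable_times_ennreal[OF borel_measurable_times_ennreal[OF 2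
         measurable_compose[OF borel_measurable_ereal_add[OF q0m refl] measurable_e2ennreal]] 1] .
  qed
  have Xm: "X \<in> borel_measurable lebesgue"
  proof -
    have 1: "(\<lambda>y. (mu.N (Complex 0 y) + mu.N (Complex 0 (- y))) * ?R y) \<in> borel_measurable lebesgue" by (rule toL) measurable
    have 2: "indicator (E \<inter> {t..4*t}) \<in> borel_measurable lebesgue" using E by (intro borel_measurable_indicator sets.Int) auto
    show ?thesis unfolding X_def mult.assoc by (rule borel_measurable_times_ennreal[OF 2 1])
  qed
  let ?I = "\<lambda>y. indicator {0<..} y :: ennreal"
  have pt: "?I y * (h y + h (- y)) \<le> ?I y * (U y + U (- y)) + P y + X y" for y
  proof (cases "t \<le> y \<and> y \<le> 4 * t")
    case False
    then have "y > 0 \<Longrightarrow> ?R y = 0 \<and> ?R (- y) = 0" using R0[of y] R0[of "- y"] by auto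
    then have "?I y * (h y + h (- y)) = 0" by (cases "y > 0") (auto simp: h_def)
    then show ?thesis by (simp only: zero_le)
  next
    case True
    then have y: "y > 0" "t \<le> \<bar>y\<bar>" "\<bar>y\<bar> \<le> 4 * t" "t \<le> \<bar>- y\<bar>" "\<bar>- y\<bar> \<le> 4 * t" using t0 by auto
    show ?thesis
    proof (cases "y \<in> E")
      case yE: True
      have "h y + h (- y) \<le> X y"
        using cavgN[OF y(2,3)] cavgN[OF y(4,5)] yE True
        by (simp add: h_def X_def distrib_right add_mono mult_right_mono)
      then show ?thesis using y(1) by (simp add: add_increasing)
    next
      case False
      have "e2ennreal (ereal (B * t) - circle_mean M (Complex 0 y) (q y)) + e2ennreal (ereal (B * t) - circle_mean M (Complex 0 (- y)) (q (- y)))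
        \<le> nu.N (Complex 0 y) + nu.N (Complex 0 (- y)) + e2ennreal (q0 y + q0 (- y))"
        unfolding defect_def
        by (rule defect_pair_le[OF nu.above nu.above mu.circle_mean_le mu.circle_mean_le q0 q0 ineq])
          (use iyb[OF y(3)] iyb[OF y(5)] ball[OF y(2,3)] ball[OF y(4,5)] True False in auto)
      then have "(e2ennreal (ereal (B * t) - circle_mean M (Complex 0 y) (q y)) + e2ennreal (ereal (B * t) - circle_mean M (Complex 0 (- y)) (q (- y)))) * ?R y
        \<le> (nu.N (Complex 0 y) + nu.N (Complex 0 (- y)) + e2ennreal (q0 y + q0 (- y))) * ?R y" by (rule mult_right_mono) simp
      moreover have "?R (- y) = ?R y" by simp
      ultimately have "h y + h (- y) \<le> U y + U (- y) + P y"
        using h[of y] h[of "- y"] True by (simp add: distrib_right U_def P_def)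
      then show ?thesis using y(1) by (simp add: add_increasing2)
    qed
  qed
  have "ennreal (mu.ring_defect - mu.shift_const * \<rho> / t) \<le> (\<integral>\<^sup>+ y. h y \<partial>lborel)"
    using mu.axis_lower[OF \<rho>, of q] q by (simp add: h)
  also have "\<dots> = (\<integral>\<^sup>+ y. ?I y * (h y + h (- y)) \<partial>lborel)" by (rule nn_integral_fold[OF hm])
  also have "\<dots> = (\<integral>\<^sup>+ y. ?I y * (h y + h (- y)) \<partial>lebesgue)" by (simp add: nn_integral_completion)
  also have "\<dots> \<le> (\<integral>\<^sup>+ y. ?I y * (U y + U (- y)) + P y + X y \<partial>lebesgue)" by (intro nn_integral_mono pt)
  also have "\<dots> = (\<integral>\<^sup>+ y. ?I y * (U y + U (- y)) \<partial>lebesgue) + (\<integral>\<^sup>+ y. P y \<partial>lebesgue) + (\<integral>\<^sup>+ y. X y \<partial>lebesgue)"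
  proof -
    have "(\<lambda>y. ?I y * (U y + U (- y))) \<in> borel_measurable lebesgue" by (rule toL) measurable
    then show ?thesis using Pm Xm by (simp add: nn_integral_add)
  qed
  also have "\<dots> \<le> (\<integral>\<^sup>+ y. ?I y * (U y + U (- y)) \<partial>lebesgue) + ennreal c"
    using c(1) unfolding P_def X_def by (simp add: add.assoc add_left_mono)
  also have "(\<integral>\<^sup>+ y. ?I y * (U y + U (- y)) \<partial>lebesgue) = (\<integral>\<^sup>+ y. U y \<partial>lborel)"
    by (simp add: nn_integral_completion nn_integral_fold[OF Um])
  also have "(\<integral>\<^sup>+ y. U y \<partial>lborel) + ennreal c \<le> ennreal nu.ring_defect + ennreal c"
    unfolding U_def by (intro add_right_mono nu.axis_upper)
  also have "\<dots> = ennreal (nu.ring_defect + c)" using nu.ring_defect_nonneg c(2) by simp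
  finally have "ennreal (mu.ring_defect - mu.shift_const * \<rho> / t) \<le> ennreal (nu.ring_defect + c)" .
  moreover have "nu.ring_defect + c \<ge> 0" using nu.ring_defect_nonneg c(2) by simp
  ultimately show ?thesis using ennreal_le_iff by blast
qed

end


section \<open>The exceptional set function and the integrals over J-windows\<close>

lemma qE_nonneg:
  assumes E: "E \<in> sets lebesgue"
  shows "qE E x \<ge> 0"
proof -
  define m where "m = measure lebesgue (E \<inter> {0..\<bar>x\<bar>})"
  have "m \<le> measure lebesgue {0..\<bar>x\<bar>}"
    unfolding m_def by (rule measure_mono_fmeasurable) (use E in auto)
  then have le: "m \<le> \<bar>x\<bar>" by simp
  show ?thesis
  proof (cases "m = 0")
    case False
    then have m: "m > 0" by (simp add: m_def zero_less_measure_iff)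
    then have "\<bar>x\<bar> / m \<ge> 1" using le by simp
    then have "exp 1 * \<bar>x\<bar> / m \<ge> exp 1 * 1" unfolding times_divide_eq_right[symmetric] by (intro mult_left_mono) auto
    then have "exp 1 * \<bar>x\<bar> / m \<ge> 1" using exp_ge_add_one_self[of 1] by linarith
    then have "m * ln (exp 1 * \<bar>x\<bar> / m) \<ge> 0" using m by (intro mult_nonneg_nonneg ln_ge_zero) auto
    then show ?thesis by (simp add: qE_def Let_def m_def[symmetric])
  qed (simp add: qE_def Let_def m_def[symmetric])
qed

text \<open>The function m (1 + ln(x/m)) increases for m up to x; the proof uses this in the form
  ln(M/m) \<le> M/m - 1.\<close>

lemma qE_lower:
  assumes E: "E \<in> sets lebesgue" and t: "t > 0" and x: "4 * t \<le> x"
    and m: "m = measure lebesgue (E \<inter> {t..4 * t})" "m > 0"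
  shows "m * (1 + ln (4 * t / m)) \<le> qE E x"
proof -
  define M where "M = measure lebesgue (E \<inter> {0..\<bar>x\<bar>})"
  have fin: "E \<inter> {0..\<bar>x\<bar>} \<in> lmeasurable" "E \<inter> {t..4 * t} \<in> lmeasurable"
    using E by (auto intro!: bounded_set_imp_lmeasurable simp: bounded_Int)
  have mM: "m \<le> M"
    unfolding m M_def by (rule measure_mono_fmeasurable) (use fin t x in auto)
  have "M \<le> measure lebesgue {0..\<bar>x\<bar>}"
    unfolding M_def by (rule measure_mono_fmeasurable) (use fin in auto)
  then have Mx: "M \<le> x" using t x by simp
  have M0: "M > 0" using mM m(2) by simp
  have x0: "x > 0" using t x by simp
  define L where "L = ln (x / M)"
  have L: "L \<ge> 0" using Mx M0 by (simp add: L_def)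
  have "ln (4 * t / m) \<le> ln (x / m)" using t x m(2) by (simp add: divide_right_mono)
  also have "ln (x / m) = L + ln (M / m)" using x0 M0 m(2) by (simp add: L_def ln_div)
  also have "ln (M / m) \<le> M / m - 1" using M0 m(2) by (intro ln_le_minus_one) auto
  finally have "m * (1 + ln (4 * t / m)) \<le> m * (1 + L + (M / m - 1))" using m(2) by (intro mult_left_mono) auto
  also have "\<dots> = M + m * L" using m(2) by (simp add: algebra_simps)
  also have "\<dots> \<le> M + M * L" using mM L by (intro add_left_mono mult_right_mono)
  also have "\<dots> = M * ln (exp 1 * x / M)"
  proof -
    have "ln (exp 1 * x / M) = ln (exp 1 :: real) + ln (x / M)"
      using x0 M0 by (subst ln_mult_pos[symmetric]) auto
    then show ?thesis by (simp add: L_def algebra_simps)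
  qed
  also have "\<dots> = qE E x" unfolding qE_def Let_def M_def[symmetric] using M0 x0 by simp
  finally show ?thesis .
qed

text \<open>Lets the bound for Borel exceptional sets apply to a Lebesgue measurable one, at no cost
  in measure.\<close>

lemma lebesgue_borel_cover:
  assumes "S \<in> sets lebesgue" "S \<subseteq> {a..b::real}"
  obtains F where "F \<in> sets borel" "S \<subseteq> F" "F \<subseteq> {a..b}" "emeasure lborel F = emeasure lebesgue S"
proof -
  from assms(1) obtain A N N' where A: "S = A \<union> N" "N \<subseteq> N'" "N' \<in> null_sets lborel" "A \<in> sets lborel"
    by (rule sets_completionE)
  define F where "F = (A \<union> N') \<inter> {a..b}"
  have Fb: "F \<in> sets borel" using A(3,4) by (auto simp: F_def null_sets_def)
  have "emeasure lborel F \<le> emeasure lborel (A \<union> N')"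
    by (rule emeasure_mono) (use A in \<open>auto simp: F_def null_sets_def\<close>)
  also have "\<dots> = emeasure lborel A" using A by (intro emeasure_Un_null_set) auto
  also have "\<dots> = emeasure lebesgue A" using A(4) by simp
  also have "\<dots> \<le> emeasure lebesgue S" by (rule emeasure_mono) (use A assms in auto)
  finally have "emeasure lborel F \<le> emeasure lebesgue S" .
  moreover have "emeasure lebesgue S \<le> emeasure lebesgue F"
    by (rule emeasure_mono) (use A assms Fb in \<open>auto simp: F_def\<close>)
  then have "emeasure lebesgue S \<le> emeasure lborel F" using Fb by simp
  ultimately show thesis using A assms Fb by (intro that[of F]) (auto simp: F_def)
qed

text \<open>\<open>2 * pi\<close> times \<open>J_R\<close>, with values in
  \<open>ennreal\<close>.\<close>

definition J_int :: "(real \<Rightarrow> ereal) \<Rightarrow> real \<Rightarrow> real \<Rightarrow> ennreal" where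
  "J_int v a b = (\<integral>\<^sup>+ x. indicator {a..b} x * e2ennreal ((v x + v (- x)) / ereal (x\<^sup>2)) \<partial>lborel)"

lemma J_int_mono: "a' \<le> a \<Longrightarrow> b \<le> b' \<Longrightarrow> J_int v a b \<le> J_int v a' b'"
  unfolding J_int_def by (intro nn_integral_mono mult_right_mono) (auto simp: indicator_def)

lemma J_int_lower:
  assumes "0 < a" "a \<le> b" "c \<ge> 0" and v: "\<And>x. a \<le> x \<Longrightarrow> x \<le> b \<Longrightarrow> ereal c \<le> v x + v (- x)"
  shows "ennreal (c * (b - a) / b\<^sup>2) \<le> J_int v a b"
proof -
  have "ennreal (c * (b - a) / b\<^sup>2) = ennreal (c / b\<^sup>2) * ennreal (b - a)"
    using assms by (simp add: ennreal_mult[symmetric])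
  also have "\<dots> = (\<integral>\<^sup>+ x. ennreal (c / b\<^sup>2) * indicator {a..b} x \<partial>lborel)"
    using assms by (simp add: nn_integral_cmult_indicator)
  also have "\<dots> \<le> J_int v a b"
    unfolding J_int_def
  proof (rule nn_integral_mono)
    fix x
    show "ennreal (c / b\<^sup>2) * indicator {a..b} x \<le> indicator {a..b} x * e2ennreal ((v x + v (- x)) / ereal (x\<^sup>2))"
    proof (cases "x \<in> {a..b}")
      case True
      then have x: "0 < x" "x\<^sup>2 \<le> b\<^sup>2" using assms by (auto intro: power_mono)
      have "ennreal (c / b\<^sup>2) \<le> ennreal (c / x\<^sup>2)" using x assms by (intro ennreal_leI divide_left_mono) auto
      also have "\<dots> = e2ennreal (ereal c / ereal (x\<^sup>2))" using x by simp
      also have "\<dots> \<le> e2ennreal ((v x + v (- x)) / ereal (x\<^sup>2))"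
        using v[of x] True x by (intro e2ennreal_mono ereal_divide_right_mono) auto
      finally show ?thesis using True by simp
    qed simp
  qed
  finally show ?thesis .
qed

lemma distr_uminus_complex: "distr lborel borel uminus = (lborel :: complex measure)"
proof (rule measure_eqI)
  fix A :: "complex set" assume "A \<in> sets (distr lborel borel uminus)"
  then have [measurable]: "A \<in> sets borel" by simp
  have "emeasure (distr lborel borel uminus) A = (\<integral>\<^sup>+ z. indicator A z \<partial>distr lborel borel uminus)" by simp
  also have "\<dots> = (\<integral>\<^sup>+ z. indicator A (- 1 * z) \<partial>lborel)" by (subst nn_integral_distr) auto
  also have "\<dots> = (\<integral>\<^sup>+ z. indicator A z \<partial>lborel)" by (rule nn_integral_rotate) auto
  finally show "emeasure (distr lborel borel uminus) A = emeasure lborel A" by simp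
qed simp

section \<open>Fluxes freed from the scale\<close>

context ring_side
begin

text \<open>Almost everywhere the defect is B t minus u, so the dependence of the flux on the scale
  is confined to the first term.\<close>

lemma flux_eq:
  assumes "0 < a" "2 * a \<le> 16 * t"
  shows "flux a = B * t * (\<integral>z. flux_ker a z \<partial>lborel) - (\<integral>z. real_of_ereal (u z) * flux_ker a z \<partial>lborel)"
proof -
  have far: "flux_ker a z = 0" if "cmod z > 16 * t" for z using flux_ker_far[of a z] that assms by simp
  have [measurable]: "u \<in> borel_measurable borel" by (rule subharmonic_borel[OF sh])
  have [measurable]: "flux_ker a \<in> borel_measurable borel" by (rule borel_measurable_continuous_onI[OF flux_ker_cont])
  have i1: "integrable lborel (flux_ker a)" by (rule integrable_compact_support[OF flux_ker_cont far])
  have i2: "integrable lborel (\<lambda>z. n z * flux_ker a z)" by (rule integrable_n_cont[OF flux_ker_cont far])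
  have "(\<integral>z. real_of_ereal (u z) * flux_ker a z \<partial>lborel) = (\<integral>z. B * t * flux_ker a z - n z * flux_ker a z \<partial>lborel)"
  proof (rule integral_cong_AE)
    show "AE z in lborel. real_of_ereal (u z) * flux_ker a z = B * t * flux_ker a z - n z * flux_ker a z"
      using AE_N
    proof eventually_elim
      case (elim z)
      then show ?case using far[of z] by (cases "cmod z > 16 * t") (auto simp: left_diff_distrib)
    qed
  qed measurable
  also have "\<dots> = B * t * (\<integral>z. flux_ker a z \<partial>lborel) - flux a" unfolding flux_def using i1 i2 by simp
  finally show ?thesis by simp
qed

text \<open>The reflection of z to -z exchanges the half-planes, so the constant level contributes
  equally on both sides.\<close>

lemma flux_ker_integral: "(\<integral>z. flux_ker a z \<partial>lborel) = (\<integral>z. ring_side.flux_ker 1 a z \<partial>lborel)"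
proof (cases "s = 1")
  case False
  then have s1: "s = -1" using s by simp
  interpret r: ring_side u \<mu> B C t k \<kappa> f f1 1 by unfold_locales simp
  have "(\<integral>z. r.flux_ker a z \<partial>lborel) = (\<integral>z. r.flux_ker a z \<partial>distr lborel borel uminus)"
    by (simp add: distr_uminus_complex)
  also have "\<dots> = (\<integral>z. r.flux_ker a (- z) \<partial>lborel)"
    by (rule integral_distr) (auto intro: borel_measurable_continuous_onI[OF r.flux_ker_cont])
  also have "(\<lambda>z. r.flux_ker a (- z)) = flux_ker a"
    unfolding r.flux_ker_def[abs_def] flux_ker_def[abs_def] using s1 by (simp add: sqd_eq)
  finally show ?thesis by simp
qed simp

end

context ring_pair
begin

text \<open>The scale \<open>t\<close> does not occur. Hence the gap at the outer circle of one ring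
  is the gap at the inner circle of the next, although the defects of the two rings are taken below
  different levels.\<close>

definition gap :: "real \<Rightarrow> real" where
  "gap a = (\<integral>z. real_of_ereal (u z) * ring_side.flux_ker s a z \<partial>lborel)
     - (\<integral>z. real_of_ereal (M z) * ring_side.flux_ker s' a z \<partial>lborel)"

lemma gap_eq: "0 < a \<Longrightarrow> 2 * a \<le> 16 * t \<Longrightarrow> gap a = mu.flux a - nu.flux a"
  by (simp add: gap_def mu.flux_eq nu.flux_eq mu.flux_ker_integral nu.flux_ker_integral)

lemma gap_bound: "t / 4 \<le> a \<Longrightarrow> a \<le> 8 * t \<Longrightarrow> \<bar>gap a\<bar> \<le> 256 * ring_const * C"
  using gap_eq[of a] mu.flux_bound[of a] nu.flux_bound[of a] mu.t by simp

text \<open>On the ring the weight is at most 1/t^2. The set is covered by a Borel set and its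
  mirror image, each estimated by \<open>exceptional_bound\<close>; hence 66 = 2 * 33.\<close>

lemma exceptional_term:
  assumes E: "E \<in> sets lebesgue" and m: "m = measure lebesgue (E \<inter> {t..4 * t})"
  shows "(\<integral>\<^sup>+ y. indicator (E \<inter> {t..4 * t}) y * (mu.N (Complex 0 y) + mu.N (Complex 0 (- y))) * ennreal (ring_wt t (2 * t) (y\<^sup>2)) \<partial>lebesgue)
    \<le> ennreal (if m = 0 then 0 else 66 * C / t * (m * (1 + ln (4 * t / m))))"
proof -
  let ?S = "E \<inter> {t..4 * t}"
  have t0: "t > 0" using mu.t by simp
  have S: "?S \<in> lmeasurable"
    using E by (auto intro!: bounded_set_imp_lmeasurable simp: bounded_Int)
  obtain F where F: "F \<in> sets borel" "?S \<subseteq> F" "F \<subseteq> {t..4 * t}" "emeasure lborel F = emeasure lebesgue ?S"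
    using lebesgue_borel_cover[of ?S t "4 * t"] S by (auto simp: fmeasurable_def)
  have [measurable]: "F \<in> sets borel" by fact
  have Fm: "emeasure lborel F = ennreal m" using F(4) S m by (simp add: emeasure_eq_measure2)
  have mn: "m \<ge> 0" using m by simp
  have "ennreal m \<le> emeasure lborel {t..4 * t}" unfolding Fm[symmetric] using F by (intro emeasure_mono) auto
  then have m4: "m \<le> 4 * t" using t0 by (simp add: ennreal_le_iff2)
  define F' where "F' = {y. - y \<in> F}"
  have F'm [measurable]: "F' \<in> sets borel"
    unfolding F'_def using measurable_sets[of uminus borel borel F] by (simp add: vimage_def)
  have indF': "indicator F' y = (indicator F (- y) :: ennreal)" for y by (simp add: F'_def indicator_def)
  have refl: "(\<integral>\<^sup>+ y. g (- y) \<partial>lborel) = (\<integral>\<^sup>+ y. g y \<partial>lborel)" if "g \<in> borel_measurable borel" for g :: "real \<Rightarrow> ennreal"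
    using nn_integral_real_affine[OF that, of "-1" 0] by simp
  have "emeasure lborel F' = (\<integral>\<^sup>+ y. indicator F (- y) \<partial>lborel)"
    using nn_integral_indicator[of F' lborel] by (simp add: indF'[symmetric])
  also have "\<dots> = emeasure lborel F" by (subst refl) auto
  finally have F'e: "emeasure lborel F' = ennreal m" using Fm by simp
  have "(\<integral>\<^sup>+ y. indicator ?S y * (mu.N (Complex 0 y) + mu.N (Complex 0 (- y))) * ennreal (ring_wt t (2 * t) (y\<^sup>2)) \<partial>lebesgue)
    = (\<integral>\<^sup>+ y. indicator ?S y * (mu.N (Complex 0 y) + mu.N (Complex 0 (- y))) * ennreal (ring_wt t (2 * t) (y\<^sup>2)) \<partial>lborel)"
    by (rule nn_integral_completion)
  also have "\<dots> \<le> (\<integral>\<^sup>+ y. ennreal (1 / t\<^sup>2) * (indicator F y * mu.N (Complex 0 y) + indicator F y * mu.N (Complex 0 (- y))) \<partial>lborel)"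
  proof (rule nn_integral_mono)
    fix y
    show "indicator ?S y * (mu.N (Complex 0 y) + mu.N (Complex 0 (- y))) * ennreal (ring_wt t (2 * t) (y\<^sup>2))
      \<le> ennreal (1 / t\<^sup>2) * (indicator F y * mu.N (Complex 0 y) + indicator F y * mu.N (Complex 0 (- y)))"
    proof (cases "y \<in> ?S")
      case True
      then have y: "t \<le> y" "y \<in> F" using F by auto
      then have "t\<^sup>2 \<le> y\<^sup>2" "y\<^sup>2 > 0" using t0 by (auto intro!: power_mono)
      then have "ring_wt t (2 * t) (y\<^sup>2) \<le> 1 / y\<^sup>2" "1 / y\<^sup>2 \<le> 1 / t\<^sup>2"
        using t0 by (auto intro!: ring_wt_le divide_left_mono)
      then have "ennreal (ring_wt t (2 * t) (y\<^sup>2)) \<le> ennreal (1 / t\<^sup>2)" by (intro ennreal_leI) linarith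
      then show ?thesis using True y(2) by (simp add: mult.commute mult_right_mono)
    qed simp
  qed
  also have "\<dots> = ennreal (1 / t\<^sup>2) * ((\<integral>\<^sup>+ y. indicator F y * mu.N (Complex 0 y) \<partial>lborel) + (\<integral>\<^sup>+ y. indicator F y * mu.N (Complex 0 (- y)) \<partial>lborel))"
    by (subst nn_integral_cmult, measurable, subst nn_integral_add, measurable)
  also have "(\<integral>\<^sup>+ y. indicator F y * mu.N (Complex 0 (- y)) \<partial>lborel) = (\<integral>\<^sup>+ y. indicator F' y * mu.N (Complex 0 y) \<partial>lborel)"
    using refl[of "\<lambda>y. indicator F' y * mu.N (Complex 0 y)"] by (simp add: indF')
  finally have le: "(\<integral>\<^sup>+ y. indicator ?S y * (mu.N (Complex 0 y) + mu.N (Complex 0 (- y))) * ennreal (ring_wt t (2 * t) (y\<^sup>2)) \<partial>lebesgue)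
    \<le> ennreal (1 / t\<^sup>2) * ((\<integral>\<^sup>+ y. indicator F y * mu.N (Complex 0 y) \<partial>lborel) + (\<integral>\<^sup>+ y. indicator F' y * mu.N (Complex 0 y) \<partial>lborel))" .
  show ?thesis
  proof (cases "m = 0")
    case True
    have z: "(\<integral>\<^sup>+ y. indicator H y * g y \<partial>lborel) = 0"
      if "H \<in> sets borel" "emeasure lborel H = 0" for H :: "real set" and g :: "real \<Rightarrow> ennreal"
    proof -
      have "AE y in lborel. y \<notin> H" by (rule AE_not_in) (use that in \<open>auto simp: null_sets_def\<close>)
      then have "AE y in lborel. indicator H y * g y = 0" by eventually_elim simp
      then have "(\<integral>\<^sup>+ y. indicator H y * g y \<partial>lborel) = (\<integral>\<^sup>+ y. 0 \<partial>(lborel::real measure))" by (rule nn_integral_cong_AE)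
      then show ?thesis by simp
    qed
    show ?thesis using le z[OF F(1)] z[OF F'm] Fm F'e True by simp
  next
    case False
    then have m0: "m > 0" using mn by simp
    let ?g = "33 * C * t * m * (1 + ln (4 * t / m))"
    have g0: "?g \<ge> 0" using m0 m4 mu.C t0 by (intro mult_nonneg_nonneg) auto
    have sub: "F \<subseteq> {-4 * t..4 * t}" "F' \<subseteq> {-4 * t..4 * t}" using F(3) t0 by (force simp: F'_def)+
    note le
    also have "ennreal (1 / t\<^sup>2) * ((\<integral>\<^sup>+ y. indicator F y * mu.N (Complex 0 y) \<partial>lborel) + (\<integral>\<^sup>+ y. indicator F' y * mu.N (Complex 0 y) \<partial>lborel))
      \<le> ennreal (1 / t\<^sup>2) * (ennreal ?g + ennreal ?g)"
      by (intro mult_left_mono add_mono mu.exceptional_bound[OF F(1) sub(1) Fm m0 m4] mu.exceptional_bound[OF F'm sub(2) F'e m0 m4]) simp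
    also have "\<dots> = ennreal (1 / t\<^sup>2 * (?g + ?g))" by (subst ennreal_plus[OF g0 g0, symmetric], subst ennreal_mult[symmetric]) (use g0 in auto)
    also have "1 / t\<^sup>2 * (?g + ?g) = 66 * C / t * (m * (1 + ln (4 * t / m)))" using t0 by (simp add: field_simps power2_eq_square)
    finally show ?thesis using False by simp
  qed
qed

text \<open>In order: the smoothing error with \<rho>/t at most 1/t + 2 * 8^p j, the share of
  \<open>q0\<close>, and the exceptional set with 1056 = 66 * 16.\<close>

definition ring_step_const :: "real \<Rightarrow> real" where
  "ring_step_const p = mu.shift_const * (1 + 2 * 8 powr p) + 1 + 1056 * C"

lemma ring_step:
  fixes q :: "real \<Rightarrow> real" and q0 :: "real \<Rightarrow> ereal" and p :: real and E :: "real set"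
  defines "v \<equiv> \<lambda>x. q0 x + ereal (q x) + ereal (qE E x)"
  assumes q_cont: "continuous_on UNIV q" and qn: "\<And>y. q y \<ge> 0" and p: "p \<ge> 0"
    and qy: "\<And>y. t \<le> \<bar>y\<bar> \<Longrightarrow> q y \<le> \<bar>y\<bar>"
    and reg: "\<And>x y. t / 2 \<le> x \<Longrightarrow> x \<le> y \<Longrightarrow> (q y + q (- y)) / y powr p \<le> (q x + q (- x)) / x powr p"
    and q0: "\<And>y. q0 y \<ge> 0" and q0m: "q0 \<in> borel_measurable lebesgue"
    and E: "E \<in> sets lebesgue"
    and ineq: "\<And>y. t \<le> y \<Longrightarrow> y \<notin> E \<Longrightarrow>
       u (Complex 0 y) + u (Complex 0 (- y)) \<le> circle_mean M (Complex 0 y) (q y) + circle_mean M (Complex 0 (- y)) (q (- y)) + q0 y + q0 (- y)"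
    and j: "J_int v (t / 2) (8 * t) \<le> ennreal j" "j \<ge> 0"
  shows "2 * pi * nu.half_mass t (2 * t) \<le> 2 * pi * mu.half_mass t (2 * t) + gap t - gap (2 * t) + ring_step_const p * (j + 1 / t)"
proof -
  have t0: "t > 0" using mu.t by simp
  let ?Q = "\<lambda>y. q y + q (- y)"
  have vq: "ereal (?Q x) \<le> v x + v (- x)" for x
    using add_mono[OF add_mono[OF q0[of x] order_refl] order_refl, of "ereal (q x)"] qE_nonneg[OF E, of x] qE_nonneg[OF E, of "- x"] q0[of x] q0[of "- x"]
    unfolding v_def by (cases "q0 x"; cases "q0 (- x)") auto
  have vE: "ereal (qE E x) \<le> v x + v (- x)" for x
    using qn[of x] qn[of "- x"] qE_nonneg[OF E, of "- x"] q0[of x] q0[of "- x"]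
    unfolding v_def by (cases "q0 x"; cases "q0 (- x)") auto
  \<comment> \<open>The minimum of Q on the interval just below the ring is controlled by the
    integral of Q there; the growth condition then carries it across the ring.\<close>
  have "\<exists>x\<in>{t/2..t}. \<forall>y\<in>{t/2..t}. ?Q x \<le> ?Q y"
    by (rule continuous_attains_inf) (use t0 q_cont in \<open>auto intro!: continuous_intros continuous_on_subset[OF q_cont] continuous_on_compose2[OF q_cont]\<close>)
  then obtain x0 where x0: "t / 2 \<le> x0" "x0 \<le> t" "\<And>y. t / 2 \<le> y \<Longrightarrow> y \<le> t \<Longrightarrow> ?Q x0 \<le> ?Q y" by auto
  have Q0: "?Q x0 \<ge> 0" using qn[of x0] qn[of "- x0"] by simp
  have jpart: "c * (b - a) / b\<^sup>2 \<le> j"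
    if "t / 2 \<le> a" "a \<le> b" "b \<le> 8 * t" "c \<ge> 0" "\<And>x. a \<le> x \<Longrightarrow> x \<le> b \<Longrightarrow> ereal c \<le> v x + v (- x)" for a b c
  proof -
    have "ennreal (c * (b - a) / b\<^sup>2) \<le> J_int v a b" by (rule J_int_lower) (use that t0 in auto)
    also have "\<dots> \<le> J_int v (t / 2) (8 * t)" by (rule J_int_mono) (use that in auto)
    also have "\<dots> \<le> ennreal j" by (rule j)
    finally show ?thesis using j(2) by (simp add: ennreal_le_iff)
  qed
  have "?Q x0 * (t - t / 2) / t\<^sup>2 \<le> j"
    by (rule jpart) (use t0 Q0 x0(3) vq in \<open>auto intro: order_trans[OF _ vq]\<close>)
  moreover have "?Q x0 * (t - t / 2) / t\<^sup>2 = ?Q x0 / t / 2" using t0 by (simp add: power2_eq_square field_simps)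
  ultimately have "?Q x0 / t / 2 \<le> j" by (simp only:)
  then have Qj: "?Q x0 / t \<le> 2 * j" by (simp only: pos_divide_le_eq zero_less_numeral mult.commute)
  define \<rho> where "\<rho> = 1 + 8 powr p * ?Q x0"
  have \<rho>: "\<rho> > 0" using Q0 by (simp add: \<rho>_def add_pos_nonneg)
  have Qy: "?Q y \<le> 8 powr p * ?Q x0" if "t \<le> y" "y \<le> 4 * t" for y
  proof -
    have y0: "y > 0" "x0 > 0" using that t0 x0 by auto
    have "?Q y / y powr p \<le> ?Q x0 / x0 powr p" by (rule reg) (use x0 that in auto)
    then have "?Q y \<le> ?Q x0 * (y powr p / x0 powr p)" using y0 by (simp add: field_simps)
    also have "y powr p / x0 powr p = (y / x0) powr p" using y0 by (simp add: powr_divide)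
    \<comment> \<open>The ratio is at most 8, since \<open>y \<le> 4 * t\<close> and
      \<open>x0 \<ge> t / 2\<close>.\<close>
    also have "?Q x0 * (y / x0) powr p \<le> ?Q x0 * 8 powr p"
      using y0 that x0 p Q0 by (intro mult_left_mono powr_mono2) (auto simp: field_simps)
    finally show ?thesis by (simp add: mult.commute)
  qed
  have q\<rho>: "0 \<le> q y \<and> q y \<le> \<rho> \<and> q y \<le> \<bar>y\<bar>" if "t \<le> \<bar>y\<bar>" "\<bar>y\<bar> \<le> 4 * t" for y
    using Qy[OF that] qn[of y] qn[of "- y"] qy[OF that(1)] unfolding \<rho>_def by (cases "y \<ge> 0") auto
  define m where "m = measure lebesgue (E \<inter> {t..4 * t})"
  define g where "g = (if m = 0 then 0 else m * (1 + ln (4 * t / m)))"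
  have S: "E \<inter> {t..4 * t} \<in> lmeasurable"
    using E by (auto intro!: bounded_set_imp_lmeasurable simp: bounded_Int)
  have g0: "g \<ge> 0"
  proof -
    have "m \<le> measure lebesgue {t..4 * t}" unfolding m_def by (rule measure_mono_fmeasurable) (use S in auto)
    then have "m \<le> 4 * t" using t0 by simp
    moreover have "m \<ge> 0" by (simp add: m_def)
    ultimately show ?thesis by (cases "m = 0") (auto simp: g_def intro!: mult_nonneg_nonneg add_nonneg_nonneg)
  qed
  have gq: "g \<le> qE E x" if "4 * t \<le> x" for x
  proof (cases "m = 0")
    case False
    then have "m > 0" by (simp add: m_def zero_less_measure_iff)
    then show ?thesis using qE_lower[OF E t0 that m_def] by (simp add: g_def)
  qed (simp add: g_def qE_nonneg[OF E])
  \<comment> \<open>The exceptional set in the ring is charged to the interval from 4t to 8t, where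
    \<open>qE\<close> already sees all of it. This fixes the right end of the window, as Q fixed the
    left one.\<close>
  have "g * (8 * t - 4 * t) / (8 * t)\<^sup>2 \<le> j"
    by (rule jpart) (use t0 g0 in \<open>auto intro!: order_trans[OF _ vE] gq\<close>)
  then have gj: "g / t \<le> 16 * j" using t0 by (simp add: power2_eq_square field_simps)
  have P: "(\<integral>\<^sup>+ y. indicator {t..4 * t} y * e2ennreal (q0 y + q0 (- y)) * ennreal (ring_wt t (2 * t) (y\<^sup>2)) \<partial>lebesgue) \<le> ennreal j"
  proof -
    have "(\<integral>\<^sup>+ y. indicator {t..4 * t} y * e2ennreal (q0 y + q0 (- y)) * ennreal (ring_wt t (2 * t) (y\<^sup>2)) \<partial>lebesgue)
      = (\<integral>\<^sup>+ y. indicator {t..4 * t} y * e2ennreal (q0 y + q0 (- y)) * ennreal (ring_wt t (2 * t) (y\<^sup>2)) \<partial>lborel)"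
      by (rule nn_integral_completion)
    also have "\<dots> \<le> J_int v t (4 * t)"
      unfolding J_int_def
    proof (rule nn_integral_mono)
      fix y
      show "indicator {t..4 * t} y * e2ennreal (q0 y + q0 (- y)) * ennreal (ring_wt t (2 * t) (y\<^sup>2))
        \<le> indicator {t..4 * t} y * e2ennreal ((v y + v (- y)) / ereal (y\<^sup>2))"
      proof (cases "y \<in> {t..4 * t}")
        case True
        then have y: "y > 0" using t0 by auto
        have vq0: "q0 y + q0 (- y) \<le> v y + v (- y)"
          using qn[of y] qn[of "- y"] qE_nonneg[OF E, of y] qE_nonneg[OF E, of "- y"] q0[of y] q0[of "- y"]
          unfolding v_def by (cases "q0 y"; cases "q0 (- y)") auto
        have "e2ennreal (q0 y + q0 (- y)) * ennreal (ring_wt t (2 * t) (y\<^sup>2)) \<le> e2ennreal (q0 y + q0 (- y)) * ennreal (1 / y\<^sup>2)"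
          using y t0 by (intro mult_left_mono ennreal_leI ring_wt_le) auto
        also have "\<dots> = e2ennreal ((q0 y + q0 (- y)) / ereal (y\<^sup>2))"
          using q0[of y] q0[of "- y"] y
          by (cases "q0 y"; cases "q0 (- y)") (auto simp: ennreal_mult[symmetric] ennreal_top_mult ennreal_plus[symmetric] simp del: ennreal_plus)
        also have "\<dots> \<le> e2ennreal ((v y + v (- y)) / ereal (y\<^sup>2))"
          using y vq0 by (intro e2ennreal_mono ereal_divide_right_mono) auto
        finally show ?thesis using True by simp
      qed simp
    qed
    also have "\<dots> \<le> J_int v (t / 2) (8 * t)" by (rule J_int_mono) (use t0 in auto)
    finally show ?thesis using j(1) by simp
  qed
  have X: "(\<integral>\<^sup>+ y. indicator (E \<inter> {t..4 * t}) y * (mu.N (Complex 0 y) + mu.N (Complex 0 (- y))) * ennreal (ring_wt t (2 * t) (y\<^sup>2)) \<partial>lebesgue)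
     \<le> ennreal (1056 * C * j)"
  proof -
    have "(if m = 0 then 0 else 66 * C / t * (m * (1 + ln (4 * t / m)))) = 66 * C * (g / t)" by (simp add: g_def)
    also have "\<dots> \<le> 66 * C * (16 * j)" using gj mu.C by (intro mult_left_mono) auto
    finally have le: "(if m = 0 then 0 else 66 * C / t * (m * (1 + ln (4 * t / m)))) \<le> 1056 * C * j"
      by (simp add: mult.assoc)
    show ?thesis by (rule order_trans[OF exceptional_term[OF E m_def] ennreal_leI[OF le]])
  qed
  have "mu.ring_defect - mu.shift_const * \<rho> / t \<le> nu.ring_defect + (j + 1056 * C * j)"
  proof (rule ring_comparison[OF q_cont \<rho> q\<rho> q0 q0m E ineq])
    show "(\<integral>\<^sup>+ y. indicator {t..4 * t} y * e2ennreal (q0 y + q0 (- y)) * ennreal (ring_wt t (2 * t) (y\<^sup>2)) \<partial>lebesgue) +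
      (\<integral>\<^sup>+ y. indicator (E \<inter> {t..4 * t}) y * (mu.N (Complex 0 y) + mu.N (Complex 0 (- y))) * ennreal (ring_wt t (2 * t) (y\<^sup>2)) \<partial>lebesgue)
      \<le> ennreal (j + 1056 * C * j)"
      using add_mono[OF P X] j(2) mu.C by simp
  qed (use j(2) mu.C in auto)
  moreover have "mu.shift_const * \<rho> / t \<le> mu.shift_const * (1 / t + 2 * 8 powr p * j)"
  proof -
    have "\<rho> / t = 1 / t + 8 powr p * (?Q x0 / t)" unfolding \<rho>_def by (simp only: add_divide_distrib[of 1] times_divide_eq_right)
    also have "\<dots> \<le> 1 / t + 8 powr p * (2 * j)" using Qj by (intro add_left_mono mult_left_mono) auto
    finally have "\<rho> / t \<le> 1 / t + 2 * 8 powr p * j" by (simp add: mult.left_commute)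
    then have "mu.shift_const * (\<rho> / t) \<le> mu.shift_const * (1 / t + 2 * 8 powr p * j)"
      using mu.shift_const_pos by (intro mult_left_mono) auto
    then show ?thesis by simp
  qed
  moreover have "mu.shift_const * (1 / t + 2 * 8 powr p * j) + (j + 1056 * C * j) \<le> ring_step_const p * (j + 1 / t)"
  proof -
    have "0 \<le> mu.shift_const * j + 2 * mu.shift_const * 8 powr p * (1 / t) + (1 + 1056 * C) * (1 / t)"
      using mu.shift_const_pos j(2) t0 mu.C by (intro add_nonneg_nonneg mult_nonneg_nonneg) auto
    then show ?thesis by (simp add: ring_step_const_def algebra_simps)
  qed
  moreover have "gap t = mu.flux t - nu.flux t" "gap (2 * t) = mu.flux (2 * t) - nu.flux (2 * t)"
    using t0 by (auto intro!: gap_eq)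
  ultimately show ?thesis unfolding mu.ring_defect_def nu.ring_defect_def by simp
qed

end


section \<open>Summation over dyadic rings\<close>

text \<open>The sign selects the half-plane, so that one argument serves all four combinations of
  sides.\<close>

definition l_side :: "complex measure \<Rightarrow> real \<Rightarrow> real \<Rightarrow> real \<Rightarrow> ennreal" where
  "l_side \<mu> s r R = (\<integral>\<^sup>+ z. indicator {z. r < cmod z \<and> cmod z \<le> R \<and> s * Re z > 0} z * ennreal (Re (of_real s / z)) \<partial>\<mu>)"

lemma l_side_eq:
  "enn2ereal (l_side \<mu> 1 r R) = l_rh \<mu> r R" "enn2ereal (l_side \<mu> (-1) r R) = l_lh \<mu> r R"
  by (simp_all add: l_side_def l_rh_def l_lh_def)

context ring_side
begin

lemma Re_side: "Re (of_real s / z) = s * Re z / sqd 0 z"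
  using s by (auto simp: Re_divide sqd_def)

lemma ring_support:
  assumes "0 < a" "a \<le> b" "2 * b \<le> 16 * t" "cmod z > 16 * t"
  shows "ring_wt a b (sqd 0 z) = 0"
proof -
  have "(2 * b)\<^sup>2 \<le> (cmod z)\<^sup>2" using assms by (intro power_mono) auto
  then show ?thesis using ring_wt_outer(1)[OF assms(1,2), of "sqd 0 z"] by (simp add: sqd_eq power2_eq_square)
qed

lemma half_mass_integrable:
  assumes "0 < a" "a \<le> b" "2 * b \<le> 16 * t"
  shows "integrable \<mu> (\<lambda>z. max 0 (s * Re z) * ring_wt a b (sqd 0 z))"
proof (rule mass_integral(1))
  show "continuous_on UNIV (\<lambda>z. max 0 (s * Re z) * ring_wt a b (sqd 0 z))"
    by (intro continuous_intros continuous_Re_sqd(2)[OF has_deriv2_continuous(1)[OF has_deriv2_ring_wt]])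
qed (simp add: ring_support assms)

lemma half_mass_add:
  assumes "0 < a" "a \<le> b" "b \<le> c" "2 * c \<le> 16 * t"
  shows "half_mass a c = half_mass a b + half_mass b c"
proof -
  have "half_mass a c = (\<integral>z. max 0 (s * Re z) * ring_wt a b (sqd 0 z) + max 0 (s * Re z) * ring_wt b c (sqd 0 z) \<partial>\<mu>)"
    unfolding half_mass_def by (simp add: ring_wt_def algebra_simps)
  also have "\<dots> = half_mass a b + half_mass b c"
    unfolding half_mass_def using assms
    by (intro Bochner_Integration.integral_add half_mass_integrable) auto
  finally show ?thesis .
qed

lemma nn_half_mass:
  assumes "0 < a" "a \<le> b" "2 * b \<le> 16 * t"
  shows "ennreal (half_mass a b) = (\<integral>\<^sup>+ z. ennreal (max 0 (s * Re z) * ring_wt a b (sqd 0 z)) \<partial>\<mu>)"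
  unfolding half_mass_def
  by (rule nn_integral_eq_integral[OF half_mass_integrable[OF assms], symmetric])
    (use ring_wt_nonneg assms in \<open>auto intro!: AE_I2 mult_nonneg_nonneg\<close>)

text \<open>Sharp and smooth cutoffs differ by a factor 2 in the radii, which a logarithmic density
  does not notice.\<close>

lemma l_side_le_half_mass:
  assumes "0 < a" "a \<le> b" "2 * b \<le> 16 * t"
  shows "l_side \<mu> s (2 * a) b \<le> ennreal (half_mass a b)"
  unfolding nn_half_mass[OF assms] l_side_def
proof (rule nn_integral_mono)
  fix z
  show "indicator {z. 2 * a < cmod z \<and> cmod z \<le> b \<and> s * Re z > 0} z * ennreal (Re (of_real s / z))
    \<le> ennreal (max 0 (s * Re z) * ring_wt a b (sqd 0 z))"
  proof (cases "2 * a < cmod z \<and> cmod z \<le> b \<and> s * Re z > 0")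
    case True
    have "(2 * a)\<^sup>2 \<le> (cmod z)\<^sup>2" "(cmod z)\<^sup>2 \<le> b\<^sup>2" by (rule power_mono; use True assms(1) in simp)+
    moreover have "(2 * a)\<^sup>2 = 4 * a\<^sup>2" by (simp add: power_mult_distrib)
    ultimately have "4 * a\<^sup>2 \<le> sqd 0 z" "sqd 0 z \<le> b\<^sup>2" by (simp_all only: sqd_eq diff_zero)
    then have "ring_wt a b (sqd 0 z) = 1 / sqd 0 z" using assms by (intro ring_wt_mid)
    then show ?thesis using True by (simp add: Re_side)
  qed simp
qed

lemma half_mass_le_l_side:
  assumes "0 < a" "a \<le> b" "2 * b \<le> 16 * t"
  shows "ennreal (half_mass a b) \<le> l_side \<mu> s a (2 * b)"
  unfolding nn_half_mass[OF assms] l_side_def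
proof (rule nn_integral_mono)
  fix z
  show "ennreal (max 0 (s * Re z) * ring_wt a b (sqd 0 z))
    \<le> indicator {z. a < cmod z \<and> cmod z \<le> 2 * b \<and> s * Re z > 0} z * ennreal (Re (of_real s / z))"
  proof (cases "s * Re z > 0 \<and> ring_wt a b (sqd 0 z) \<noteq> 0")
    case True
    have "\<not> sqd 0 z \<le> a\<^sup>2" "\<not> sqd 0 z \<ge> 4 * b\<^sup>2"
      using True ring_wt_inner(1)[OF assms(1,2), of "sqd 0 z"] ring_wt_outer(1)[OF assms(1,2), of "sqd 0 z"] by auto
    then have "a\<^sup>2 < (cmod z)\<^sup>2" "(cmod z)\<^sup>2 < (2 * b)\<^sup>2" by (auto simp: sqd_eq power_mult_distrib)
    then have z: "a < cmod z" "cmod z < 2 * b"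
      using power2_less_imp_less[of a "cmod z"] power2_less_imp_less[of "cmod z" "2 * b"] assms by auto
    have "sqd 0 z > 0" unfolding sqd_eq diff_zero by (rule zero_less_power) (rule less_trans[OF assms(1) z(1)])
    then have "ring_wt a b (sqd 0 z) \<le> 1 / sqd 0 z" by (rule ring_wt_le[OF assms(1,2)])
    then have "s * Re z * ring_wt a b (sqd 0 z) \<le> s * Re z * (1 / sqd 0 z)"
      using True by (intro mult_left_mono) auto
    then have "max 0 (s * Re z) * ring_wt a b (sqd 0 z) \<le> s * Re z * (1 / sqd 0 z)" using True by simp
    then show ?thesis using True z by (simp add: Re_side ennreal_leI)
  next
    case False
    then have "max 0 (s * Re z) * ring_wt a b (sqd 0 z) = 0" by (auto simp: max_def)
    then show ?thesis by (simp only: ennreal_0 zero_le)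
  qed
qed

end

text \<open>The windows have ratio 16 = 2^4, so the indices of those containing a given point lie
  between the smallest one and that plus 4.\<close>

lemma dyadic_overlap:
  fixes x t0 :: real
  assumes "t0 > 0"
  shows "(\<Sum>k\<le>n. indicator {2 ^ k * t0 / 2..8 * (2 ^ k * t0)} x :: ennreal) \<le> 5 * indicator {t0 / 2..8 * (2 ^ n * t0)} x"
proof -
  define S where "S = {k. k \<le> n \<and> 2 ^ k * t0 / 2 \<le> x \<and> x \<le> 8 * (2 ^ k * t0)}"
  have fin: "finite S" by (simp add: S_def)
  have "(\<Sum>k\<le>n. indicator {2 ^ k * t0 / 2..8 * (2 ^ k * t0)} x :: ennreal) = (\<Sum>k\<in>S. 1)"
    by (rule sum.mono_neutral_cong_right) (auto simp: S_def indicator_def)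
  also have "\<dots> = of_nat (card S)" by simp
  finally have eq: "(\<Sum>k\<le>n. indicator {2 ^ k * t0 / 2..8 * (2 ^ k * t0)} x :: ennreal) = of_nat (card S)" .
  show ?thesis
  proof (cases "S = {}")
    case False
    define k0 where "k0 = Min S"
    have k0: "k0 \<in> S" "\<And>k. k \<in> S \<Longrightarrow> k0 \<le> k" using False fin by (auto simp: k0_def)
    have "S \<subseteq> {k0..k0 + 4}"
    proof
      fix k assume k: "k \<in> S"
      have "2 ^ k * t0 / 2 \<le> 8 * (2 ^ k0 * t0)" using k k0(1) by (auto simp: S_def)
      then have "(2::real) ^ k \<le> 2 ^ (k0 + 4)" using assms by (simp add: power_add field_simps)
      then show "k \<in> {k0..k0 + 4}" using k0(2)[OF k] by (simp del: power_add)
    qed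
    then have "card S \<le> 5" using card_mono[of "{k0..k0 + 4}" S] by simp
    then have "of_nat (card S) \<le> (of_nat 5 :: ennreal)" by (rule of_nat_mono)
    moreover have "x \<in> {t0 / 2..8 * (2 ^ n * t0)}"
    proof -
      have "(1::real) \<le> 2 ^ k0" "(2::real) ^ k0 \<le> 2 ^ n" using k0(1) by (auto simp: S_def)
      then have "1 * t0 \<le> 2 ^ k0 * t0" "2 ^ k0 * t0 \<le> 2 ^ n * t0" using assms by (auto intro!: mult_right_mono)
      then show ?thesis using k0(1) by (auto simp: S_def)
    qed
    ultimately show ?thesis by (simp add: eq)
  qed (simp add: eq)
qed

lemma J_int_dyadic_sum:
  assumes m: "(\<lambda>x. e2ennreal ((v x + v (- x)) / ereal (x\<^sup>2))) \<in> borel_measurable lebesgue" and t0: "t0 > 0"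
  shows "(\<Sum>k\<le>n. J_int v (2 ^ k * t0 / 2) (8 * (2 ^ k * t0))) \<le> 5 * J_int v (t0 / 2) (8 * (2 ^ n * t0))"
proof -
  let ?g = "\<lambda>x. e2ennreal ((v x + v (- x)) / ereal (x\<^sup>2))"
  have JL: "J_int v a b = (\<integral>\<^sup>+ x. indicator {a..b} x * ?g x \<partial>lebesgue)" for a b
    unfolding J_int_def by (rule nn_integral_completion[symmetric])
  have mm: "(\<lambda>x. indicator {a..b} x * ?g x) \<in> borel_measurable lebesgue" for a b
    by (rule borel_measurable_times_ennreal[OF borel_measurable_indicator m]) simp
  have "(\<Sum>k\<le>n. J_int v (2 ^ k * t0 / 2) (8 * (2 ^ k * t0)))
     = (\<integral>\<^sup>+ x. (\<Sum>k\<le>n. indicator {2 ^ k * t0 / 2..8 * (2 ^ k * t0)} x * ?g x) \<partial>lebesgue)"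
    unfolding JL by (rule nn_integral_sum[symmetric]) (rule mm)
  also have "\<dots> \<le> (\<integral>\<^sup>+ x. 5 * (indicator {t0 / 2..8 * (2 ^ n * t0)} x * ?g x) \<partial>lebesgue)"
  proof (rule nn_integral_mono)
    fix x
    show "(\<Sum>k\<le>n. indicator {2 ^ k * t0 / 2..8 * (2 ^ k * t0)} x * ?g x) \<le> 5 * (indicator {t0 / 2..8 * (2 ^ n * t0)} x * ?g x)"
      using mult_right_mono[OF dyadic_overlap[OF t0, where n=n and x=x], of "?g x"] by (simp only: sum_distrib_right mult.assoc[of 5] zero_le simp_thms)
  qed
  also have "\<dots> = 5 * J_int v (t0 / 2) (8 * (2 ^ n * t0))"
    unfolding JL by (rule nn_integral_cmult[OF mm])
  finally show ?thesis .
qed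

text \<open>The one-ring estimates are added: masses add up exactly, gaps telescope to two bounded
  terms, the integrals overlap at most five times, and the terms 1/t form a geometric
  series.\<close>

lemma side_comparison:
  fixes q :: "real \<Rightarrow> real" and q0 :: "real \<Rightarrow> ereal" and p :: real and E :: "real set"
  defines "v \<equiv> \<lambda>x. q0 x + ereal (q x) + ereal (qE E x)"
  assumes rp: "\<And>t. t \<ge> T \<Longrightarrow> ring_pair M u \<mu> \<nu> B C t k \<kappa> f f1 s' s" and T: "T \<ge> 1"
    and q_cont: "continuous_on UNIV q" and qn: "\<And>y. q y \<ge> 0" and p: "p \<ge> 0"
    and qy: "\<And>y. T \<le> \<bar>y\<bar> \<Longrightarrow> q y \<le> \<bar>y\<bar>"
    and reg: "\<And>x y. T / 2 \<le> x \<Longrightarrow> x \<le> y \<Longrightarrow> (q y + q (- y)) / y powr p \<le> (q x + q (- x)) / x powr p"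
    and q0: "\<And>y. q0 y \<ge> 0" and q0m: "q0 \<in> borel_measurable lebesgue"
    and vm: "(\<lambda>x. e2ennreal ((v x + v (- x)) / ereal (x\<^sup>2))) \<in> borel_measurable lebesgue"
    and E: "E \<in> sets lebesgue"
    and ineq: "\<And>y. T \<le> y \<Longrightarrow> y \<notin> E \<Longrightarrow>
       u (Complex 0 y) + u (Complex 0 (- y)) \<le> circle_mean M (Complex 0 y) (q y) + circle_mean M (Complex 0 (- y)) (q (- y)) + q0 y + q0 (- y)"
  obtains D where "D > 0" "\<And>r R. 2 * T \<le> r \<Longrightarrow> r \<le> R \<Longrightarrow>
     l_side \<nu> s r R \<le> l_side \<mu> s' (r / 2) (4 * R) + ennreal D * (1 + J_int v (r / 4) (8 * R))"
proof -
  define S where "S = ring_pair.ring_step_const C p"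
  \<comment> \<open>Two gaps of at most 256, the overlap 5, and the bound 2 for the sum of the
    reciprocals of the scales.\<close>
  define D where "D = 512 * ring_const * C + 5 * S + 2 * S"
  interpret p0: ring_pair M u \<mu> \<nu> B C T k \<kappa> f f1 s' s by (rule rp) simp
  have C: "C > 0" by (rule p0.mu.C)
  have S: "S > 0"
    unfolding S_def p0.ring_step_const_def using p0.mu.shift_const_pos C
    by (intro add_pos_pos mult_pos_pos) auto
  have D: "D > 0" unfolding D_def using ring_const_pos C S by (intro add_pos_pos mult_pos_pos) auto
  show thesis
  proof (rule that[OF D])
    fix r R assume r: "2 * T \<le> r" "r \<le> R"
    show "l_side \<nu> s r R \<le> l_side \<mu> s' (r / 2) (4 * R) + ennreal D * (1 + J_int v (r / 4) (8 * R))"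
    proof (cases "J_int v (r / 4) (8 * R) = \<infinity>")
      case True
      then show ?thesis using D by (simp add: ennreal_mult_top)
    next
      case False
      then obtain J where J: "J_int v (r / 4) (8 * R) = ennreal J" "J \<ge> 0"
        by (cases "J_int v (r / 4) (8 * R)") auto
      have r0: "r > 0" using r T by linarith
      \<comment> \<open>The least dyadic multiple of \<open>r\<close> reaching \<open>R\<close>
        overshoots it by at most a factor 2.\<close>
      have "\<exists>n. R \<le> 2 ^ n * r \<and> 2 ^ n * r \<le> 2 * R"
      proof -
        obtain n0 where "R / r < 2 ^ n0" using real_arch_pow[of 2 "R / r"] by auto
        then have ex: "R \<le> 2 ^ n0 * r" using r0 by (simp add: field_simps)
        define n where "n = (LEAST n. R \<le> 2 ^ n * r)"
        have n: "R \<le> 2 ^ n * r" unfolding n_def by (rule LeastI[of "\<lambda>n. R \<le> 2 ^ n * r", OF ex])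
        have "2 ^ n * r \<le> 2 * R"
        proof (cases n)
          case 0 then show ?thesis using r r0 by simp
        next
          case (Suc m)
          then have "\<not> R \<le> 2 ^ m * r" using not_less_Least[of m "\<lambda>n. R \<le> 2 ^ n * r"] by (simp add: n_def)
          then show ?thesis using Suc by simp
        qed
        then show ?thesis using n by blast
      qed
      then obtain n where n: "R \<le> 2 ^ n * r" "2 ^ n * r \<le> 2 * R" by blast
      \<comment> \<open>The smooth weight is exact only from twice its inner radius on, so the rings
        start at r/2.\<close>
      define t0 where "t0 = r / 2"
      define a where "a = (\<lambda>k::nat. 2 ^ k * t0)"
      have t0: "t0 \<ge> T" "t0 > 0" using r r0 by (auto simp: t0_def)
      have aSuc: "a (Suc k) = 2 * a k" for k by (simp add: a_def)
      have at0: "a k \<ge> t0" for k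
        using t0 mult_right_mono[of 1 "2 ^ k" t0] by (simp add: a_def)
      have aT: "a k \<ge> T" for k using at0[of k] t0 by linarith
      have a0: "a k > 0" for k using t0 by (simp add: a_def)
      have amono: "a k \<le> a m" if "k \<le> m" for k m
        using that t0 by (auto simp: a_def intro!: mult_right_mono)
      have an1: "a (Suc n) = 2 ^ n * r" by (simp add: a_def t0_def)
      define j where "j = (\<lambda>k. enn2real (J_int v (a k / 2) (8 * a k)))"
      have Jk: "J_int v (a k / 2) (8 * a k) = ennreal (j k)" if "k \<le> n" for k
      proof -
        have "J_int v (a k / 2) (8 * a k) \<le> J_int v (r / 4) (8 * R)"
        proof (rule J_int_mono)
          show "r / 4 \<le> a k / 2" using at0[of k] by (simp add: t0_def)
          have "8 * a k \<le> 4 * a (Suc n)" using amono[OF that] aSuc[of n] by simp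
          moreover have "a (Suc n) \<le> 2 * R" using n(2) an1 by simp
          ultimately show "8 * a k \<le> 8 * R" by linarith
        qed
        then have "J_int v (a k / 2) (8 * a k) < top" unfolding J(1) by (rule le_less_trans) simp
        then show ?thesis unfolding j_def by simp
      qed
      have "(\<Sum>k\<le>n. J_int v (a k / 2) (8 * a k)) \<le> 5 * J_int v (t0 / 2) (8 * (2 ^ n * t0))"
        unfolding a_def by (rule J_int_dyadic_sum[OF vm t0(2)])
      also have "J_int v (t0 / 2) (8 * (2 ^ n * t0)) \<le> J_int v (r / 4) (8 * R)"
        using n(2) by (intro J_int_mono) (auto simp: t0_def mult.commute)
      finally have "(\<Sum>k\<le>n. J_int v (a k / 2) (8 * a k)) \<le> 5 * ennreal J" by (simp add: J mult_left_mono)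
      also have "\<dots> = ennreal (5 * J)" using J(2) by (simp add: ennreal_mult)
      also have "(\<Sum>k\<le>n. J_int v (a k / 2) (8 * a k)) = (\<Sum>k\<le>n. ennreal (j k))" by (intro sum.cong) (auto simp: Jk)
      also have "\<dots> = ennreal (\<Sum>k\<le>n. j k)" by (rule sum_ennreal) (simp add: j_def)
      finally have jsum: "(\<Sum>k\<le>n. j k) \<le> 5 * J" using J(2) by simp
      have tsum: "(\<Sum>k\<le>m. 1 / a k) \<le> 2 - 1 / 2 ^ m" for m
      proof -
        have "1 / a k \<le> (1 / 2) ^ k" for k
        proof -
          have "2 ^ k * 1 \<le> a k" unfolding a_def using t0 T by (intro mult_left_mono) auto
          then have "1 / a k \<le> 1 / 2 ^ k" by (intro divide_left_mono) (auto intro!: mult_pos_pos a0)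
          then show ?thesis by (simp add: power_divide)
        qed
        then have "(\<Sum>k\<le>m. 1 / a k) \<le> (\<Sum>k\<le>m. (1 / 2) ^ k)" by (intro sum_mono)
        also have "\<dots> = 2 - 1 / 2 ^ m" by (induction m) (auto simp: power_divide field_simps)
        finally show ?thesis .
      qed
      have "0 < 1 / (2::real) ^ n" by simp
      then have tsum2: "(\<Sum>k\<le>n. 1 / a k) \<le> 2" using tsum[of n] by linarith
      \<comment> \<open>Half masses and gaps do not involve the scale, so facts obtained at
        different scales speak of the same quantities; the largest scale covers all rings for
        additivity.\<close>
      interpret pn: ring_pair M u \<mu> \<nu> B C "a n" k \<kappa> f f1 s' s by (rule rp[OF aT])
      have hsum: "(\<Sum>k\<le>m. pn.nu.half_mass (a k) (a (Suc k))) = pn.nu.half_mass (a 0) (a (Suc m))"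
        "(\<Sum>k\<le>m. pn.mu.half_mass (a k) (a (Suc k))) = pn.mu.half_mass (a 0) (a (Suc m))" if "m \<le> n" for m
      proof -
        have "(\<Sum>k\<le>m. pn.nu.half_mass (a k) (a (Suc k))) = pn.nu.half_mass (a 0) (a (Suc m))
          \<and> (\<Sum>k\<le>m. pn.mu.half_mass (a k) (a (Suc k))) = pn.mu.half_mass (a 0) (a (Suc m))"
          using that
        proof (induction m)
          case (Suc m)
          have b: "2 * a (Suc (Suc m)) \<le> 16 * a n"
            using amono[of "Suc m" n] Suc.prems aSuc[of "Suc m"] a0[of n] by simp
          have "pn.nu.half_mass (a 0) (a (Suc (Suc m))) = pn.nu.half_mass (a 0) (a (Suc m)) + pn.nu.half_mass (a (Suc m)) (a (Suc (Suc m)))"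
            by (rule pn.nu.half_mass_add[OF a0 amono amono b]) auto
          moreover have "pn.mu.half_mass (a 0) (a (Suc (Suc m))) = pn.mu.half_mass (a 0) (a (Suc m)) + pn.mu.half_mass (a (Suc m)) (a (Suc (Suc m)))"
            by (rule pn.mu.half_mass_add[OF a0 amono amono b]) auto
          ultimately show ?case using Suc by simp
        qed simp
        then show "(\<Sum>k\<le>m. pn.nu.half_mass (a k) (a (Suc k))) = pn.nu.half_mass (a 0) (a (Suc m))"
          "(\<Sum>k\<le>m. pn.mu.half_mass (a k) (a (Suc k))) = pn.mu.half_mass (a 0) (a (Suc m))" by blast+
      qed
      have step: "2 * pi * pn.nu.half_mass (a i) (a (Suc i)) \<le> 2 * pi * pn.mu.half_mass (a i) (a (Suc i))
          + (pn.gap (a i) - pn.gap (a (Suc i))) + S * (j i + 1 / a i)" if "i \<le> n" for i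
      proof -
        interpret pk: ring_pair M u \<mu> \<nu> B C "a i" k \<kappa> f f1 s' s by (rule rp[OF aT])
        have "2 * pi * pk.nu.half_mass (a i) (2 * a i) \<le> 2 * pi * pk.mu.half_mass (a i) (2 * a i)
          + pk.gap (a i) - pk.gap (2 * a i) + pk.ring_step_const p * (j i + 1 / a i)"
        proof (rule pk.ring_step[OF q_cont qn p _ _ q0 q0m E])
          show "q y \<le> \<bar>y\<bar>" if "a i \<le> \<bar>y\<bar>" for y using qy that aT[of i] by simp
          show "(q y + q (- y)) / y powr p \<le> (q x + q (- x)) / x powr p" if "a i / 2 \<le> x" "x \<le> y" for x y
            using reg that aT[of i] by simp
          show "u (Complex 0 y) + u (Complex 0 (- y)) \<le> circle_mean M (Complex 0 y) (q y) + circle_mean M (Complex 0 (- y)) (q (- y)) + q0 y + q0 (- y)"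
            if "a i \<le> y" "y \<notin> E" for y using ineq that aT[of i] by simp
          show "J_int (\<lambda>x. q0 x + ereal (q x) + ereal (qE E x)) (a i / 2) (8 * a i) \<le> ennreal (j i)"
            using Jk[OF that] by (simp add: v_def)
          show "0 \<le> j i" by (simp add: j_def)
        qed
        then show ?thesis by (simp add: aSuc S_def)
      qed
      have "2 * pi * pn.nu.half_mass (a 0) (a (Suc n)) = (\<Sum>k\<le>n. 2 * pi * pn.nu.half_mass (a k) (a (Suc k)))"
        by (simp only: sum_distrib_left[symmetric] hsum(1)[OF order_refl])
      also have "\<dots> \<le> (\<Sum>k\<le>n. 2 * pi * pn.mu.half_mass (a k) (a (Suc k)) + (pn.gap (a k) - pn.gap (a (Suc k))) + S * (j k + 1 / a k))"
        by (intro sum_mono step) simp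
      also have "\<dots> = 2 * pi * (\<Sum>k\<le>n. pn.mu.half_mass (a k) (a (Suc k))) + (\<Sum>k\<le>n. pn.gap (a k) - pn.gap (a (Suc k)))
         + S * ((\<Sum>k\<le>n. j k) + (\<Sum>k\<le>n. 1 / a k))"
        by (simp add: sum.distrib sum_distrib_left distrib_left)
      also have "(\<Sum>k\<le>n. pn.mu.half_mass (a k) (a (Suc k))) = pn.mu.half_mass (a 0) (a (Suc n))"
        by (rule hsum) simp
      also have "(\<Sum>k\<le>n. pn.gap (a k) - pn.gap (a (Suc k))) = pn.gap (a 0) - pn.gap (a (Suc n))"
        by (rule sum_telescope)
      finally have main: "2 * pi * pn.nu.half_mass (a 0) (a (Suc n)) \<le> 2 * pi * pn.mu.half_mass (a 0) (a (Suc n))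
         + (pn.gap (a 0) - pn.gap (a (Suc n))) + S * ((\<Sum>k\<le>n. j k) + (\<Sum>k\<le>n. 1 / a k))" .
      \<comment> \<open>The first gap is bounded at the smallest scale, the last one at the largest;
        no single scale is comparable with both radii.\<close>
      interpret pz: ring_pair M u \<mu> \<nu> B C "a 0" k \<kappa> f f1 s' s by (rule rp[OF aT])
      have g: "\<bar>pn.gap (a 0)\<bar> \<le> 256 * ring_const * C" "\<bar>pn.gap (a (Suc n))\<bar> \<le> 256 * ring_const * C"
        using pz.gap_bound[of "a 0"] pn.gap_bound[of "a (Suc n)"] aSuc[of n] a0[of 0] a0[of n] by auto
      have "S * ((\<Sum>k\<le>n. j k) + (\<Sum>k\<le>n. 1 / a k)) \<le> S * (5 * J + 2)"
        using jsum tsum2 S by (intro mult_left_mono add_mono) auto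
      then have "2 * pi * pn.nu.half_mass (a 0) (a (Suc n)) \<le> 2 * pi * pn.mu.half_mass (a 0) (a (Suc n)) + (512 * ring_const * C + S * (5 * J + 2))"
        using main g by linarith
      also have "512 * ring_const * C + S * (5 * J + 2) \<le> D * (1 + J)"
      proof -
        have "0 \<le> (512 * ring_const * C + 2 * S) * J + 5 * S"
          using ring_const_pos C S J(2) by (intro add_nonneg_nonneg mult_nonneg_nonneg) auto
        then show ?thesis by (simp add: D_def algebra_simps)
      qed
      finally have "2 * pi * pn.nu.half_mass (a 0) (a (Suc n)) \<le> 2 * pi * pn.mu.half_mass (a 0) (a (Suc n)) + D * (1 + J)" by simp
      also have "D * (1 + J) \<le> 2 * pi * (D * (1 + J))"
      proof -
        have "D * (1 + J) \<ge> 0" using D J(2) by simp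
        then have "1 * (D * (1 + J)) \<le> 2 * pi * (D * (1 + J))" using pi_gt3 by (intro mult_right_mono) auto
        then show ?thesis by simp
      qed
      finally have fin: "pn.nu.half_mass (a 0) (a (Suc n)) \<le> pn.mu.half_mass (a 0) (a (Suc n)) + D * (1 + J)"
        by (simp add: distrib_left[symmetric])
      have ab: "a 0 \<le> a (Suc n)" "2 * a (Suc n) \<le> 16 * a n" using amono[of 0 "Suc n"] aSuc[of n] a0[of n] by auto
      have "l_side \<nu> s r R \<le> l_side \<nu> s (2 * a 0) (a (Suc n))"
        unfolding l_side_def using n(1) an1
        by (intro nn_integral_mono mult_right_mono) (auto simp: indicator_def a_def t0_def)
      also have "\<dots> \<le> ennreal (pn.nu.half_mass (a 0) (a (Suc n)))" by (rule pn.nu.l_side_le_half_mass[OF a0 ab])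
      also have "\<dots> \<le> ennreal (pn.mu.half_mass (a 0) (a (Suc n)) + D * (1 + J))" by (rule ennreal_leI[OF fin])
      also have "\<dots> = ennreal (pn.mu.half_mass (a 0) (a (Suc n))) + ennreal D * (1 + ennreal J)"
        using pn.mu.half_mass_nonneg[OF a0 ab(1)] D J(2) by (simp add: ennreal_mult flip: ennreal_1 del: ennreal_1)
      also have "ennreal (pn.mu.half_mass (a 0) (a (Suc n))) \<le> l_side \<mu> s' (a 0) (2 * a (Suc n))"
        by (rule pn.mu.half_mass_le_l_side[OF a0 ab])
      also have "l_side \<mu> s' (a 0) (2 * a (Suc n)) \<le> l_side \<mu> s' (r / 2) (4 * R)"
        unfolding l_side_def using n(2) an1
        by (intro nn_integral_mono mult_right_mono) (auto simp: indicator_def a_def t0_def)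
      finally show ?thesis by (simp add: J)
    qed
  qed
qed


section \<open>Logarithmic densities\<close>

lemma ln_dens_mono:
  assumes "\<And>r R. l1 r R \<le> l2 r R"
  shows "ln_dens l1 \<le> ln_dens l2"
  unfolding ln_dens_def
proof (rule Limsup_mono)
  show "\<forall>\<^sub>F a in at_top. ereal (1 / ln a) * Limsup at_top (\<lambda>r. l1 r (a * r)) \<le> ereal (1 / ln a) * Limsup at_top (\<lambda>r. l2 r (a * r))"
    using eventually_gt_at_top[of "1::real"]
    by eventually_elim (intro ereal_mult_left_mono Limsup_mono always_eventually allI assms, simp)
qed

lemma ln_dens_lessD:
  assumes "ln_dens l < ereal b"
  shows "\<forall>\<^sub>F a in at_top. \<forall>\<^sub>F r in at_top. l r (a * r) < ereal (b * ln a)"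
proof -
  have "\<forall>\<^sub>F a in at_top. ereal (1 / ln a) * Limsup at_top (\<lambda>r. l r (a * r)) < ereal b"
    using assms unfolding ln_dens_def by (rule Limsup_lessD)
  then show ?thesis using eventually_gt_at_top[of "1::real"]
  proof eventually_elim
    case (elim a)
    then have la: "ln a > 0" by simp
    have "Limsup at_top (\<lambda>r. l r (a * r)) < ereal (b * ln a)"
      using elim(1) la by (cases "Limsup at_top (\<lambda>r. l r (a * r))") (auto simp: field_simps)
    then show ?case by (rule Limsup_lessD)
  qed
qed

text \<open>Enlarging the intervals replaces the ratio a by 8a or 32a, and ln(8a)/ln a and
  ln(32a)/ln a tend to 1; the additive constant vanishes after division by ln a.\<close>

lemma ln_dens_compare:
  assumes le: "\<And>r R. T \<le> r \<Longrightarrow> r \<le> R \<Longrightarrow> l1 r R \<le> l2 (r / 2) (4 * R) + ereal D * (1 + l3 (r / 4) (8 * R))"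
    and D: "D \<ge> 0" and l3: "ln_dens l3 = 0" "\<And>r R. l3 r R \<ge> 0" and l2: "\<And>r R. l2 r R \<ge> 0"
  shows "ln_dens l1 \<le> ln_dens l2"
proof (rule ereal_le_real)
  fix b assume b: "ln_dens l2 \<le> ereal b"
  show "ln_dens l1 \<le> ereal b"
  proof (rule ereal_le_epsilon2)
    fix e :: real assume e: "e > 0"
    \<comment> \<open>Chosen so that \<open>D * d\<close> is at most e/2; the other half of e is
      spent on \<open>b'\<close>.\<close>
    define d where "d = e / (2 * (D + 1))"
    have d: "d > 0" using e D by (simp add: d_def)
    define b' where "b' = b + e / 2"
    have "ereal b < ereal b'" using e by (simp add: b'_def)
    then have "ln_dens l2 < ereal b'" using b by (rule le_less_trans[rotated])
    from ln_dens_lessD[OF this] have E2: "\<forall>\<^sub>F a in at_top. \<forall>\<^sub>F r in at_top. l2 r (a * r) < ereal (b' * ln a)" .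
    have "ln_dens l3 < ereal d" using l3(1) d by simp
    from ln_dens_lessD[OF this] have E3: "\<forall>\<^sub>F a in at_top. \<forall>\<^sub>F r in at_top. l3 r (a * r) < ereal (d * ln a)" .
    have sc: "filterlim (\<lambda>a::real. c * a) at_top at_top" if "c > 0" for c
      using that by (intro filterlim_tendsto_pos_mult_at_top[OF tendsto_const _ filterlim_ident])
    have E2': "\<forall>\<^sub>F a in at_top. \<forall>\<^sub>F r in at_top. l2 r ((8 * a) * r) < ereal (b' * ln (8 * a))"
      by (rule eventually_compose_filterlim[OF E2 sc]) simp
    have E3': "\<forall>\<^sub>F a in at_top. \<forall>\<^sub>F r in at_top. l3 r ((32 * a) * r) < ereal (d * ln (32 * a))"
      by (rule eventually_compose_filterlim[OF E3 sc]) simp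
    define g where "g = (\<lambda>a. (1 / ln a) * (b' * ln (8 * a) + D * (1 + d * ln (32 * a))))"
    have ev: "\<forall>\<^sub>F a in at_top. ereal (1 / ln a) * Limsup at_top (\<lambda>r. l1 r (a * r)) \<le> ereal (g a)"
      using E2' E3' eventually_gt_at_top[of "1::real"]
    proof eventually_elim
      case (elim a)
      have "\<forall>\<^sub>F r in at_top. l2 (r / 2) ((8 * a) * (r / 2)) < ereal (b' * ln (8 * a))"
        using eventually_compose_filterlim[OF elim(1) sc[of "1/2"]] by simp
      moreover have "\<forall>\<^sub>F r in at_top. l3 (r / 4) ((32 * a) * (r / 4)) < ereal (d * ln (32 * a))"
        using eventually_compose_filterlim[OF elim(2) sc[of "1/4"]] by simp
      ultimately have "\<forall>\<^sub>F r in at_top. l1 r (a * r) \<le> ereal (b' * ln (8 * a) + D * (1 + d * ln (32 * a)))"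
        using eventually_ge_at_top[of T] eventually_gt_at_top[of 0]
      proof eventually_elim
        case (elim r)
        have "r \<le> a * r" using \<open>1 < a\<close> elim(4) by simp
        then have "l1 r (a * r) \<le> l2 (r / 2) (4 * (a * r)) + ereal D * (1 + l3 (r / 4) (8 * (a * r)))"
          using elim(3) by (intro le)
        also have "4 * (a * r) = (8 * a) * (r / 2)" by simp
        also have "8 * (a * r) = (32 * a) * (r / 4)" by simp
        also have "l2 (r / 2) ((8 * a) * (r / 2)) + ereal D * (1 + l3 (r / 4) ((32 * a) * (r / 4)))
           \<le> ereal (b' * ln (8 * a)) + ereal D * (1 + ereal (d * ln (32 * a)))"
          using elim(1,2) D by (intro add_mono ereal_mult_left_mono) auto
        finally show ?case by (simp add: one_ereal_def)
      qed
      then have "Limsup at_top (\<lambda>r. l1 r (a * r)) \<le> ereal (b' * ln (8 * a) + D * (1 + d * ln (32 * a)))"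
        by (rule Limsup_bounded)
      then have "ereal (1 / ln a) * Limsup at_top (\<lambda>r. l1 r (a * r)) \<le> ereal (1 / ln a) * ereal (b' * ln (8 * a) + D * (1 + d * ln (32 * a)))"
        using \<open>1 < a\<close> by (intro ereal_mult_left_mono) auto
      then show ?case by (simp add: g_def)
    qed
    have glim: "(g \<longlongrightarrow> b' + D * d) at_top"
    proof -
      have i: "((\<lambda>a::real. 1 / ln a) \<longlongrightarrow> 0) at_top"
        by (rule tendsto_divide_0[OF tendsto_const]) (rule filterlim_mono[OF ln_at_top at_top_le_at_infinity order_refl])
      have "((\<lambda>a. b' * (ln 8 * (1 / ln a) + 1) + D * (1 / ln a + d * (ln 32 * (1 / ln a) + 1))) \<longlongrightarrow> b' * (ln 8 * 0 + 1) + D * (0 + d * (ln 32 * 0 + 1))) at_top"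
        by (intro tendsto_intros i)
      moreover have "\<forall>\<^sub>F a in at_top. b' * (ln 8 * (1 / ln a) + 1) + D * (1 / ln a + d * (ln 32 * (1 / ln a) + 1)) = g a"
        using eventually_gt_at_top[of "1::real"]
      proof eventually_elim
        case (elim a)
        have "ln a \<noteq> 0" "ln (8 * a) = ln 8 + ln a" "ln (32 * a) = ln 32 + ln a" using elim by (auto simp: ln_mult)
        then show ?case unfolding g_def by (simp add: field_simps)
      qed
      ultimately show ?thesis by (simp add: filterlim_cong[OF refl refl])
    qed
    have "ln_dens l1 \<le> Limsup at_top (\<lambda>a. ereal (g a))" unfolding ln_dens_def by (rule Limsup_mono[OF ev])
    also have "\<dots> = ereal (b' + D * d)" by (intro lim_imp_Limsup tendsto_intros glim) simp
    also have "b' + D * d \<le> b + e"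
    proof -
      have "D * d = e / 2 * (D / (D + 1))" using D by (simp add: d_def)
      also have "\<dots> \<le> e / 2 * 1" using e D by (intro mult_left_mono) auto
      finally show ?thesis by (simp add: b'_def)
    qed
    finally show "ln_dens l1 \<le> ereal b + ereal e" by simp
  qed
qed

text \<open>The measure of the truncated set is monotone in the endpoint, hence Borel measurable
  although \<open>E\<close> is only Lebesgue measurable.\<close>

lemma qE_measurable:
  assumes E: "E \<in> sets lebesgue"
  shows "qE E \<in> borel_measurable borel"
proof -
  define m where "m = (\<lambda>x. measure lebesgue (E \<inter> {0..x}))"
  have "mono m" unfolding m_def
    by (intro monoI measure_mono_fmeasurable) (use E in \<open>auto intro!: bounded_set_imp_lmeasurable simp: bounded_Int\<close>)
  then have [measurable]: "m \<in> borel_measurable borel" by (rule borel_measurable_mono)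
  have "qE E = (\<lambda>x. if m \<bar>x\<bar> = 0 then 0 else m \<bar>x\<bar> * ln (exp 1 * \<bar>x\<bar> / m \<bar>x\<bar>))"
    by (simp add: fun_eq_iff qE_def Let_def m_def)
  also have "\<dots> \<in> borel_measurable borel" by measurable
  finally show ?thesis .
qed

text \<open>Both alternatives say that Q grows at most like a power: the first directly with p = 2 +
  N, the second because y Q' \<le> c Q makes the derivative of Q/y^c nonpositive.\<close>

lemma regular_imp_power_antimono:
  fixes Q :: "real \<Rightarrow> real"
  assumes Qn: "\<And>s. Q s \<ge> 0"
    and reg: "(\<exists>N::real. N \<ge> 0 \<and> (\<exists>A. antimono_on {A<..} (\<lambda>s. Q s / s powr (2 + N))))
      \<or> (\<exists>A Q'. (\<forall>s>A. (Q has_real_derivative Q' s) (at s)) \<and> continuous_on {A<..} Q'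
          \<and> Limsup at_top (\<lambda>y. ereal (y * Q' y / Q y)) < \<infinity>)"
  obtains p A where "p \<ge> 0" "\<And>x y. A < x \<Longrightarrow> x \<le> y \<Longrightarrow> Q y / y powr p \<le> Q x / x powr p"
  using reg
proof (elim disjE exE conjE)
  fix N A :: real assume "N \<ge> 0" and a: "antimono_on {A<..} (\<lambda>s. Q s / s powr (2 + N))"
  show thesis
  proof (rule that[of "2 + N" A])
    show "Q y / y powr (2 + N) \<le> Q x / x powr (2 + N)" if "A < x" "x \<le> y" for x y
      using monotone_onD[OF a, of x y] that by simp
  qed (use \<open>N \<ge> 0\<close> in simp)
next
  fix A Q' assume d: "\<forall>s>A. (Q has_real_derivative Q' s) (at s)"
    and L: "Limsup at_top (\<lambda>y. ereal (y * Q' y / Q y)) < \<infinity>"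
  obtain c :: nat where "Limsup at_top (\<lambda>y. ereal (y * Q' y / Q y)) < ereal c"
    using less_PInf_Ex_of_nat[of "Limsup at_top (\<lambda>y. ereal (y * Q' y / Q y))"] L by auto
  then have "\<forall>\<^sub>F y in at_top. ereal (y * Q' y / Q y) < ereal c" by (rule Limsup_lessD)
  then obtain Y where Y: "\<And>y. y \<ge> Y \<Longrightarrow> y * Q' y / Q y < real c" by (auto simp: eventually_at_top_linorder)
  define A' where "A' = max 1 (max A Y)"
  show thesis
  proof (rule that[of "real c" A'])
    fix x y :: real assume xy: "A' < x" "x \<le> y"
    show "Q y / y powr real c \<le> Q x / x powr real c"
    proof (rule DERIV_nonpos_imp_nonincreasing[OF xy(2)])
      fix z assume z: "x \<le> z" "z \<le> y"
      then have z1: "z > 1" "z > A" "z \<ge> Y" using xy by (auto simp: A'_def)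
      have dz: "(Q has_real_derivative Q' z) (at z)" using d z1 by blast
      have key: "z * Q' z \<le> c * Q z"
      proof (cases "Q z = 0")
        case True
        \<comment> \<open>At a zero of Q the quotient in the hypothesis is 0 by convention and
          carries no information; but a zero of a nonnegative function is a minimum.\<close>
        have "Q' z = 0"
          by (rule DERIV_local_min[OF dz, of 1]) (use True Qn in auto)
        then show ?thesis using True by simp
      next
        case False
        then have "Q z > 0" using Qn[of z] by simp
        then show ?thesis using Y[OF z1(3)] by (simp add: field_simps)
      qed
      have "((\<lambda>s. Q s / s powr real c) has_real_derivative (z * Q' z - c * Q z) / (z * z powr real c)) (at z)"
        using z1 dz by (auto intro!: derivative_eq_intros simp: field_simps powr_diff)
      moreover have "(z * Q' z - c * Q z) / (z * z powr real c) \<le> 0"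
        using key z1 by (intro divide_nonpos_nonneg) auto
      ultimately show "\<exists>D. ((\<lambda>s. Q s / s powr real c) has_real_derivative D) (at z) \<and> D \<le> 0" by blast
    qed
  qed simp
qed

theorem theorem2:
  fixes M u :: "complex \<Rightarrow> ereal" and \<mu> \<nu> :: "complex measure"
    and q0 :: "real \<Rightarrow> ereal" and q :: "real \<Rightarrow> real" and E :: "real set"
  assumes M_sh: "subharmonic_C M" and M_ne: "\<exists>z. M z \<noteq> -\<infinity>" and M_ft: "finite_type M"
      and u_sh: "subharmonic_C u" and u_ne: "\<exists>z. u z \<noteq> -\<infinity>" and u_ft: "finite_type u"
      and \<mu>: "riesz_measure M \<mu>" and \<nu>: "riesz_measure u \<nu>"
      and q0_nonneg: "\<forall>y. q0 y \<ge> 0"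
      and q0_meas: "q0 \<in> borel_measurable lebesgue"
      and q0_locint: "\<forall>a b. (\<integral>\<^sup>+ x. indicator {a..b} x * e2ennreal (q0 x) \<partial>lebesgue) < \<infinity>"
      and q0_growth: "Limsup at_infinity (\<lambda>y. q0 y / ereal \<bar>y\<bar>) < \<infinity>"
      and q_cont: "continuous_on UNIV q" and q_nonneg: "\<forall>y. q y \<ge> 0"
      and q_growth: "Limsup at_infinity (\<lambda>y. ereal (q y / \<bar>y\<bar>)) < 1"
      and E_sub: "E \<subseteq> {0..}" and E_meas: "E \<in> sets lebesgue"
      and main_ineq: "\<forall>y \<in> {0..} - E.
          u (\<i> * of_real y) + u (- \<i> * of_real y)
            \<le> circle_mean M (\<i> * of_real y) (q y) + circle_mean M (- \<i> * of_real y) (q (- y))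
               + q0 y + q0 (- y)"
      and Q_reg: "(\<exists>N::real. N \<ge> 0 \<and> (\<exists>A. antimono_on {A<..}
                       (\<lambda>s. (q s + q (- s)) / s powr (2 + N))))
                \<or> (\<exists>A Q'. (\<forall>s>A. ((\<lambda>s. q s + q (- s)) has_real_derivative Q' s) (at s))
                          \<and> continuous_on {A<..} Q'
                          \<and> Limsup at_top (\<lambda>y. ereal (y * Q' y / (q y + q (- y)))) < \<infinity>)"
      and J_dens: "ln_dens (J_R (\<lambda>x. q0 x + ereal (q x) + ereal (qE E x))) = 0"
  shows "ln_dens (l_meas \<nu>) \<le> min (ln_dens (l_rh \<mu>)) (ln_dens (l_lh \<mu>))
         \<and> min (ln_dens (l_rh \<mu>)) (ln_dens (l_lh \<mu>)) \<le> ln_dens (l_meas \<mu>)"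
proof -
  define v where "v = (\<lambda>x. q0 x + ereal (q x) + ereal (qE E x))"
  obtain B1 where B1: "B1 > 0" "\<And>t z. t \<ge> 1 \<Longrightarrow> cmod z \<le> 20 * t \<Longrightarrow> M z \<le> ereal (B1 * t)"
    using finite_type_linear_bound[OF M_sh M_ft] by blast
  obtain B2 where B2: "B2 > 0" "\<And>t z. t \<ge> 1 \<Longrightarrow> cmod z \<le> 20 * t \<Longrightarrow> u z \<le> ereal (B2 * t)"
    using finite_type_linear_bound[OF u_sh u_ft] by blast
  \<comment> \<open>One level for both functions, as the pairwise comparison of defects
    requires.\<close>
  define B where "B = max B1 B2"
  have B: "B > 0" using B1 by (simp add: B_def)
  have above: "M z \<le> ereal (B * t)" "u z \<le> ereal (B * t)" if "t \<ge> 1" "cmod z \<le> 20 * t" for t z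
  proof -
    have "B1 * t \<le> B * t" "B2 * t \<le> B * t" using that(1) by (auto simp: B_def intro!: mult_right_mono)
    then show "M z \<le> ereal (B * t)" "u z \<le> ereal (B * t)"
      using B1(2)[OF that] B2(2)[OF that] by (meson ereal_less_eq(3) order_trans)+
  qed
  obtain C1 T1 where C1: "C1 > 0" "T1 \<ge> 1" "\<And>t. t \<ge> T1 \<Longrightarrow> ring_scale M \<mu> B C1 t"
    using ring_scale_exists[OF M_sh \<mu> M_ne B above(1)] by blast
  obtain C2 T2 where C2: "C2 > 0" "T2 \<ge> 1" "\<And>t. t \<ge> T2 \<Longrightarrow> ring_scale u \<nu> B C2 t"
    using ring_scale_exists[OF u_sh \<nu> u_ne B above(2)] by blast
  define C where "C = max C1 C2"
  obtain k \<kappa> f f1 where mol: "mollifier k \<kappa> f f1" using mollifier_exists by blast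
  obtain p A where pA: "p \<ge> 0" "\<And>x y. A < x \<Longrightarrow> x \<le> y \<Longrightarrow> (q y + q (- y)) / y powr p \<le> (q x + q (- x)) / x powr p"
    using regular_imp_power_antimono[OF _ Q_reg] q_nonneg by (metis add_nonneg_nonneg)
  have "\<forall>\<^sub>F y in at_infinity. ereal (q y / \<bar>y\<bar>) < 1" by (rule Limsup_lessD[OF q_growth])
  then obtain T3 where T3: "\<And>y. norm y \<ge> T3 \<Longrightarrow> q y / \<bar>y\<bar> < 1" unfolding eventually_at_infinity by auto
  \<comment> \<open>The last entry gives \<open>T / 2 > A\<close>, because the windows of the rings
    begin at half the scale.\<close>
  define T where "T = max (max T1 T2) (max T3 (2 * \<bar>A\<bar> + 2))"
  have T: "T \<ge> 1" "T \<ge> T1" "T \<ge> T2" "T \<ge> T3" "T / 2 > A" using C1(2) by (auto simp: T_def)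
  have rp: "ring_pair M u \<mu> \<nu> B C t k \<kappa> f f1 s' s" if "t \<ge> T" "s' = 1 \<or> s' = -1" "s = 1 \<or> s = -1" for t s' s
    using ring_scale_mono[OF C1(3), of t C] ring_scale_mono[OF C2(3), of t C] that T mol
    unfolding ring_pair_def ring_side_def ring_side_axioms_def by (auto simp: C_def)
  have vm: "(\<lambda>x. e2ennreal ((v x + v (- x)) / ereal (x\<^sup>2))) \<in> borel_measurable lebesgue"
  proof -
    have neg: "(\<lambda>y::real. - y) \<in> lebesgue \<rightarrow>\<^sub>M lebesgue"
      using lebesgue_affine_measurable[of "\<lambda>_::real. -1" 0] by simp
    have "(\<lambda>x. ereal (q x) + ereal (qE E x)) \<in> borel_measurable borel"
      using borel_measurable_continuous_onI[OF q_cont] qE_measurable[OF E_meas] by measurable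
    then have "(\<lambda>x. ereal (q x) + ereal (qE E x)) \<in> borel_measurable lebesgue"
      by (intro measurable_completion) simp
    then have v1: "v \<in> borel_measurable lebesgue"
      unfolding v_def add.assoc using q0_meas by (rule borel_measurable_ereal_add[rotated])
    have v2: "(\<lambda>x. v (- x)) \<in> borel_measurable lebesgue" using measurable_compose[OF neg v1] .
    have "(\<lambda>x::real. ereal (x\<^sup>2)) \<in> borel_measurable borel" by measurable
    then have sq: "(\<lambda>x::real. ereal (x\<^sup>2)) \<in> borel_measurable lebesgue"
      by (intro measurable_completion) simp
    show ?thesis
      by (rule measurable_compose[OF borel_measurable_ereal_divide[OF borel_measurable_ereal_add[OF v1 v2] sq] measurable_e2ennreal])
  qed
  have ineq: "u (Complex 0 y) + u (Complex 0 (- y)) \<le> circle_mean M (Complex 0 y) (q y) + circle_mean M (Complex 0 (- y)) (q (- y)) + q0 y + q0 (- y)"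
    if "T \<le> y" "y \<notin> E" for y
  proof -
    have "\<i> * of_real y = Complex 0 y" "- \<i> * of_real y = Complex 0 (- y)" by (simp_all add: complex_eq_iff)
    then show ?thesis using bspec[OF main_ineq, of y] that T(1) by simp
  qed
  have side: "\<exists>D>0. \<forall>r R. 2 * T \<le> r \<longrightarrow> r \<le> R \<longrightarrow>
     l_side \<nu> s r R \<le> l_side \<mu> s' (r / 2) (4 * R) + ennreal D * (1 + J_int v (r / 4) (8 * R))"
    if s: "s' = 1 \<or> s' = -1" "s = 1 \<or> s = -1" for s' s
  proof -
    obtain D where "D > 0" "\<And>r R. 2 * T \<le> r \<Longrightarrow> r \<le> R \<Longrightarrow>
       l_side \<nu> s r R \<le> l_side \<mu> s' (r / 2) (4 * R) + ennreal D * (1 + J_int v (r / 4) (8 * R))"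
    proof (rule side_comparison[where T=T and M=M and u=u and \<mu>=\<mu> and \<nu>=\<nu> and s=s and s'=s' and q=q and ?q0.0=q0 and E=E and p=p])
      show "ring_pair M u \<mu> \<nu> B C t k \<kappa> f f1 s' s" if "T \<le> t" for t using rp[OF that s] .
      show "q y \<le> \<bar>y\<bar>" if "T \<le> \<bar>y\<bar>" for y
      proof -
        have "q y / \<bar>y\<bar> < 1" "\<bar>y\<bar> > 0" using T3[of y] that T by auto
        then show ?thesis by (simp add: divide_less_eq)
      qed
      show "(q y + q (- y)) / y powr p \<le> (q x + q (- x)) / x powr p" if "T / 2 \<le> x" "x \<le> y" for x y
        using pA(2)[of x y] that T(5) by simp
      show "(\<lambda>x. e2ennreal ((q0 x + ereal (q x) + ereal (qE E x) + (q0 (- x) + ereal (q (- x)) + ereal (qE E (- x)))) / ereal (x\<^sup>2))) \<in> borel_measurable lebesgue"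
        using vm by (simp add: v_def)
    qed (use T pA q_cont q_nonneg q0_nonneg q0_meas E_meas ineq in \<open>auto simp: v_def\<close>)
    then show ?thesis by blast
  qed
  have JR: "enn2ereal (J_int v r R) = ereal (2 * pi) * J_R v r R" for r R
  proof -
    have "ereal (2 * pi) * J_R v r R = (ereal (2 * pi) * ereal (1 / (2 * pi))) * enn2ereal (J_int v r R)"
      unfolding J_R_def J_int_def by (simp only: mult.assoc)
    then show ?thesis by (simp add: one_ereal_def[symmetric])
  qed
  have J0: "J_R v r R \<ge> 0" for r R by (simp add: J_R_def)
  \<comment> \<open>Both sides of \<nu> are compared with the same side of \<mu>; since that side is
    arbitrary, the minimum follows.\<close>
  have upper: "ln_dens (l_meas \<nu>) \<le> ln_dens (\<lambda>r R. enn2ereal (l_side \<mu> s' r R))" if s': "s' = 1 \<or> s' = -1" for s'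
  proof -
    obtain D1 where D1: "D1 > 0" "\<And>r R. 2 * T \<le> r \<Longrightarrow> r \<le> R \<Longrightarrow>
       l_side \<nu> 1 r R \<le> l_side \<mu> s' (r / 2) (4 * R) + ennreal D1 * (1 + J_int v (r / 4) (8 * R))"
      using side[OF s', of 1] by blast
    obtain D2 where D2: "D2 > 0" "\<And>r R. 2 * T \<le> r \<Longrightarrow> r \<le> R \<Longrightarrow>
       l_side \<nu> (-1) r R \<le> l_side \<mu> s' (r / 2) (4 * R) + ennreal D2 * (1 + J_int v (r / 4) (8 * R))"
      using side[OF s', of "-1"] by blast
    define Dm where "Dm = max D1 D2"
    have Dm: "Dm > 0" "D1 \<le> Dm" "D2 \<le> Dm" using D1(1) by (auto simp: Dm_def)
    \<comment> \<open>The factor \<open>2 * pi\<close> passes from \<open>J_int\<close> to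
      \<open>J_R\<close>, using 1 + 2 pi J \<le> 2 pi (1 + J).\<close>
    define D where "D = Dm * (2 * pi)"
    have D0: "D \<ge> 0" using Dm(1) by (simp add: D_def)
    show ?thesis
    proof (rule ln_dens_compare[where T="2 * T" and D=D and ?l3.0="J_R v"])
      fix r R assume r: "2 * T \<le> r" "r \<le> R"
      have "max (l_side \<nu> (-1) r R) (l_side \<nu> 1 r R) \<le> l_side \<mu> s' (r / 2) (4 * R) + ennreal (Dm) * (1 + J_int v (r / 4) (8 * R))"
        using D1(2)[OF r] D2(2)[OF r]
        by (auto intro!: order_trans[OF D1(2)[OF r]] order_trans[OF D2(2)[OF r]] add_left_mono mult_right_mono ennreal_leI Dm)
      then have "enn2ereal (max (l_side \<nu> (-1) r R) (l_side \<nu> 1 r R)) \<le> enn2ereal (l_side \<mu> s' (r / 2) (4 * R) + ennreal (Dm) * (1 + J_int v (r / 4) (8 * R)))"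
        by (simp add: less_eq_ennreal.rep_eq)
      also have "\<dots> = enn2ereal (l_side \<mu> s' (r / 2) (4 * R)) + ereal (Dm) * (1 + ereal (2 * pi) * J_R v (r / 4) (8 * R))"
        using Dm(1) by (simp add: plus_ennreal.rep_eq times_ennreal.rep_eq one_ennreal.rep_eq JR)
      also have "\<dots> \<le> enn2ereal (l_side \<mu> s' (r / 2) (4 * R)) + ereal D * (1 + J_R v (r / 4) (8 * R))"
      proof (intro add_left_mono)
        have "1 + ereal (2 * pi) * J_R v (r / 4) (8 * R) \<le> ereal (2 * pi) * 1 + ereal (2 * pi) * J_R v (r / 4) (8 * R)"
          using pi_gt3 by (intro add_right_mono) (simp add: one_ereal_def)
        also have "\<dots> = ereal (2 * pi) * (1 + J_R v (r / 4) (8 * R))"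
          using J0 by (intro ereal_left_distrib[symmetric, THEN trans] ereal_right_distrib[symmetric]) auto
        finally have "ereal (Dm) * (1 + ereal (2 * pi) * J_R v (r / 4) (8 * R)) \<le> ereal (Dm) * (ereal (2 * pi) * (1 + J_R v (r / 4) (8 * R)))"
          using Dm(1) by (intro ereal_mult_left_mono) auto
        then show "ereal (Dm) * (1 + ereal (2 * pi) * J_R v (r / 4) (8 * R)) \<le> ereal D * (1 + J_R v (r / 4) (8 * R))"
          by (simp add: D_def mult.assoc[symmetric])
      qed
      finally show "l_meas \<nu> r R \<le> enn2ereal (l_side \<mu> s' (r / 2) (4 * R)) + ereal D * (1 + J_R v (r / 4) (8 * R))"
        by (auto simp: l_meas_def l_side_eq[symmetric] max_def less_eq_ennreal.rep_eq split: if_splits)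
    qed (use D0 J0 J_dens in \<open>auto simp: v_def\<close>)
  qed
  have "ln_dens (l_meas \<nu>) \<le> ln_dens (l_rh \<mu>)" "ln_dens (l_meas \<nu>) \<le> ln_dens (l_lh \<mu>)"
    using upper[of 1] upper[of "-1"] by (simp_all add: l_side_eq)
  moreover have "ln_dens (l_rh \<mu>) \<le> ln_dens (l_meas \<mu>)" by (rule ln_dens_mono) (simp add: l_meas_def)
  ultimately show ?thesis by (auto simp: min_le_iff_disj)
qed

end
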